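(* (ILW systems.) Let $0<\gamma<1$, $\alpha>1$, $T>0$, $\mu>3/2$, and let $g(\xi)=\frac{\alpha}{\gamma}|\xi|\coth|\xi|$ for $\xi\in\mathbb{R}\setminus\{0\}$, $g(0)=\frac{\alpha}{\gamma}$. Let $\zeta_0,u_0$ be real-valued smooth $1$-periodic functions, and assume that the $1$-periodic initial-value problem $$\zeta_{t}+\frac{1}{\gamma}(1+g(D))^{-1}\Big(1+\frac{\alpha-1}{\alpha}g(D)\Big)u_{x}=\frac{1}{\gamma}(1+g(D))^{-1}(\zeta u)_{x},$$ $$u_{t}+(1-\gamma)\zeta_{x}=\frac{1}{2\gamma}\partial_{x}(u^{2}),$$ $$\zeta(x,0)=\zeta_{0}(x),\qquad u(x,0)=u_{0}(x),$$ for $0\le x\le 1$, $0\le t\le T$, has a unique real-valued solution $(\zeta,u)$ with $\zeta,u\in C([0,T];H^{\mu})$. For each integer $N\ge1$ let $(\zeta_N,u_N)$ denote the Fourier-Galerkin semidiscretization, i.e. the real-valued solution with $\zeta_N(t),u_N(t)\in S_N$ of $$\zeta_{N,t}+\frac{1}{\gamma}(1+g(D))^{-1}\Big(1+\frac{\alpha-1}{\alpha}g(D)\Big)u_{N,x}=\frac{1}{\gamma}(1+g(D))^{-1}\partial_{x}P_{N}(\zeta_{N}u_{N}),$$ $$u_{N,t}+(1-\gamma)\zeta_{N,x}=\frac{1}{2\gamma}\partial_{x}P_{N}(u_{N}^{2}),$$ $$\zeta_{N}|_{t=0}=P_{N}\zeta_{0},\qquad u_{N}|_{t=0}=P_{N}u_{0}.$$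 Then there exist a constant $C$ independent of $N$ and an integer $N_0$ such that for all $N\ge N_0$ the solution $(\zeta_N,u_N)$ exists on $[0,T]$ and $$\max_{0\leq t\leq T}\big(\|\zeta_{N}-\zeta\|+\|u_{N}-u\|\big)\leq C N^{1-\mu}.$$
   Context: All functions of $x$ are $1$-periodic. $\|\cdot\|$ is the norm of $L^2=L^2(0,1)$. For $k\in\mathbb{Z}$, $\widehat v(k)=\int_0^1 v(x)e^{-2\pi i kx}\,dx$ is the $k$th Fourier coefficient. For real $\mu\ge 0$, $H^\mu$ is the $L^2$-based Sobolev space of $1$-periodic functions with norm $\|v\|_\mu=\big(\sum_{k\in\mathbb{Z}}(1+k^2)^\mu|\widehat v(k)|^2\big)^{1/2}$. For an even function $m:\mathbb{R}\to\mathbb{R}$, the operator $m(D)$ is the Fourier multiplier $\widehat{m(D)v}(k)=m(2\pi k)\widehat v(k)$; in particular $(1+g(D))^{-1}$ has symbol $1/(1+g)$. For an integer $N\ge1$, $S_N=\mathrm{span}\{e^{2\pi i kx}: k\in\mathbb{Z},\,-N\le k\le N\}$, and $P_N$ is the $L^2$-projection onto $S_N$, $P_Nv=\sum_{|k|\le N}\widehat v(k)e^{2\pi i kx}$. The semidiscrete system is an initial-value problem for a system of ordinary differential equations, so it has a unique local-in-time solution. *)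

theory Defs
  imports "HOL-Analysis.Analysis"
begin

text \<open>Functions of \<open>x\<close> are complex-valued functions on the real line; a space-time function
  \<open>w\<close> is curried with time first, so that \<open>w t\<close> is its spatial profile.\<close>

definition periodic1 :: "(real \<Rightarrow> complex) \<Rightarrow> bool" where
  "periodic1 v \<longleftrightarrow> (\<forall>x. v (x + 1) = v x)"

definition real_valued :: "(real \<Rightarrow> complex) \<Rightarrow> bool" where
  "real_valued v \<longleftrightarrow> (\<forall>x. v x \<in> \<real>)"

definition dx :: "(real \<Rightarrow> complex) \<Rightarrow> real \<Rightarrow> complex" where
  "dx v = (\<lambda>x. vector_derivative v (at x))"

definition smooth :: "(real \<Rightarrow> complex) \<Rightarrow> bool" where
  "smooth v \<longleftrightarrow> (\<forall>n x. ((dx ^^ n) v) differentiable (at x))"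

definition square_integrable :: "(real \<Rightarrow> complex) \<Rightarrow> bool" where
  "square_integrable v \<longleftrightarrow>
     set_borel_measurable lborel {0..1} v \<and> set_integrable lborel {0..1} (\<lambda>x. (cmod (v x))\<^sup>2)"

definition L2_norm :: "(real \<Rightarrow> complex) \<Rightarrow> real" where
  "L2_norm v = sqrt (LBINT x:{0..1}. (cmod (v x))\<^sup>2)"

definition fourier_basis :: "int \<Rightarrow> real \<Rightarrow> complex" where
  "fourier_basis k x = cis (2 * pi * of_int k * x)"

definition fourier_coeff :: "(real \<Rightarrow> complex) \<Rightarrow> int \<Rightarrow> complex" where
  "fourier_coeff v k = (CLBINT x:{0..1}. v x * cis (- 2 * pi * of_int k * x))"

definition sobolev_space :: "real \<Rightarrow> (real \<Rightarrow> complex) set" where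
  "sobolev_space \<mu> = {v. periodic1 v \<and> square_integrable v \<and>
     (\<lambda>k::int. (1 + (of_int k)\<^sup>2) powr \<mu> * (cmod (fourier_coeff v k))\<^sup>2) summable_on UNIV}"

definition sobolev_norm :: "real \<Rightarrow> (real \<Rightarrow> complex) \<Rightarrow> real" where
  "sobolev_norm \<mu> v =
     sqrt (\<Sum>\<^sub>\<infinity>k::int. (1 + (of_int k)\<^sup>2) powr \<mu> * (cmod (fourier_coeff v k))\<^sup>2)"

definition continuous_in_sobolev :: "real \<Rightarrow> real \<Rightarrow> (real \<Rightarrow> real \<Rightarrow> complex) \<Rightarrow> bool" where
  "continuous_in_sobolev T \<mu> w \<longleftrightarrow>
     (\<forall>t\<in>{0..T}. w t \<in> sobolev_space \<mu>) \<and>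
     (\<forall>t\<in>{0..T}. ((\<lambda>s. sobolev_norm \<mu> (\<lambda>x. w s x - w t x)) \<longlongrightarrow> 0) (at t within {0..T}))"

text \<open>\<open>fourier_multiplier m\<close> is \<open>m(D)\<close>. It is realised as the pointwise sum of the Fourier series
  with coefficients \<open>m(2 \<pi> k) v^(k)\<close>, which is meaningful when these are absolutely summable. This
  holds wherever the operator is used below: the symbols are bounded, and the arguments are
  derivatives of elements of \<open>H\<^sup>\<mu>\<close> with \<open>\<mu> > 3/2\<close> or trigonometric polynomials.\<close>

definition fourier_multiplier :: "(real \<Rightarrow> real) \<Rightarrow> (real \<Rightarrow> complex) \<Rightarrow> real \<Rightarrow> complex" where
  "fourier_multiplier m v x =
     (\<Sum>\<^sub>\<infinity>k::int. of_real (m (2 * pi * of_int k)) * fourier_coeff v k * fourier_basis k x)"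

definition trig_space :: "nat \<Rightarrow> (real \<Rightarrow> complex) set" where
  "trig_space N = {v. \<exists>c. v = (\<lambda>x. \<Sum>k\<in>{- int N..int N}. c k * fourier_basis k x)}"

definition trig_proj :: "nat \<Rightarrow> (real \<Rightarrow> complex) \<Rightarrow> real \<Rightarrow> complex" where
  "trig_proj N v x = (\<Sum>k\<in>{- int N..int N}. fourier_coeff v k * fourier_basis k x)"

definition ilw_g :: "real \<Rightarrow> real \<Rightarrow> real \<Rightarrow> real" where
  "ilw_g \<gamma> \<alpha> \<xi> =
     (if \<xi> = 0 then \<alpha> / \<gamma> else \<alpha> / \<gamma> * \<bar>\<xi>\<bar> * (cosh \<bar>\<xi>\<bar> / sinh \<bar>\<xi>\<bar>))"

definition ilw_inv :: "real \<Rightarrow> real \<Rightarrow> (real \<Rightarrow> complex) \<Rightarrow> real \<Rightarrow> complex" where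
  "ilw_inv \<gamma> \<alpha> = fourier_multiplier (\<lambda>\<xi>. 1 / (1 + ilw_g \<gamma> \<alpha> \<xi>))"

text \<open>The composition \<open>(1 + g(D))^(-1) (1 + (\<alpha> - 1) / \<alpha> g(D))\<close> is a single multiplier whose symbol is
  the product of the two symbols. Applying the factors one after the other would pass through the
  unbounded operator \<open>g(D)\<close>, whose values need not be functions.\<close>

definition ilw_lin :: "real \<Rightarrow> real \<Rightarrow> (real \<Rightarrow> complex) \<Rightarrow> real \<Rightarrow> complex" where
  "ilw_lin \<gamma> \<alpha> = fourier_multiplier
     (\<lambda>\<xi>. 1 / (1 + ilw_g \<gamma> \<alpha> \<xi>) * (1 + (\<alpha> - 1) / \<alpha> * ilw_g \<gamma> \<alpha> \<xi>))"

text \<open>Time derivatives are taken within \<open>[0,T]\<close>, hence are one-sided at the endpoints.\<close>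

definition dt_exists :: "real \<Rightarrow> (real \<Rightarrow> real \<Rightarrow> complex) \<Rightarrow> real \<Rightarrow> real \<Rightarrow> bool" where
  "dt_exists T w t x \<longleftrightarrow> (\<lambda>s. w s x) differentiable (at t within {0..T})"

definition dt :: "real \<Rightarrow> (real \<Rightarrow> real \<Rightarrow> complex) \<Rightarrow> real \<Rightarrow> real \<Rightarrow> complex" where
  "dt T w t x = vector_derivative (\<lambda>s. w s x) (at t within {0..T})"

text \<open>An element of \<open>H\<^sup>\<mu>\<close> with \<open>\<mu> > 3/2\<close> has a unique continuous representative, and that one is
  continuously differentiable. Each \<open>\<zeta> t\<close> and \<open>u t\<close> is taken to be this representative. The right-hand
  sides of the evolution equations are then continuous in \<open>(t, x)\<close>, so the equations hold in the
  classical pointwise sense.\<close>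

definition ilw_solution ::
  "real \<Rightarrow> real \<Rightarrow> real \<Rightarrow> real \<Rightarrow> (real \<Rightarrow> complex) \<Rightarrow> (real \<Rightarrow> complex) \<Rightarrow>
   (real \<Rightarrow> real \<Rightarrow> complex) \<Rightarrow> (real \<Rightarrow> real \<Rightarrow> complex) \<Rightarrow> bool" where
  "ilw_solution \<gamma> \<alpha> T \<mu> \<zeta>\<^sub>0 u\<^sub>0 \<zeta> u \<longleftrightarrow>
     continuous_in_sobolev T \<mu> \<zeta> \<and> continuous_in_sobolev T \<mu> u \<and>
     (\<forall>t\<in>{0..T}. real_valued (\<zeta> t) \<and> real_valued (u t) \<and>
        continuous_on UNIV (\<zeta> t) \<and> continuous_on UNIV (u t)) \<and>
     (\<forall>t\<in>{0..T}. \<forall>x.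
        dt_exists T \<zeta> t x \<and> dt_exists T u t x \<and>
        dt T \<zeta> t x + of_real (1 / \<gamma>) * ilw_lin \<gamma> \<alpha> (dx (u t)) x
          = of_real (1 / \<gamma>) * ilw_inv \<gamma> \<alpha> (dx (\<lambda>y. \<zeta> t y * u t y)) x \<and>
        dt T u t x + of_real (1 - \<gamma>) * dx (\<zeta> t) x
          = of_real (1 / (2 * \<gamma>)) * dx (\<lambda>y. (u t y)\<^sup>2) x) \<and>
     \<zeta> 0 = \<zeta>\<^sub>0 \<and> u 0 = u\<^sub>0"

definition ilw_galerkin_solution ::
  "real \<Rightarrow> real \<Rightarrow> real \<Rightarrow> nat \<Rightarrow> (real \<Rightarrow> complex) \<Rightarrow> (real \<Rightarrow> complex) \<Rightarrow>
   (real \<Rightarrow> real \<Rightarrow> complex) \<Rightarrow> (real \<Rightarrow> real \<Rightarrow> complex) \<Rightarrow> bool" where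
  "ilw_galerkin_solution \<gamma> \<alpha> T N \<zeta>\<^sub>0 u\<^sub>0 \<zeta>\<^sub>N u\<^sub>N \<longleftrightarrow>
     (\<forall>t\<in>{0..T}. \<zeta>\<^sub>N t \<in> trig_space N \<and> u\<^sub>N t \<in> trig_space N \<and>
        real_valued (\<zeta>\<^sub>N t) \<and> real_valued (u\<^sub>N t)) \<and>
     (\<forall>t\<in>{0..T}. \<forall>x.
        dt_exists T \<zeta>\<^sub>N t x \<and> dt_exists T u\<^sub>N t x \<and>
        dt T \<zeta>\<^sub>N t x + of_real (1 / \<gamma>) * ilw_lin \<gamma> \<alpha> (dx (u\<^sub>N t)) x
          = of_real (1 / \<gamma>) * ilw_inv \<gamma> \<alpha> (dx (trig_proj N (\<lambda>y. \<zeta>\<^sub>N t y * u\<^sub>N t y))) x \<and>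
        dt T u\<^sub>N t x + of_real (1 - \<gamma>) * dx (\<zeta>\<^sub>N t) x
          = of_real (1 / (2 * \<gamma>)) * dx (trig_proj N (\<lambda>y. (u\<^sub>N t y)\<^sup>2)) x) \<and>
     \<zeta>\<^sub>N 0 = trig_proj N \<zeta>\<^sub>0 \<and> u\<^sub>N 0 = trig_proj N u\<^sub>0"

end

theory Submission
  imports Defs
begin

text \<open>Write \<open>A\<close> for the bounded order-zero multiplier in front of \<open>u\<^sub>x\<close>. Since
  \<open>(1 + c g) / (1 + g) = c + (1 - c) / (1 + g)\<close> with \<open>c = (\<alpha> - 1) / \<alpha>\<close>, it is a positive constant
  plus an operator that gains one derivative. For the differences \<open>\<theta>\<close> of \<open>\<zeta>\<^sub>N\<close> and \<open>P\<^sub>N \<zeta>\<close>, and \<open>\<xi>\<close> of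
  \<open>u\<^sub>N\<close> and \<open>P\<^sub>N u\<close>, the energy \<open>(1 - \<gamma>) \<parallel>\<theta>\<parallel>\<^sup>2 + (A \<xi>, \<xi>)\<close> symmetrises the linear part. In the
  nonlinear part every term is smoothed by one derivative except \<open>(\<partial>\<^sub>x (u\<^sub>N\<^sup>2 - u\<^sup>2), \<xi>)\<close>, where
  integration by parts leaves \<open>\<integral> (P\<^sub>N u)\<^sub>x \<xi>\<^sup>2\<close> and a consistency error that costs one factor \<open>N\<close>.
  With \<open>n = (\<parallel>\<theta>\<parallel>\<^sup>2 + \<parallel>\<xi>\<parallel>\<^sup>2)\<^sup>1\<^sup>/\<^sup>2\<close> and the inverse inequality \<open>\<parallel>\<theta>\<parallel>\<^sub>\<infinity> \<le> C N\<^sup>1\<^sup>/\<^sup>2 \<parallel>\<theta>\<parallel>\<close> the energy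
  grows at most at the rate \<open>K (n\<^sup>2 + N\<^sup>1\<^sup>/\<^sup>2 n\<^sup>3 + N\<^sup>1\<^sup>-\<^sup>\<mu> n)\<close>. For \<open>\<mu> > 3 / 2\<close> and large \<open>N\<close> it
  therefore stays below the barrier \<open>N\<^sup>2\<^sup>-\<^sup>2\<^sup>\<mu> e\<^sup>G\<^sup>t\<close>. The same bound prevents blow-up of the
  Galerkin solution before time \<open>T\<close>.\<close>

subsection \<open>Fourier coefficients of continuous functions\<close>

text \<open>On the frequencies |k| <= N the exact and the Galerkin coefficients obey the same
  formula, so the energy compares them directly and only the products still see the tails. The
  weights \<open>1 - \<gamma>\<close> and \<open>lin_symbol / \<gamma>\<close> give the two coupling
  terms equal coefficients; their real parts cancel because the derivative symbol is imaginary. The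
  obstacle is that nothing uniform in N is known about the Galerkin solution in advance. Its slope
  never has to be bounded, only that of the truncated exact solution. This is why regularity is
  measured by absolutely summable Fourier series: truncation cannot increase such a norm, while it
  is not uniformly bounded in the sup norm. The size of the error matters in the cubic term, and
  only at a first contact with the barrier, where n^2 is a bounded multiple of
  \<open>N powr (2 - 2 * \<mu>)\<close>, so that N n^2 tends to 0 as N grows.\<close>

notation fourier_coeff (\<open>\<F>\<close>)

definition deriv_symbol :: "int \<Rightarrow> complex" where
  "deriv_symbol k = \<i> * of_real (2 * pi * of_int k)"

lemma cnj_deriv_symbol [simp]: "cnj (deriv_symbol k) = - deriv_symbol k"
  by (simp add: deriv_symbol_def)

lemma deriv_symbol_uminus: "deriv_symbol (- k) = - deriv_symbol k"
  by (simp add: deriv_symbol_def)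

lemma norm_deriv_symbol: "cmod (deriv_symbol k) = 2 * pi * \<bar>of_int k\<bar>"
  by (simp add: deriv_symbol_def norm_mult abs_mult)

lemma fourier_basis_0 [simp]: "fourier_basis 0 x = 1"
  by (simp add: fourier_basis_def)

lemma fourier_basis_add: "fourier_basis (j + k) x = fourier_basis j x * fourier_basis k x"
  by (simp add: fourier_basis_def cis_mult algebra_simps)

lemma fourier_basis_uminus: "fourier_basis (- k) x = cnj (fourier_basis k x)"
  by (simp add: fourier_basis_def cis_cnj)

lemma norm_fourier_basis [simp]: "cmod (fourier_basis k x) = 1"
  by (simp add: fourier_basis_def)

lemma fourier_basis_at_0 [simp]: "fourier_basis k 0 = 1"
  by (simp add: fourier_basis_def)

lemma fourier_basis_mult_cnj [simp]: "fourier_basis k x * cnj (fourier_basis k x) = 1"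
  by (simp add: complex_norm_square[symmetric])

lemma cis_2pi_int: "cis (2 * pi * of_int k) = 1"
  by (metis cis_multiple_2pi Ints_of_int)

lemma fourier_basis_periodic: "fourier_basis k (x + 1) = fourier_basis k x"
proof -
  have "fourier_basis k (x + 1) = cis (2 * pi * of_int k * x) * cis (2 * pi * of_int k)"
    unfolding fourier_basis_def by (simp add: cis_mult algebra_simps)
  then show ?thesis by (simp add: cis_2pi_int fourier_basis_def)
qed

lemma fourier_basis_at_1 [simp]: "fourier_basis k 1 = 1"
  using fourier_basis_periodic[of k 0] by simp

lemma has_vector_derivative_fourier_basis:
  "(fourier_basis k has_vector_derivative deriv_symbol k * fourier_basis k x) (at x within S)"
proof -
  have "((\<lambda>x. exp (deriv_symbol k * of_real x)) has_vector_derivative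
      deriv_symbol k * exp (deriv_symbol k * of_real x)) (at x within S)"
    by (auto intro!: derivative_eq_intros has_vector_derivative_real_field)
  moreover have "fourier_basis k = (\<lambda>x. exp (deriv_symbol k * of_real x))"
    by (auto simp: fourier_basis_def deriv_symbol_def cis_conv_exp mult_ac)
  ultimately show ?thesis by simp
qed

lemma continuous_on_fourier_basis [continuous_intros]: "continuous_on S (fourier_basis k)"
  unfolding fourier_basis_def by (intro continuous_intros)

lemma integrable_on_unit [intro]:
  fixes f :: "real \<Rightarrow> 'a::banach"
  assumes "continuous_on UNIV f" shows "f integrable_on {0..1}"
  using assms by (intro integrable_continuous_real) (auto intro: continuous_on_subset)

lemma set_integrable_unit:
  fixes f :: "real \<Rightarrow> 'a::euclidean_space"
  assumes "continuous_on UNIV f" shows "set_integrable lborel {0..1} f"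
  using assms by (intro borel_integrable_atLeastAtMost') (auto intro: continuous_on_subset)

text \<open>Bridge from the Lebesgue set integral to the gauge integral, where the fundamental
  theorem of calculus and the uniform limit theorems live. The functions treated below are
  continuous, so the two agree.\<close>

lemma fourier_coeff_integral:
  assumes "continuous_on UNIV v"
  shows "\<F> v k = integral {0..1} (\<lambda>x. v x * cnj (fourier_basis k x))"
proof -
  have "\<F> v k = (CLBINT x:{0..1}. v x * cnj (fourier_basis k x))"
    by (simp add: fourier_coeff_def fourier_basis_def cis_cnj)
  also have "\<dots> = integral {0..1} (\<lambda>x. v x * cnj (fourier_basis k x))"
    by (intro set_borel_integral_eq_integral set_integrable_unit continuous_intros assms)
  finally show ?thesis .
qed

lemma L2_norm_integral:
  assumes "continuous_on UNIV v"
  shows "L2_norm v = sqrt (integral {0..1} (\<lambda>x. (cmod (v x))\<^sup>2))"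
  unfolding L2_norm_def
  by (subst set_borel_integral_eq_integral) (auto intro!: set_integrable_unit continuous_intros assms)

lemma L2_norm_nonneg [simp]: "L2_norm v \<ge> 0"
  unfolding L2_norm_def set_lebesgue_integral_def
  by (auto intro!: integral_nonneg_AE)

lemma L2_norm_power2:
  assumes "continuous_on UNIV v"
  shows "(L2_norm v)\<^sup>2 = integral {0..1} (\<lambda>x. (cmod (v x))\<^sup>2)"
  unfolding L2_norm_integral[OF assms]
  by (intro real_sqrt_pow2 integral_nonneg) (auto intro!: integrable_on_unit continuous_intros assms)

lemma of_real_L2_norm_power2:
  assumes "continuous_on UNIV v"
  shows "complex_of_real ((L2_norm v)\<^sup>2) = integral {0..1} (\<lambda>x. v x * cnj (v x))"
proof -
  have "complex_of_real ((L2_norm v)\<^sup>2) = integral {0..1} (\<lambda>x. complex_of_real ((cmod (v x))\<^sup>2))"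
    using integral_linear[of "\<lambda>x. (cmod (v x))\<^sup>2" "{0..1}" complex_of_real] assms
    by (simp add: o_def bounded_linear_of_real integrable_on_unit continuous_intros L2_norm_power2)
  then show ?thesis by (simp only: complex_norm_square)
qed

lemma fourier_coeff_add:
  assumes "continuous_on UNIV v" "continuous_on UNIV w"
  shows "\<F> (\<lambda>x. v x + w x) k = \<F> v k + \<F> w k"
  using assms
  by (simp add: fourier_coeff_integral continuous_intros distrib_right integral_add integrable_on_unit)

lemma fourier_coeff_diff:
  assumes "continuous_on UNIV v" "continuous_on UNIV w"
  shows "\<F> (\<lambda>x. v x - w x) k = \<F> v k - \<F> w k"
  using assms
  by (simp add: fourier_coeff_integral continuous_intros left_diff_distrib integral_diff integrable_on_unit)

lemma fourier_coeff_cmult: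
  assumes "continuous_on UNIV v"
  shows "\<F> (\<lambda>x. c * v x) k = c * \<F> v k"
  using assms by (simp add: fourier_coeff_integral continuous_intros mult.assoc)

lemma fourier_coeff_zero [simp]: "\<F> (\<lambda>x. 0) k = 0"
  by (simp add: fourier_coeff_integral)

lemma fourier_coeff_sum:
  assumes "finite K" "\<And>j. j \<in> K \<Longrightarrow> continuous_on UNIV (v j)"
  shows "\<F> (\<lambda>x. \<Sum>j\<in>K. v j x) k = (\<Sum>j\<in>K. \<F> (v j) k)"
  using assms
  by (induction K rule: finite_induct) (auto simp: fourier_coeff_add continuous_intros)

lemma fourier_coeff_real:
  assumes "continuous_on UNIV v" "real_valued v"
  shows "\<F> v (- k) = cnj (\<F> v k)"
proof -
  have "(\<lambda>x. v x * fourier_basis k x) = (\<lambda>x. cnj (v x * cnj (fourier_basis k x)))"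
    using assms by (auto simp: real_valued_def Reals_cnj_iff)
  then have "integral {0..1} (\<lambda>x. v x * fourier_basis k x)
      = integral {0..1} (\<lambda>x. cnj (v x * cnj (fourier_basis k x)))" by metis
  also have "\<dots> = cnj (integral {0..1} (\<lambda>x. v x * cnj (fourier_basis k x)))"
    by (rule integral_cnj[symmetric])
  finally show ?thesis
    using assms by (simp add: fourier_coeff_integral fourier_basis_uminus)
qed

lemma norm_fourier_coeff_le:
  assumes "continuous_on UNIV v" "\<And>x. cmod (v x) \<le> M"
  shows "cmod (\<F> v k) \<le> M"
proof -
  have "cmod (integral {0..1} (\<lambda>x. v x * cnj (fourier_basis k x))) \<le> M * (1 - 0)"
    by (rule integral_bound) (auto intro!: continuous_intros continuous_on_subset[OF assms(1)]
        simp: norm_mult assms)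
  then show ?thesis using assms(1) by (simp add: fourier_coeff_integral)
qed

lemma integral_derivative_periodic:
  fixes f :: "real \<Rightarrow> 'a::banach"
  assumes "\<And>x. (f has_vector_derivative f' x) (at x)" "f 1 = f 0"
  shows "integral {0..1} f' = 0"
proof -
  have "(f' has_integral (f 1 - f 0)) {0..1}"
    by (rule fundamental_theorem_of_calculus)
      (auto intro: has_vector_derivative_at_within assms)
  then show ?thesis using assms by (simp add: integral_unique)
qed

text \<open>Integration by parts against \<open>fourier_basis (- k)\<close>; periodicity removes the
  boundary terms.\<close>

lemma fourier_coeff_derivative:
  assumes "\<And>x. (v has_vector_derivative v' x) (at x)" "continuous_on UNIV v'" "periodic1 v"
  shows "\<F> v' k = deriv_symbol k * \<F> v k"
proof -
  have cv: "continuous_on UNIV v"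
    using assms(1) by (meson continuous_at_imp_continuous_on has_vector_derivative_continuous)
  have v1: "v 1 = v 0" using assms(3)[unfolded periodic1_def, rule_format, of 0] by simp
  have "integral {0..1} (\<lambda>x. v x * (deriv_symbol (- k) * fourier_basis (- k) x)
      + v' x * fourier_basis (- k) x) = 0"
    by (rule integral_derivative_periodic[of "\<lambda>x. v x * fourier_basis (- k) x"])
      (auto intro!: has_vector_derivative_mult has_vector_derivative_fourier_basis assms simp: v1)
  moreover have "integral {0..1} (\<lambda>x. v x * (deriv_symbol (- k) * fourier_basis (- k) x)
      + v' x * fourier_basis (- k) x)
      = integral {0..1} (\<lambda>x. deriv_symbol (- k) * (v x * cnj (fourier_basis k x)))
        + integral {0..1} (\<lambda>x. v' x * cnj (fourier_basis k x))"
    by (subst integral_add[symmetric])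
      (auto intro!: integrable_on_unit continuous_intros cv assms simp: fourier_basis_uminus mult_ac)
  ultimately show ?thesis
    by (simp add: fourier_coeff_integral cv assms deriv_symbol_uminus)
qed

text \<open>Orthogonality without computing an integral: \<open>fourier_basis j\<close> is an
  eigenfunction of the derivative, and evaluating the coefficient of its derivative in two ways
  forces it to vanish unless the eigenvalues agree.\<close>

lemma fourier_coeff_basis:
  "\<F> (fourier_basis j) k = (if j = k then 1 else 0)"
proof -
  have "deriv_symbol j * \<F> (fourier_basis j) k
      = \<F> (\<lambda>x. deriv_symbol j * fourier_basis j x) k"
    by (simp add: fourier_coeff_cmult continuous_intros)
  also have "\<dots> = deriv_symbol k * \<F> (fourier_basis j) k"
    by (rule fourier_coeff_derivative)
      (auto intro!: has_vector_derivative_fourier_basis continuous_intros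
        simp: periodic1_def fourier_basis_periodic)
  finally have "deriv_symbol j = deriv_symbol k \<or> \<F> (fourier_basis j) k = 0"
    by (simp only: mult_cancel_right) blast
  moreover have "\<F> (fourier_basis k) k = 1"
    by (simp add: fourier_coeff_integral continuous_intros)
  ultimately show ?thesis by (auto simp: deriv_symbol_def)
qed

abbreviation freqs :: "nat \<Rightarrow> int set" where
  "freqs N \<equiv> {- int N..int N}"

lemma norm_deriv_symbol_le:
  assumes "k \<in> freqs N" shows "cmod (deriv_symbol k) \<le> 2 * pi * real N"
proof -
  have "\<bar>k\<bar> \<le> int N" using assms by auto
  then have "\<bar>real_of_int k\<bar> \<le> real N" by linarith
  then show ?thesis by (simp add: norm_deriv_symbol)
qed

lemma fourier_coeff_trig:
  assumes "finite K"
  shows "\<F> (\<lambda>x. \<Sum>j\<in>K. c j * fourier_basis j x) k = (if k \<in> K then c k else 0)"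
proof -
  have "\<F> (\<lambda>x. \<Sum>j\<in>K. c j * fourier_basis j x) k = (\<Sum>j\<in>K. \<F> (\<lambda>x. c j * fourier_basis j x) k)"
    using assms by (intro fourier_coeff_sum continuous_intros)
  also have "\<dots> = (\<Sum>j\<in>K. if k = j then c j else 0)"
    by (intro sum.cong) (auto simp: fourier_coeff_cmult fourier_coeff_basis continuous_intros)
  finally show ?thesis using assms by simp
qed

lemma integral_mult_cnj_trig:
  assumes "continuous_on UNIV v" "finite K"
  shows "integral {0..1} (\<lambda>x. v x * cnj (\<Sum>k\<in>K. c k * fourier_basis k x))
    = (\<Sum>k\<in>K. \<F> v k * cnj (c k))"
proof -
  have "integral {0..1} (\<lambda>x. v x * cnj (\<Sum>k\<in>K. c k * fourier_basis k x))
      = integral {0..1} (\<lambda>x. \<Sum>k\<in>K. cnj (c k) * (v x * cnj (fourier_basis k x)))"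
    by (simp add: sum_distrib_left mult_ac)
  also have "\<dots> = (\<Sum>k\<in>K. integral {0..1} (\<lambda>x. cnj (c k) * (v x * cnj (fourier_basis k x))))"
    using assms by (intro integral_sum) (auto intro!: integrable_on_unit continuous_intros)
  also have "\<dots> = (\<Sum>k\<in>K. \<F> v k * cnj (c k))"
    by (simp only: fourier_coeff_integral[OF assms(1)] integral_mult_right mult.commute)
  finally show ?thesis .
qed

lemma trig_norm_square:
  assumes "finite K"
  shows "integral {0..1} (\<lambda>x. (cmod (\<Sum>k\<in>K. c k * fourier_basis k x))\<^sup>2) = (\<Sum>k\<in>K. (cmod (c k))\<^sup>2)"
proof -
  let ?v = "\<lambda>x. \<Sum>k\<in>K. c k * fourier_basis k x"
  have cv: "continuous_on UNIV ?v" by (intro continuous_intros)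
  have "complex_of_real (integral {0..1} (\<lambda>x. (cmod (?v x))\<^sup>2)) = integral {0..1} (\<lambda>x. ?v x * cnj (?v x))"
    by (simp only: of_real_L2_norm_power2[OF cv] flip: L2_norm_power2[OF cv])
  also have "\<dots> = (\<Sum>k\<in>K. \<F> ?v k * cnj (c k))"
    using assms by (intro integral_mult_cnj_trig continuous_intros)
  also have "\<dots> = (\<Sum>k\<in>K. complex_of_real ((cmod (c k))\<^sup>2))"
    using assms by (intro sum.cong) (auto simp: fourier_coeff_trig complex_norm_square simp del: of_real_power)
  finally show ?thesis by (simp only: of_real_sum[symmetric] of_real_eq_iff)
qed

lemma cmod_diff_power2:
  "(cmod (a - b))\<^sup>2 = (cmod a)\<^sup>2 + (cmod b)\<^sup>2 - 2 * Re (a * cnj b)"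
  by (simp only: cmod_power2) (simp add: algebra_simps power2_eq_square)

lemma cmod_diff_power2_le: "(cmod (a - b))\<^sup>2 \<le> 2 * (cmod a)\<^sup>2 + 2 * (cmod b)\<^sup>2"
proof -
  have "(cmod (a - b))\<^sup>2 \<le> (cmod a + cmod b)\<^sup>2" by (intro power_mono norm_triangle_ineq4) simp
  also have "\<dots> \<le> 2 * (cmod a)\<^sup>2 + 2 * (cmod b)\<^sup>2"
    using sum_squares_bound[of "cmod a" "cmod b"] by (simp add: power2_sum)
  finally show ?thesis .
qed

text \<open>Expand the nonnegative squared distance from \<open>v\<close> to its partial sum over
  \<open>K\<close>: the cross term and the squared norm of the partial sum are both the left-hand
  side.\<close>

lemma bessel:
  assumes "continuous_on UNIV v" "finite K"
  shows "(\<Sum>k\<in>K. (cmod (\<F> v k))\<^sup>2) \<le> (L2_norm v)\<^sup>2"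
proof -
  let ?w = "\<lambda>x. \<Sum>k\<in>K. \<F> v k * fourier_basis k x"
  have cw: "continuous_on UNIV ?w" by (intro continuous_intros)
  have "integral {0..1} (\<lambda>x. v x * cnj (?w x)) = of_real (\<Sum>k\<in>K. (cmod (\<F> v k))\<^sup>2)"
    by (simp add: integral_mult_cnj_trig assms complex_norm_square del: cnj_sum of_real_power)
  then have re: "integral {0..1} (\<lambda>x. Re (v x * cnj (?w x))) = (\<Sum>k\<in>K. (cmod (\<F> v k))\<^sup>2)"
    using integral_linear[of "\<lambda>x. v x * cnj (?w x)" "{0..1}" Re] assms cw
    by (auto simp: o_def bounded_linear_Re integrable_on_unit continuous_intros simp del: cnj_sum)
  have "0 \<le> integral {0..1} (\<lambda>x. (cmod (v x - ?w x))\<^sup>2)"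
    by (intro integral_nonneg integrable_on_unit) (auto intro!: continuous_intros assms)
  also have "(\<lambda>x. (cmod (v x - ?w x))\<^sup>2)
      = (\<lambda>x. ((cmod (v x))\<^sup>2 + (cmod (?w x))\<^sup>2) - 2 * Re (v x * cnj (?w x)))"
    by (intro ext) (rule cmod_diff_power2)
  also have "integral {0..1} \<dots> = integral {0..1} (\<lambda>x. (cmod (v x))\<^sup>2)
      + integral {0..1} (\<lambda>x. (cmod (?w x))\<^sup>2) - 2 * integral {0..1} (\<lambda>x. Re (v x * cnj (?w x)))"
    using assms cw
    by (subst integral_diff integral_add integral_mult_right;
      (intro integrable_on_unit continuous_intros assms cw)?)+ simp
  finally show ?thesis
    using re trig_norm_square[OF assms(2), of "\<F> v"] assms
    by (simp add: L2_norm_power2)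
qed

subsection \<open>Uniqueness and inversion\<close>

text \<open>An inductive class instead of sums over explicit frequency ranges: closure under
  products is then a nested induction without bookkeeping of frequencies.\<close>

inductive trigonometric :: "(real \<Rightarrow> complex) \<Rightarrow> bool" where
  basis: "trigonometric (\<lambda>x. a * fourier_basis k x)"
| add: "trigonometric f \<Longrightarrow> trigonometric g \<Longrightarrow> trigonometric (\<lambda>x. f x + g x)"

lemma trigonometric_const: "trigonometric (\<lambda>x. a)"
  using trigonometric.basis[of a 0] by simp

lemma trigonometric_mult:
  assumes "trigonometric f" "trigonometric g"
  shows "trigonometric (\<lambda>x. f x * g x)"
  using assms(1)
proof induction
  case (basis a k)
  show ?case using assms(2)
  proof induction
    case (basis b j)
    have "(\<lambda>x. a * fourier_basis k x * (b * fourier_basis j x)) = (\<lambda>x. (a * b) * fourier_basis (k + j) x)"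
      by (simp add: fourier_basis_add mult_ac)
    then show ?case using trigonometric.basis by metis
  next
    case (add f g)
    then show ?case using trigonometric.add by (fastforce simp: distrib_left)
  qed
next
  case (add f f')
  then show ?case using trigonometric.add by (fastforce simp: distrib_right)
qed

text \<open>Induction on the polynomial. A linear functional on the plane is determined by its
  values at 1 and \<open>\<i>\<close>, and cosine and sine combine the frequencies 1 and -1.\<close>

lemma trigonometric_real_polynomial:
  assumes "real_polynomial_function p"
  shows "trigonometric (\<lambda>x. complex_of_real (p (cis (2 * pi * x))))"
  using assms
proof induction
  case (linear f)
  then interpret f: bounded_linear f .
  have "f (cis (2 * pi * x)) = cos (2 * pi * x) * f 1 + sin (2 * pi * x) * f \<i>" for x
  proof -
    have "cis (2 * pi * x) = cos (2 * pi * x) *\<^sub>R 1 + sin (2 * pi * x) *\<^sub>R \<i>"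
      by (simp add: complex_eq_iff)
    then show ?thesis by (metis f.add f.scaleR real_scaleR_def)
  qed
  moreover have "complex_of_real (cos (2 * pi * x)) = (fourier_basis 1 x + fourier_basis (-1) x) / 2" for x
    by (simp add: fourier_basis_def complex_eq_iff)
  moreover have "complex_of_real (sin (2 * pi * x)) = (fourier_basis 1 x - fourier_basis (-1) x) / (2 * \<i>)" for x
    by (simp add: fourier_basis_def complex_eq_iff)
  ultimately have "(\<lambda>x. complex_of_real (f (cis (2 * pi * x))))
      = (\<lambda>x. (f 1 / 2 + f \<i> / (2 * \<i>)) * fourier_basis 1 x
            + (f 1 / 2 - f \<i> / (2 * \<i>)) * fourier_basis (-1) x)"
    by (intro ext) (simp only: of_real_add of_real_mult, simp add: algebra_simps add_divide_distrib diff_divide_distrib)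
  then show ?case
    by (simp only: trigonometric.add trigonometric.basis)
next
  case (const c)
  show ?case by (rule trigonometric_const)
next
  case (add f g)
  then show ?case using trigonometric.add by simp
next
  case (mult f g)
  then show ?case using trigonometric_mult by simp
qed

lemma trigonometric_polynomial:
  fixes p :: "complex \<Rightarrow> complex"
  assumes "polynomial_function p"
  shows "trigonometric (\<lambda>x. p (cis (2 * pi * x)))"
proof -
  have "real_polynomial_function (Re \<circ> p)" "real_polynomial_function (Im \<circ> p)"
    using assms bounded_linear_Re bounded_linear_Im unfolding polynomial_function_def by auto
  then have "trigonometric (\<lambda>x. complex_of_real ((Re \<circ> p) (cis (2 * pi * x)))
      + \<i> * complex_of_real ((Im \<circ> p) (cis (2 * pi * x))))"
    by (intro trigonometric.add trigonometric_mult trigonometric_const trigonometric_real_polynomial)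
  then show ?thesis
    by (simp add: complex_eq[symmetric])
qed

lemma trigonometric_continuous:
  assumes "trigonometric f" shows "continuous_on S f"
  using assms by induction (auto intro!: continuous_intros)

lemma trigonometric_orthogonal:
  assumes "trigonometric f" "continuous_on UNIV v" "\<And>k. \<F> v k = 0"
  shows "integral {0..1} (\<lambda>x. v x * cnj (f x)) = 0"
  using assms(1)
proof induction
  case (basis a k)
  have "integral {0..1} (\<lambda>x. v x * cnj (a * fourier_basis k x))
      = integral {0..1} (\<lambda>x. cnj a * (v x * cnj (fourier_basis k x)))"
    by (simp add: mult_ac)
  also have "\<dots> = 0"
    using assms by (simp only: integral_mult_right fourier_coeff_integral[symmetric] mult_zero_right)
  finally show ?case .
next
  case (add f g)
  then have "integral {0..1} (\<lambda>x. v x * cnj (f x) + v x * cnj (g x)) = 0"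
    using assms(2) trigonometric_continuous[OF add.hyps(1)] trigonometric_continuous[OF add.hyps(2)]
    by (subst integral_add) (auto intro!: integrable_on_unit continuous_intros)
  then show ?case by (simp add: distrib_left)
qed

lemma periodic1_int:
  assumes "periodic1 v" shows "v (x + of_int n) = v x"
proof (induction n rule: int_induct[where k=0])
  case (step1 i)
  then show ?case using assms[unfolded periodic1_def, rule_format, of "x + of_int i"]
    by (simp add: add.assoc)
next
  case (step2 i)
  then show ?case using assms[unfolded periodic1_def, rule_format, of "x + of_int (i - 1)"]
    by (simp add: add.assoc)
qed simp

lemma periodic1_frac: "periodic1 v \<Longrightarrow> v x = v (frac x)"
  using periodic1_int[of v "frac x" "\<lfloor>x\<rfloor>"] by (simp add: frac_def)

lemma frac_unit: "frac x \<in> {0..1::real}"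
  by (simp add: frac_lt_1 less_imp_le)

text \<open>Descent to the circle, so that Stone-Weierstrass applies on a compact set. By
  periodicity the choice of preimage in \<open>f\<close> is immaterial. Continuity is tested on
  closed sets: a preimage under \<open>f\<close> is the image of a compact part of the unit
  interval.\<close>

lemma periodic1_on_circle:
  assumes "continuous_on UNIV v" "periodic1 v"
  obtains f where "continuous_on (sphere (0::complex) 1) f" "\<And>x. f (cis (2 * pi * x)) = v x"
proof -
  define f where "f = (\<lambda>z. v (SOME x. z = cis (2 * pi * x)))"
  have f: "f (cis (2 * pi * x)) = v x" for x
  proof -
    define y where "y = (SOME y. cis (2 * pi * x) = cis (2 * pi * y))"
    have "cis (2 * pi * x) = cis (2 * pi * y)"
      unfolding y_def by (rule someI) (rule refl)
    then have "sin (2 * pi * x) = sin (2 * pi * y) \<and> cos (2 * pi * x) = cos (2 * pi * y)"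
      by (simp add: complex_eq_iff)
    then obtain n :: int where "2 * pi * x = 2 * pi * y + 2 * pi * of_int n"
      using sin_cos_eq_iff by (metis mult.commute)
    then have "2 * pi * x = 2 * pi * (y + of_int n)" by (simp add: algebra_simps)
    then have "x = y + of_int n" by simp
    then have "v x = v y" by (simp only: periodic1_int[OF assms(2)])
    then show ?thesis by (simp add: f_def y_def)
  qed
  have im: "z \<in> sphere 0 1 \<longleftrightarrow> (\<exists>x\<in>{0..1}. z = cis (2 * pi * x))" for z :: complex
  proof
    assume "z \<in> sphere 0 1"
    then have "z = cis (Arg z)" using cis_Arg[of z] by (cases "z = 0") (auto simp: sgn_div_norm)
    then have "z = cis (2 * pi * (Arg z / (2 * pi)))" by simp
    also have "\<dots> = fourier_basis 1 (Arg z / (2 * pi))" by (simp add: fourier_basis_def)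
    also have "\<dots> = fourier_basis 1 (frac (Arg z / (2 * pi)))"
      by (rule periodic1_frac) (simp add: periodic1_def fourier_basis_periodic)
    finally have "z = cis (2 * pi * frac (Arg z / (2 * pi)))" by (simp add: fourier_basis_def)
    then show "\<exists>x\<in>{0..1}. z = cis (2 * pi * x)" using frac_unit by blast
  qed auto
  have "closed (f -` B \<inter> sphere 0 1)" if "closed B" for B
  proof -
    have eq: "f -` B \<inter> sphere 0 1 = (\<lambda>x. cis (2 * pi * x)) ` ({0..1} \<inter> v -` B)"
      unfolding set_eq_iff Int_iff im by (auto simp: f)
    have "compact ({0..1} \<inter> v -` B)"
      using closed_vimage[OF that assms(1)] by (intro compact_Int_closed) auto
    then have "compact ((\<lambda>x. cis (2 * pi * x)) ` ({0..1} \<inter> v -` B))"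
      by (intro compact_continuous_image continuous_intros)
    then show ?thesis unfolding eq by (rule compact_imp_closed)
  qed
  then have "continuous_on (sphere 0 1) f"
    by (subst continuous_on_closed_vimage[OF closed_sphere]) (intro allI impI)
  then show thesis using f that by blast
qed

lemma L2_norm_eq_0_imp:
  assumes "continuous_on UNIV v" "periodic1 v" "L2_norm v = 0"
  shows "v x = 0"
proof -
  have "integral {0..1} (\<lambda>x. (cmod (v x))\<^sup>2) = 0"
    using L2_norm_power2[OF assms(1)] assms(3) by simp
  then have "\<forall>x\<in>{0..1}. (cmod (v x))\<^sup>2 = 0"
    by (subst (asm) integral_eq_0_iff)
      (auto intro!: continuous_intros continuous_on_subset[OF assms(1)])
  then have "v (frac x) = 0" using frac_unit[of x] by simp
  then show ?thesis using periodic1_frac[OF assms(2)] by metis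
qed

text \<open>By Stone-Weierstrass there is a trigonometric polynomial \<open>h\<close> uniformly
  within \<open>e\<close> of \<open>v\<close>. Since \<open>v\<close> is orthogonal to
  \<open>h\<close>, its squared norm is the integral of \<open>v x * cnj (v x - h x)\<close>, hence
  at most \<open>M * e\<close>.\<close>

lemma fourier_uniqueness:
  assumes v: "continuous_on UNIV v" "periodic1 v" and "\<And>k. \<F> v k = 0"
  shows "v x = 0"
proof -
  obtain f where f: "continuous_on (sphere (0::complex) 1) f" "\<And>x. f (cis (2 * pi * x)) = v x"
    using periodic1_on_circle[OF v] by blast
  have "compact (v ` {0..1})"
    by (intro compact_continuous_image continuous_on_subset[OF v(1)]) auto
  then obtain M where M: "M > 0" "\<And>x. x \<in> {0..1} \<Longrightarrow> cmod (v x) \<le> M"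
    by (metis compact_imp_bounded bounded_pos image_eqI)
  have small: "(L2_norm v)\<^sup>2 \<le> M * e" if e: "e > 0" for e
  proof -
    obtain g where g: "polynomial_function g" "\<And>z. z \<in> sphere 0 1 \<Longrightarrow> cmod (f z - g z) < e"
      using Stone_Weierstrass_polynomial_function[OF _ f(1) e] by auto
    define h where "h = (\<lambda>x. g (cis (2 * pi * x)))"
    have h: "trigonometric h" unfolding h_def by (rule trigonometric_polynomial[OF g(1)])
    note ch = trigonometric_continuous[OF h, of UNIV]
    have h_near: "cmod (v x - h x) \<le> e" for x
      using g(2)[of "cis (2 * pi * x)"] f(2)[of x] by (simp add: h_def less_imp_le)
    have "complex_of_real ((L2_norm v)\<^sup>2) = integral {0..1} (\<lambda>x. v x * cnj (v x))"
      by (rule of_real_L2_norm_power2[OF v(1)])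
    also have "\<dots> = integral {0..1} (\<lambda>x. v x * cnj (v x)) - integral {0..1} (\<lambda>x. v x * cnj (h x))"
      using trigonometric_orthogonal[OF h v(1) assms(3)] by simp
    also have "\<dots> = integral {0..1} (\<lambda>x. v x * cnj (v x - h x))"
      using v ch by (subst integral_diff[symmetric])
        (auto intro!: integrable_on_unit continuous_intros simp: algebra_simps)
    finally have "(L2_norm v)\<^sup>2 = cmod (integral {0..1} (\<lambda>x. v x * cnj (v x - h x)))"
      by (metis abs_of_nonneg norm_of_real zero_le_power2)
    also have "\<dots> \<le> M * e * (1 - 0)"
      using M h_near continuous_on_subset[OF v(1)] continuous_on_subset[OF ch]
      by (intro integral_bound)
        (auto intro!: continuous_intros mult_mono simp: norm_mult simp del: complex_cnj_diff)
    finally show ?thesis by simp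
  qed
  have "(L2_norm v)\<^sup>2 \<le> 0"
  proof (rule field_le_epsilon)
    fix e :: real assume "e > 0"
    then show "(L2_norm v)\<^sup>2 \<le> 0 + e" using small[of "e / M"] M(1) by simp
  qed
  then show ?thesis by (intro L2_norm_eq_0_imp[OF v]) simp
qed

section \<open>Absolutely convergent Fourier series\<close>

lemma has_sum_integral:
  fixes f :: "'i \<Rightarrow> real \<Rightarrow> 'a::banach"
  assumes "\<And>k. continuous_on {a..b} (f k)" "\<And>k x. x \<in> {a..b} \<Longrightarrow> norm (f k x) \<le> M k"
    "M summable_on UNIV"
  shows "((\<lambda>k. integral {a..b} (f k)) has_sum integral {a..b} (\<lambda>x. \<Sum>\<^sub>\<infinity>k. f k x)) UNIV"
proof -
  have u: "uniform_limit {a..b} (\<lambda>X x. \<Sum>k\<in>X. f k x) (\<lambda>x. \<Sum>\<^sub>\<infinity>k. f k x) (finite_subsets_at_top UNIV)"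
    by (rule Weierstrass_m_test_general) (use assms in auto)
  obtain I J where I: "\<And>X. ((\<lambda>x. \<Sum>k\<in>X. f k x) has_integral I X) {a..b}"
    "((\<lambda>x. \<Sum>\<^sub>\<infinity>k. f k x) has_integral J) {a..b}" "(I \<longlongrightarrow> J) (finite_subsets_at_top UNIV)"
    by (rule uniform_limit_integral[OF u]) (auto intro!: continuous_intros assms)
  have "eventually (\<lambda>X. I X = (\<Sum>k\<in>X. integral {a..b} (f k))) (finite_subsets_at_top UNIV)"
  proof (intro eventually_finite_subsets_at_top_weakI)
    fix X :: "'i set" assume "finite X"
    then show "I X = (\<Sum>k\<in>X. integral {a..b} (f k))"
      using I(1)[of X] assms(1)
      by (subst integral_sum[symmetric]) (auto simp: integral_unique integrable_continuous_real)
  qed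
  then have "((\<lambda>X. \<Sum>k\<in>X. integral {a..b} (f k)) \<longlongrightarrow> J) (finite_subsets_at_top UNIV)"
    using I(3) by (simp add: tendsto_cong)
  then show ?thesis using I(2) by (simp add: has_sum_def integral_unique)
qed

definition fourier_sum :: "(int \<Rightarrow> complex) \<Rightarrow> real \<Rightarrow> complex" where
  "fourier_sum c x = (\<Sum>\<^sub>\<infinity>k. c k * fourier_basis k x)"

lemma has_sum_fourier_sum:
  assumes "(\<lambda>k. cmod (c k)) summable_on UNIV"
  shows "((\<lambda>k. c k * fourier_basis k x) has_sum fourier_sum c x) UNIV"
  unfolding fourier_sum_def using assms
  by (intro has_sum_infsum) (rule abs_summable_summable, simp add: norm_mult)

lemma continuous_on_fourier_sum:
  assumes "(\<lambda>k. cmod (c k)) summable_on UNIV"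
  shows "continuous_on S (fourier_sum c)"
proof -
  have "uniform_limit UNIV (\<lambda>X x. \<Sum>k\<in>X. c k * fourier_basis k x) (fourier_sum c) (finite_subsets_at_top UNIV)"
    unfolding fourier_sum_def[abs_def]
    by (rule Weierstrass_m_test_general[OF _ assms]) (simp add: norm_mult)
  then have "continuous_on UNIV (fourier_sum c)"
    by (rule uniform_limit_theorem[rotated]) (auto intro!: always_eventually continuous_intros)
  then show ?thesis by (rule continuous_on_subset) simp
qed

lemma norm_fourier_sum_le:
  assumes "(\<lambda>k. cmod (c k)) summable_on UNIV"
  shows "cmod (fourier_sum c x) \<le> (\<Sum>\<^sub>\<infinity>k. cmod (c k))"
  unfolding fourier_sum_def using norm_infsum_bound[of "\<lambda>k. c k * fourier_basis k x" UNIV] assms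
  by (simp add: norm_mult)

lemma periodic1_fourier_sum: "periodic1 (fourier_sum c)"
  by (simp add: periodic1_def fourier_sum_def fourier_basis_periodic)

lemma fourier_coeff_fourier_sum:
  assumes "(\<lambda>k. cmod (c k)) summable_on UNIV"
  shows "\<F> (fourier_sum c) k = c k"
proof -
  have "((\<lambda>j. integral {0..1} (\<lambda>x. c j * fourier_basis j x * cnj (fourier_basis k x)))
      has_sum integral {0..1} (\<lambda>x. \<Sum>\<^sub>\<infinity>j. c j * fourier_basis j x * cnj (fourier_basis k x))) UNIV"
    by (rule has_sum_integral[OF _ _ assms]) (auto intro!: continuous_intros simp: norm_mult)
  moreover have "integral {0..1} (\<lambda>x. c j * fourier_basis j x * cnj (fourier_basis k x))
      = (if j = k then c k else 0)" for j
  proof -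
    have "integral {0..1} (\<lambda>x. c j * fourier_basis j x * cnj (fourier_basis k x))
        = \<F> (\<lambda>x. c j * fourier_basis j x) k"
      by (simp add: fourier_coeff_integral continuous_intros)
    then show ?thesis by (simp add: fourier_coeff_cmult fourier_coeff_basis continuous_intros)
  qed
  moreover have "(\<Sum>\<^sub>\<infinity>j. c j * fourier_basis j x * cnj (fourier_basis k x))
      = fourier_sum c x * cnj (fourier_basis k x)" for x
    unfolding fourier_sum_def by (rule infsum_cmult_left')
  ultimately have "((\<lambda>j. if j = k then c k else 0) has_sum \<F> (fourier_sum c) k) UNIV"
    by (simp add: fourier_coeff_integral continuous_on_fourier_sum assms)
  moreover have "((\<lambda>j. if j = k then c k else 0) has_sum c k) UNIV"
    using has_sum_finite_neutralI[of "{k}" UNIV "\<lambda>j. if j = k then c k else 0"] by simp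
  ultimately show ?thesis by (rule has_sum_unique)
qed

lemma fourier_inversion:
  assumes "continuous_on UNIV v" "periodic1 v" "(\<lambda>k. cmod (\<F> v k)) summable_on UNIV"
  shows "v = fourier_sum (\<F> v)"
proof
  fix x
  let ?d = "\<lambda>x. v x - fourier_sum (\<F> v) x"
  have "?d x = 0"
  proof (rule fourier_uniqueness)
    show "continuous_on UNIV ?d" by (intro continuous_intros assms continuous_on_fourier_sum)
    show "periodic1 ?d" using assms(2) periodic1_fourier_sum by (simp add: periodic1_def)
    show "\<F> ?d k = 0" for k
      using assms by (simp add: fourier_coeff_diff continuous_on_fourier_sum fourier_coeff_fourier_sum)
  qed
  then show "v x = fourier_sum (\<F> v) x" by simp
qed

text \<open>The differentiated series converges uniformly and may be integrated term by term, which
  exhibits \<open>fourier_sum c\<close> as a primitive of a continuous function.\<close>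

lemma fourier_sum_has_vector_derivative:
  assumes "(\<lambda>k. cmod (c k)) summable_on UNIV" "(\<lambda>k. cmod (deriv_symbol k * c k)) summable_on UNIV"
  shows "(fourier_sum c has_vector_derivative fourier_sum (\<lambda>k. deriv_symbol k * c k) x) (at x)"
proof -
  let ?w = "fourier_sum (\<lambda>k. deriv_symbol k * c k)"
  have primitive: "integral {a..y} ?w = fourier_sum c y - fourier_sum c a" if "a \<le> y" for a y
  proof -
    have "((\<lambda>k. integral {a..y} (\<lambda>x. deriv_symbol k * c k * fourier_basis k x)) has_sum integral {a..y} ?w) UNIV"
      unfolding fourier_sum_def[abs_def]
      by (rule has_sum_integral[OF _ _ assms(2)]) (auto intro!: continuous_intros simp: norm_mult)
    moreover have "integral {a..y} (\<lambda>x. deriv_symbol k * c k * fourier_basis k x)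
        = c k * fourier_basis k y - c k * fourier_basis k a" for k
    proof (rule integral_unique, rule fundamental_theorem_of_calculus[OF that])
      show "((\<lambda>x. c k * fourier_basis k x) has_vector_derivative deriv_symbol k * c k * fourier_basis k x)
          (at x within {a..y})" for x
        using has_vector_derivative_mult_right[OF has_vector_derivative_fourier_basis, of "c k" k x "{a..y}"]
        by (simp add: mult_ac)
    qed
    ultimately have "((\<lambda>k. c k * fourier_basis k y - c k * fourier_basis k a) has_sum integral {a..y} ?w) UNIV"
      by simp
    moreover have "((\<lambda>k. c k * fourier_basis k y - c k * fourier_basis k a)
        has_sum fourier_sum c y - fourier_sum c a) UNIV"
      using has_sum_add[OF has_sum_fourier_sum[OF assms(1), of y]
          has_sum_uminusI[OF has_sum_fourier_sum[OF assms(1), of a]]] by simp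
    ultimately show ?thesis by (rule has_sum_unique)
  qed
  \<comment> \<open>Starting the primitive at \<open>x - 1\<close> makes \<open>x\<close> an
    interior point, so the derivative within the interval becomes a two-sided one.\<close>
  have "((\<lambda>y. integral {x - 1..y} ?w) has_vector_derivative ?w x) (at x within {x - 1..x + 1})"
    by (rule integral_has_vector_derivative) (auto intro: continuous_on_fourier_sum assms)
  then have "((\<lambda>y. fourier_sum c (x - 1) + integral {x - 1..y} ?w) has_vector_derivative ?w x)
      (at x within {x - 1..x + 1})"
    by (auto intro: derivative_eq_intros)
  then have "(fourier_sum c has_vector_derivative ?w x) (at x within {x - 1..x + 1})"
    by (rule has_vector_derivative_transform[rotated 2]) (auto simp: primitive)
  then show ?thesis by (simp add: at_within_Icc_at)
qed

text \<open>Only the conjugated factor of \<open>v x * cnj (v x)\<close> is expanded; the other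
  stays whole and is bounded by \<open>M\<close>, so a single series is integrated term by
  term.\<close>

lemma parseval:
  assumes "(\<lambda>k. cmod (c k)) summable_on UNIV"
  shows "((\<lambda>k. (cmod (c k))\<^sup>2) has_sum (L2_norm (fourier_sum c))\<^sup>2) UNIV"
proof -
  let ?v = "fourier_sum c"
  define M where "M = (\<Sum>\<^sub>\<infinity>k. cmod (c k))"
  have M: "cmod (?v x) \<le> M" for x unfolding M_def by (rule norm_fourier_sum_le[OF assms])
  note cv = continuous_on_fourier_sum[OF assms, of UNIV]
  have bound: "cmod (?v x * cnj (c k * fourier_basis k x)) \<le> M * cmod (c k)" for k x
    using M by (simp add: norm_mult mult_right_mono)
  have "((\<lambda>k. integral {0..1} (\<lambda>x. ?v x * cnj (c k * fourier_basis k x)))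
      has_sum integral {0..1} (\<lambda>x. \<Sum>\<^sub>\<infinity>k. ?v x * cnj (c k * fourier_basis k x))) UNIV"
    by (rule has_sum_integral[OF _ bound]) (auto intro!: continuous_intros continuous_on_fourier_sum
      summable_on_cmult_right assms)
  moreover have "integral {0..1} (\<lambda>x. ?v x * cnj (c k * fourier_basis k x)) = of_real ((cmod (c k))\<^sup>2)" for k
  proof -
    have "integral {0..1} (\<lambda>x. ?v x * cnj (c k * fourier_basis k x)) = \<F> ?v k * cnj (c k)"
      using integral_mult_cnj_trig[OF cv, of "{k}" c] by simp
    then show ?thesis by (simp only: fourier_coeff_fourier_sum[OF assms] complex_norm_square)
  qed
  moreover have "(\<Sum>\<^sub>\<infinity>k. ?v x * cnj (c k * fourier_basis k x)) = ?v x * cnj (?v x)" for x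
    by (simp only: infsum_cmult_right' infsum_cnj fourier_sum_def)
  moreover have "integral {0..1} (\<lambda>x. ?v x * cnj (?v x)) = complex_of_real ((L2_norm ?v)\<^sup>2)"
    by (rule of_real_L2_norm_power2[OF cv, symmetric])
  ultimately have "((\<lambda>k. complex_of_real ((cmod (c k))\<^sup>2)) has_sum complex_of_real ((L2_norm ?v)\<^sup>2)) UNIV"
    by simp
  then show ?thesis by (simp only: has_sum_of_real_iff)
qed

subsection \<open>Functions with a summable first-order Fourier series\<close>

abbreviation wiener_term :: "(real \<Rightarrow> complex) \<Rightarrow> int \<Rightarrow> real" where
  "wiener_term v \<equiv> \<lambda>k. (1 + \<bar>of_int k\<bar>) * cmod (\<F> v k)"

text \<open>A weighted Wiener algebra norm. One constant controls the function and, up to 2 pi, its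
  derivative in the sup norm, and truncation to |k| <= N keeps the same constant. The latter fails
  for plain sup norms, whose truncation constants grow with N.\<close>

definition wiener1 :: "real \<Rightarrow> (real \<Rightarrow> complex) \<Rightarrow> bool" where
  "wiener1 M v \<longleftrightarrow> continuous_on UNIV v \<and> periodic1 v \<and>
     wiener_term v summable_on UNIV \<and>
     infsum (wiener_term v) UNIV \<le> M"

lemma summable_on_comparison_le:
  fixes f g :: "'i \<Rightarrow> real"
  assumes "g summable_on UNIV" "\<And>k. 0 \<le> f k" "\<And>k. f k \<le> g k"
  shows "f summable_on UNIV" "infsum f UNIV \<le> infsum g UNIV"
proof -
  show "f summable_on UNIV" by (rule summable_on_comparison_test[OF assms(1)]) (use assms in auto)
  then show "infsum f UNIV \<le> infsum g UNIV" by (rule infsum_mono[OF _ assms(1)]) (use assms in auto)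
qed

context
  fixes v M assumes v: "wiener1 M v"
begin

lemma wiener1_continuous: "continuous_on S v"
  using v by (auto simp: wiener1_def intro: continuous_on_subset)

lemma wiener1_periodic: "periodic1 v"
  using v by (auto simp: wiener1_def)

lemma wiener1_term: "wiener_term v summable_on UNIV" "infsum (wiener_term v) UNIV \<le> M"
  using v by (auto simp: wiener1_def)

lemma wiener1_summable:
  "(\<lambda>k. cmod (\<F> v k)) summable_on UNIV"
  "(\<Sum>\<^sub>\<infinity>k. cmod (\<F> v k)) \<le> M"
proof -
  have "cmod (\<F> v k) \<le> wiener_term v k" for k
    by (simp add: distrib_right)
  note * = summable_on_comparison_le[OF wiener1_term(1) _ this]
  show "(\<lambda>k. cmod (\<F> v k)) summable_on UNIV" by (rule *) simp
  show "(\<Sum>\<^sub>\<infinity>k. cmod (\<F> v k)) \<le> M" by (rule order_trans[OF *(2) wiener1_term(2)]) simp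
qed

lemma wiener1_summable_deriv:
  "(\<lambda>k. cmod (deriv_symbol k * \<F> v k)) summable_on UNIV"
  "(\<Sum>\<^sub>\<infinity>k. cmod (deriv_symbol k * \<F> v k)) \<le> 2 * pi * M"
proof -
  have "cmod (deriv_symbol k * \<F> v k) \<le> 2 * pi * wiener_term v k" for k
    by (simp add: norm_mult norm_deriv_symbol distrib_right)
  note * = summable_on_comparison_le[OF summable_on_cmult_right[OF wiener1_term(1), of "2 * pi"] _ this]
  show "(\<lambda>k. cmod (deriv_symbol k * \<F> v k)) summable_on UNIV" by (rule *) simp
  have "(\<Sum>\<^sub>\<infinity>k. cmod (deriv_symbol k * \<F> v k)) \<le> (\<Sum>\<^sub>\<infinity>k. 2 * pi * wiener_term v k)"
    by (rule *) simp
  also have "\<dots> = 2 * pi * infsum (wiener_term v) UNIV"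
    by (rule infsum_cmult_right')
  finally show "(\<Sum>\<^sub>\<infinity>k. cmod (deriv_symbol k * \<F> v k)) \<le> 2 * pi * M"
    using wiener1_term(2) by (meson mult_left_mono order_trans pi_ge_zero zero_le_mult_iff zero_le_numeral)
qed

lemma wiener1_inversion: "v = fourier_sum (\<F> v)"
  by (rule fourier_inversion[OF wiener1_continuous wiener1_periodic wiener1_summable(1)])

lemma wiener1_bound: "cmod (v x) \<le> M"
  by (subst wiener1_inversion)
    (rule order_trans[OF norm_fourier_sum_le[OF wiener1_summable(1)] wiener1_summable(2)])

lemma wiener1_nonneg: "0 \<le> M"
  using wiener1_bound[of 0] norm_ge_zero order_trans by blast

lemma wiener1_derivative_sum:
  "(v has_vector_derivative fourier_sum (\<lambda>k. deriv_symbol k * \<F> v k) x) (at x)"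
  using fourier_sum_has_vector_derivative[OF wiener1_summable(1) wiener1_summable_deriv(1)]
  by (simp flip: wiener1_inversion)

lemma dx_wiener1: "dx v = fourier_sum (\<lambda>k. deriv_symbol k * \<F> v k)"
  unfolding dx_def by (intro ext vector_derivative_at wiener1_derivative_sum)

lemma wiener1_derivative: "(v has_vector_derivative dx v x) (at x)"
  using wiener1_derivative_sum by (simp add: dx_wiener1)

lemma continuous_on_dx_wiener1: "continuous_on S (dx v)"
  unfolding dx_wiener1 by (rule continuous_on_fourier_sum[OF wiener1_summable_deriv(1)])

lemma norm_dx_wiener1: "cmod (dx v x) \<le> 2 * pi * M"
  unfolding dx_wiener1
  by (rule order_trans[OF norm_fourier_sum_le[OF wiener1_summable_deriv(1)] wiener1_summable_deriv(2)])

lemma fourier_coeff_dx_wiener1: "\<F> (dx v) k = deriv_symbol k * \<F> v k"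
  unfolding dx_wiener1 by (rule fourier_coeff_fourier_sum[OF wiener1_summable_deriv(1)])

end

section \<open>The truncation operator P_N\<close>

lemma trig_proj_eq: "trig_proj N v = (\<lambda>x. \<Sum>k\<in>freqs N. \<F> v k * fourier_basis k x)"
  by (simp add: trig_proj_def[abs_def])

lemma continuous_on_trig_proj: "continuous_on S (trig_proj N v)"
  unfolding trig_proj_eq by (intro continuous_intros)

lemma fourier_coeff_trig_proj:
  "\<F> (trig_proj N v) k = (if k \<in> freqs N then \<F> v k else 0)"
  unfolding trig_proj_eq by (rule fourier_coeff_trig) simp

lemma periodic1_trig_proj: "periodic1 (trig_proj N v)"
  by (simp add: periodic1_def trig_proj_def fourier_basis_periodic)

lemma wiener1_trig_proj:
  assumes "wiener1 M v" shows "wiener1 M (trig_proj N v)"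
proof -
  note sm = wiener1_term(1)[OF assms] and le = wiener1_term(2)[OF assms]
  have "wiener_term (trig_proj N v) k \<le> wiener_term v k" for k
    by (simp add: fourier_coeff_trig_proj)
  note * = summable_on_comparison_le[OF sm _ this]
  show ?thesis
    unfolding wiener1_def
    by (intro conjI continuous_on_trig_proj periodic1_trig_proj *(1) order_trans[OF *(2) le]) auto
qed

text \<open>The constant is anonymous and may depend on N: for trigonometric polynomials this lemma
  supplies differentiability, not an estimate.\<close>

lemma wiener1_finite:
  assumes "continuous_on UNIV v" "periodic1 v" "\<And>k. k \<notin> freqs N \<Longrightarrow> \<F> v k = 0"
  shows "\<exists>M. wiener1 M v"
proof -
  have "wiener_term v k = 0" if "k \<notin> freqs N" for k
    using assms(3)[OF that] by simp
  then have "{k \<in> UNIV. wiener_term v k \<noteq> 0} \<subseteq> freqs N"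
    by blast
  then have "wiener_term v summable_on UNIV"
    by (intro finite_nonzero_values_imp_summable_on) (rule finite_subset[OF _ finite_atLeastAtMost_int])
  then show ?thesis using assms by (auto simp: wiener1_def)
qed

lemma real_valued_trig_proj:
  assumes "continuous_on UNIV v" "real_valued v"
  shows "real_valued (trig_proj N v)"
proof -
  have "cnj (trig_proj N v x) = trig_proj N v x" for x
  proof -
    have "cnj (trig_proj N v x) = (\<Sum>k\<in>freqs N. \<F> v (- k) * fourier_basis (- k) x)"
      by (simp add: trig_proj_def fourier_coeff_real assms fourier_basis_uminus)
    also have "\<dots> = trig_proj N v x"
      unfolding trig_proj_def
      by (rule sum.reindex_bij_witness[of _ uminus uminus]) auto
    finally show ?thesis .
  qed
  then show ?thesis by (simp add: real_valued_def Reals_cnj_iff)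
qed

subsection \<open>Sobolev regularity\<close>

lemma summable_on_int_powr:
  fixes s :: real assumes "s > 1 / 2"
  shows "(\<lambda>k::int. (1 + (of_int k)\<^sup>2) powr (- s)) summable_on UNIV"
proof -
  let ?f = "\<lambda>k::int. (1 + (of_int k)\<^sup>2) powr (- s)"
  have nat: "(\<lambda>n::nat. (1 + (real n)\<^sup>2) powr (- s)) summable_on UNIV"
  proof (rule norm_summable_imp_summable_on, rule summable_comparison_test_ev)
    show "summable (\<lambda>n. real n powr (- 2 * s))"
      using assms by (simp add: summable_real_powr_iff)
    show "\<forall>\<^sub>F n in sequentially. norm (norm ((1 + (real n)\<^sup>2) powr - s)) \<le> real n powr (- 2 * s)"
      \<comment> \<open>At \<open>n = 0\<close> the majorant is 0 by the convention
        \<open>0 powr x = 0\<close> while the term is 1, so the comparison holds only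
        eventually.\<close>
      using eventually_gt_at_top[of 0]
    proof eventually_elim
      case (elim n)
      have "(1 + (real n)\<^sup>2) powr (- s) \<le> ((real n)\<^sup>2) powr (- s)"
        using elim assms by (intro powr_mono2') auto
      also have "((real n)\<^sup>2) powr (- s) = real n powr (- 2 * s)"
        using elim by (simp add: powr_powr flip: powr_numeral)
      finally show ?case by simp
    qed
  qed
  have "?f summable_on (range int \<union> range (\<lambda>n. - int n))"
    using nat by (intro summable_on_union) (auto simp: summable_on_reindex inj_on_def o_def)
  moreover have "range int \<union> range (\<lambda>n. - int n) = UNIV"
    by (metis (no_types, lifting) UNIV_eq_I Un_iff int_cases2 rangeI)
  ultimately show ?thesis by simp
qed

text \<open>The constant of the embedding of the Sobolev space into \<open>wiener1\<close>: a
  majorant of the sum of (1 + |k|)^2 (1 + k^2)^(-\<mu>), convergent for \<mu> > 3/2.\<close>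

definition sobolev_weight_sum :: "real \<Rightarrow> real" where
  "sobolev_weight_sum \<mu> = (\<Sum>\<^sub>\<infinity>k::int. 2 * (1 + (of_int k)\<^sup>2) powr (- (\<mu> - 1)))"

lemma sobolev_norm_power2:
  "(sobolev_norm \<mu> v)\<^sup>2 = (\<Sum>\<^sub>\<infinity>k::int. (1 + (of_int k)\<^sup>2) powr \<mu> * (cmod (\<F> v k))\<^sup>2)"
  unfolding sobolev_norm_def by (intro real_sqrt_pow2 infsum_nonneg) simp

text \<open>Insert the weight and its inverse and apply 2 a b <= a^2 + b^2 to each term. Used in
  place of Cauchy-Schwarz, this gives summability and the bound from one termwise comparison; the
  price is a bound affine in the squared norm.\<close>

lemma wiener1_sobolev:
  assumes "\<mu> > 3 / 2" "v \<in> sobolev_space \<mu>" "continuous_on UNIV v" "(sobolev_norm \<mu> v)\<^sup>2 \<le> B"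
  shows "wiener1 ((sobolev_weight_sum \<mu> + B) / 2) v"
proof -
  let ?w = "\<lambda>k::int. 1 + (real_of_int k)\<^sup>2"
  let ?c = "\<lambda>k. cmod (\<F> v k)"
  have s1: "(\<lambda>k. 2 * ?w k powr (- (\<mu> - 1))) summable_on UNIV"
    using assms(1) by (intro summable_on_cmult_right summable_on_int_powr) simp
  have s2: "(\<lambda>k. ?w k powr \<mu> * (?c k)\<^sup>2) summable_on UNIV" and per: "periodic1 v"
    using assms(2) by (auto simp: sobolev_space_def)
  have bound: "(1 + \<bar>of_int k\<bar>) * ?c k \<le> (2 * ?w k powr (- (\<mu> - 1)) + ?w k powr \<mu> * (?c k)\<^sup>2) * (1 / 2)" for k
  proof -
    have w: "?w k > 0" by (rule add_pos_nonneg) auto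
    let ?a = "(1 + \<bar>of_int k\<bar>) * ?w k powr (- \<mu> / 2)" and ?b = "?w k powr (\<mu> / 2) * ?c k"
    have "?a * ?b = (1 + \<bar>of_int k\<bar>) * ?c k * (?w k powr (- \<mu> / 2) * ?w k powr (\<mu> / 2))"
      by (simp add: mult_ac)
    also have "?w k powr (- \<mu> / 2) * ?w k powr (\<mu> / 2) = 1"
      using w by (simp flip: powr_add)
    finally have ab: "(1 + \<bar>of_int k\<bar>) * ?c k = ?a * ?b" by simp
    have a2: "?a\<^sup>2 \<le> 2 * ?w k powr (- (\<mu> - 1))"
    proof -
      have "?a\<^sup>2 = (1 + \<bar>of_int k\<bar>)\<^sup>2 * (?w k powr (- \<mu>))"
        using w by (simp add: power_mult_distrib power2_eq_square flip: powr_add)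
      also have "\<dots> \<le> 2 * ?w k * ?w k powr (- \<mu>)"
        using sum_squares_bound[of 1 "\<bar>real_of_int k\<bar>"]
        by (intro mult_right_mono) (auto simp: power2_eq_square algebra_simps)
      also have "\<dots> = 2 * ?w k powr (- (\<mu> - 1))"
        using w by (simp add: powr_diff powr_minus field_simps)
      finally show ?thesis .
    qed
    have b2: "?b\<^sup>2 = ?w k powr \<mu> * (?c k)\<^sup>2"
      using w by (simp add: power_mult_distrib power2_eq_square flip: powr_add)
    show ?thesis using sum_squares_bound[of ?a ?b] a2 b2 unfolding ab by (simp add: mult_ac)
  qed
  have s: "(\<lambda>k. (2 * ?w k powr (- (\<mu> - 1)) + ?w k powr \<mu> * (?c k)\<^sup>2) * (1 / 2)) summable_on UNIV"
    by (intro summable_on_cmult_left summable_on_add s1 s2)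
  have "infsum (\<lambda>k. (2 * ?w k powr (- (\<mu> - 1)) + ?w k powr \<mu> * (?c k)\<^sup>2) * (1 / 2)) UNIV
      = (sobolev_weight_sum \<mu> + (sobolev_norm \<mu> v)\<^sup>2) * (1 / 2)"
    unfolding sobolev_weight_sum_def sobolev_norm_power2
    by (subst infsum_cmult_left', subst infsum_add[OF s1 s2]) (rule refl)
  then have le: "infsum (\<lambda>k. (2 * ?w k powr (- (\<mu> - 1)) + ?w k powr \<mu> * (?c k)\<^sup>2) * (1 / 2)) UNIV
      \<le> (sobolev_weight_sum \<mu> + B) / 2"
    using assms(4) by simp
  show ?thesis
    unfolding wiener1_def
    using summable_on_comparison_le[OF s _ bound] le assms(3) per by force
qed

text \<open>A squared triangle inequality with constant 2, proved coefficient by coefficient. It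
  stands in for Minkowski's inequality where only boundedness is at stake.\<close>

lemma sobolev_add:
  assumes "v \<in> sobolev_space \<mu>" "w \<in> sobolev_space \<mu>" "continuous_on UNIV v" "continuous_on UNIV w"
  shows "(sobolev_norm \<mu> v)\<^sup>2 \<le> 2 * (sobolev_norm \<mu> (\<lambda>x. v x - w x))\<^sup>2 + 2 * (sobolev_norm \<mu> w)\<^sup>2"
proof -
  let ?w = "\<lambda>k::int. (1 + (real_of_int k)\<^sup>2) powr \<mu>"
  let ?n = "\<lambda>v k. ?w k * (cmod (\<F> v k))\<^sup>2"
  have sv: "?n v summable_on UNIV" and sw: "?n w summable_on UNIV"
    using assms by (auto simp: sobolev_space_def)
  have le: "?n (\<lambda>x. v x - w x) k \<le> 2 * ?n v k + 2 * ?n w k" for k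
    using mult_left_mono[OF cmod_diff_power2_le, of "?w k" "\<F> v k" "\<F> w k"]
    by (simp add: fourier_coeff_diff assms algebra_simps)
  have sd: "?n (\<lambda>x. v x - w x) summable_on UNIV"
    by (rule summable_on_comparison_le(1)[OF _ _ le]) (auto intro!: summable_on_add summable_on_cmult_right sv sw)
  have le': "?n v k \<le> 2 * ?n (\<lambda>x. v x - w x) k + 2 * ?n w k" for k
    using mult_left_mono[OF cmod_diff_power2_le, of "?w k" "\<F> v k - \<F> w k" "- \<F> w k"]
    by (simp add: fourier_coeff_diff assms algebra_simps)
  have "infsum (?n v) UNIV \<le> infsum (\<lambda>k. 2 * ?n (\<lambda>x. v x - w x) k + 2 * ?n w k) UNIV"
    by (rule infsum_mono[OF sv _ le']) (intro summable_on_add summable_on_cmult_right sd sw)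
  also have "\<dots> = 2 * infsum (?n (\<lambda>x. v x - w x)) UNIV + 2 * infsum (?n w) UNIV"
    by (subst infsum_add) (auto intro!: summable_on_cmult_right sd sw simp: infsum_cmult_right')
  finally show ?thesis by (simp only: sobolev_norm_power2)
qed

text \<open>Continuity at each time gives a local bound; bisection makes it global. This turns the
  hypothesis on the exact solution into constants independent of time.\<close>

lemma sobolev_norm_bounded:
  assumes "continuous_in_sobolev T \<mu> w" "\<And>t. t \<in> {0..T} \<Longrightarrow> continuous_on UNIV (w t)" "T > 0"
  shows "\<exists>B. \<forall>t\<in>{0..T}. (sobolev_norm \<mu> (w t))\<^sup>2 \<le> B"
proof -
  \<comment> \<open>The intersection with \<open>{0..T}\<close> is there because the local condition
    of \<open>Bolzano\<close> ranges over all short intervals around \<open>t\<close>, including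
    those that stick out of \<open>{0..T}\<close>.\<close>
  define P where "P = (\<lambda>a b. \<exists>B. \<forall>t\<in>{a..b} \<inter> {0..T}. (sobolev_norm \<mu> (w t))\<^sup>2 \<le> B)"
  have "P 0 T"
  proof (rule Bolzano)
    show "0 \<le> T" using assms by simp
    show "P a c" if P: "P a b" "P b c" "a \<le> b" "b \<le> c" for a b c
    proof -
      obtain A B where "\<forall>t\<in>{a..b} \<inter> {0..T}. (sobolev_norm \<mu> (w t))\<^sup>2 \<le> A"
        "\<forall>t\<in>{b..c} \<inter> {0..T}. (sobolev_norm \<mu> (w t))\<^sup>2 \<le> B" using P(1,2) unfolding P_def by blast
      then have "\<forall>t\<in>{a..c} \<inter> {0..T}. (sobolev_norm \<mu> (w t))\<^sup>2 \<le> max A B"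
        by (metis IntE IntI atLeastAtMost_iff le_max_iff_disj linear)
      then show ?thesis unfolding P_def by blast
    qed
    show "\<exists>d>0. \<forall>a b. a \<le> t \<and> t \<le> b \<and> b - a < d \<longrightarrow> P a b" if t: "0 \<le> t" "t \<le> T" for t
    proof -
      have tT: "t \<in> {0..T}" using t by simp
      then have "((\<lambda>s. sobolev_norm \<mu> (\<lambda>x. w s x - w t x)) \<longlongrightarrow> 0) (at t within {0..T})"
        using assms(1) by (auto simp: continuous_in_sobolev_def)
      then have "\<forall>\<^sub>F s in at t within {0..T}. dist (sobolev_norm \<mu> (\<lambda>x. w s x - w t x)) 0 < 1"
        by (rule tendstoD) simp
      then obtain d where d: "d > 0"
        "\<And>s. s \<in> {0..T} \<Longrightarrow> s \<noteq> t \<Longrightarrow> dist s t < d \<Longrightarrow> dist (sobolev_norm \<mu> (\<lambda>x. w s x - w t x)) 0 < 1"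
        by (auto simp: eventually_at)
      have "(sobolev_norm \<mu> (w s))\<^sup>2 \<le> 2 + 2 * (sobolev_norm \<mu> (w t))\<^sup>2"
        if s: "s \<in> {0..T}" "dist s t < d" for s
      \<comment> \<open>The limit is a punctured one and says nothing at \<open>s = t\<close>; there
        the bound is trivial.\<close>
      proof (cases "s = t")
        case False
        have "(sobolev_norm \<mu> (\<lambda>x. w s x - w t x))\<^sup>2 \<le> 1"
          using d(2)[OF s(1) False s(2)] by (simp add: power2_le_iff_abs_le abs_square_le_1)
        moreover have "(sobolev_norm \<mu> (w s))\<^sup>2
            \<le> 2 * (sobolev_norm \<mu> (\<lambda>x. w s x - w t x))\<^sup>2 + 2 * (sobolev_norm \<mu> (w t))\<^sup>2"
          using assms s tT by (intro sobolev_add) (auto simp: continuous_in_sobolev_def)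
        ultimately show ?thesis by simp
      qed simp
      then have "P a b" if "a \<le> t" "t \<le> b" "b - a < d" for a b
        unfolding P_def using that by (intro exI[of _ "2 + 2 * (sobolev_norm \<mu> (w t))\<^sup>2"])
          (auto simp: dist_real_def)
      then show ?thesis using d(1) by blast
    qed
  qed
  then show ?thesis unfolding P_def Int_absorb .
qed

text \<open>Parseval for the tail, whose frequencies all carry a Sobolev weight of at least N^(2
  \<mu>).\<close>

lemma trig_proj_tail:
  assumes "\<mu> > 3 / 2" "v \<in> sobolev_space \<mu>" "continuous_on UNIV v" "N \<ge> 1"
  shows "L2_norm (\<lambda>x. v x - trig_proj N v x) \<le> real N powr (- \<mu>) * sobolev_norm \<mu> v"
proof -
  let ?d = "\<lambda>x. v x - trig_proj N v x"
  let ?w = "\<lambda>k::int. (1 + (real_of_int k)\<^sup>2) powr \<mu>"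
  let ?n = "\<lambda>k. ?w k * (cmod (\<F> v k))\<^sup>2"
  have wv: "wiener1 ((sobolev_weight_sum \<mu> + (sobolev_norm \<mu> v)\<^sup>2) / 2) v"
    by (rule wiener1_sobolev[OF assms(1-3)]) simp
  have sn: "?n summable_on UNIV" using assms by (auto simp: sobolev_space_def)
  have fc: "\<F> ?d k = (if k \<in> freqs N then 0 else \<F> v k)" for k
    using assms(3) by (simp add: fourier_coeff_diff continuous_on_trig_proj fourier_coeff_trig_proj)
  have abs: "(\<lambda>k. cmod (\<F> ?d k)) summable_on UNIV"
    by (rule summable_on_comparison_le(1)[OF wiener1_summable(1)[OF wv]]) (auto simp: fc)
  have inv: "?d = fourier_sum (\<F> ?d)"
  proof (rule fourier_inversion[OF _ _ abs])
    show "continuous_on UNIV ?d" by (intro continuous_intros assms continuous_on_trig_proj)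
    show "periodic1 ?d" using wiener1_periodic[OF wv] periodic1_trig_proj by (simp add: periodic1_def)
  qed
  have hs: "((\<lambda>k. (cmod (\<F> ?d k))\<^sup>2) has_sum (L2_norm ?d)\<^sup>2) UNIV"
    using parseval[OF abs] by (simp flip: inv)
  have N: "real N > 0" using assms by simp
  have le: "(cmod (\<F> ?d k))\<^sup>2 \<le> (real N powr (- \<mu>))\<^sup>2 * ?n k" for k
  proof (cases "k \<in> freqs N")
    case False
    then have "real N \<le> \<bar>real_of_int k\<bar>" by auto
    then have "(real N)\<^sup>2 \<le> (real_of_int k)\<^sup>2" using power_mono[of "real N" _ 2] by fastforce
    then have "((real N)\<^sup>2) powr \<mu> \<le> ?w k" using assms(1) by (intro powr_mono2) auto
    moreover have "(real N powr (- \<mu>))\<^sup>2 * ((real N)\<^sup>2) powr \<mu> = 1"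
      using N by (simp add: powr_powr power2_eq_square powr_mult flip: powr_add)
    ultimately have "1 \<le> (real N powr (- \<mu>))\<^sup>2 * ?w k"
      by (metis mult_left_mono zero_le_power2)
    then have "1 * (cmod (\<F> v k))\<^sup>2 \<le> ((real N powr (- \<mu>))\<^sup>2 * ?w k) * (cmod (\<F> v k))\<^sup>2"
      by (intro mult_right_mono) auto
    then show ?thesis using False by (simp add: fc mult.assoc)
  qed (simp add: fc)
  have "(L2_norm ?d)\<^sup>2 \<le> (real N powr (- \<mu>))\<^sup>2 * (sobolev_norm \<mu> v)\<^sup>2"
    unfolding sobolev_norm_power2
    by (rule has_sum_mono[OF hs has_sum_cmult_right[OF has_sum_infsum[OF sn]]]) (rule le)
  then have "(L2_norm ?d)\<^sup>2 \<le> (real N powr (- \<mu>) * sobolev_norm \<mu> v)\<^sup>2" by (simp add: power_mult_distrib)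
  then show ?thesis
    by (rule power2_le_imp_le) (simp add: sobolev_norm_def infsum_nonneg)
qed

subsection \<open>The symbols\<close>

definition smooth_symbol :: "real \<Rightarrow> real \<Rightarrow> int \<Rightarrow> real" where
  "smooth_symbol \<gamma> \<alpha> k = 1 / (1 + ilw_g \<gamma> \<alpha> (2 * pi * of_int k))"

definition lin_symbol :: "real \<Rightarrow> real \<Rightarrow> int \<Rightarrow> real" where
  "lin_symbol \<gamma> \<alpha> k = (\<alpha> - 1) / \<alpha> + smooth_symbol \<gamma> \<alpha> k / \<alpha>"

text \<open>From coth >= 1. Linear growth of the symbol is what makes the inverse of 1 + g an
  operator of order -1.\<close>

lemma ilw_g_lower:
  assumes "\<gamma> > 0" "\<alpha> > 0"
  shows "\<alpha> / \<gamma> * \<bar>\<xi>\<bar> \<le> ilw_g \<gamma> \<alpha> \<xi>"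
proof (cases "\<xi> = 0")
  case False
  have "sinh \<bar>\<xi>\<bar> \<le> cosh \<bar>\<xi>\<bar>" by (rule sinh_le_cosh_real)
  then have "1 \<le> cosh \<bar>\<xi>\<bar> / sinh \<bar>\<xi>\<bar>" using False by (simp add: sinh_real_pos_iff)
  then have "\<alpha> / \<gamma> * \<bar>\<xi>\<bar> * 1 \<le> \<alpha> / \<gamma> * \<bar>\<xi>\<bar> * (cosh \<bar>\<xi>\<bar> / sinh \<bar>\<xi>\<bar>)"
    using assms by (intro mult_left_mono) auto
  then show ?thesis using False by (simp add: ilw_g_def)
qed (use assms in \<open>simp add: ilw_g_def\<close>)

lemma ilw_g_nonneg: "\<gamma> > 0 \<Longrightarrow> \<alpha> > 0 \<Longrightarrow> 0 \<le> ilw_g \<gamma> \<alpha> \<xi>"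
  by (rule order_trans[OF _ ilw_g_lower]) auto

lemma smooth_symbol_uminus: "smooth_symbol \<gamma> \<alpha> (- k) = smooth_symbol \<gamma> \<alpha> k"
  by (simp add: smooth_symbol_def ilw_g_def)

lemma lin_symbol_uminus: "lin_symbol \<gamma> \<alpha> (- k) = lin_symbol \<gamma> \<alpha> k"
  by (simp add: lin_symbol_def smooth_symbol_uminus)

context
  fixes \<gamma> \<alpha> :: real
  assumes \<gamma>: "\<gamma> > 0" and \<alpha>: "\<alpha> > 1"
begin

lemma smooth_symbol_pos: "0 < smooth_symbol \<gamma> \<alpha> k"
  using ilw_g_nonneg[of \<gamma> \<alpha> "2 * pi * of_int k"] \<gamma> \<alpha> by (simp add: smooth_symbol_def)

lemma smooth_symbol_le_1: "smooth_symbol \<gamma> \<alpha> k \<le> 1"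
  using ilw_g_nonneg[of \<gamma> \<alpha> "2 * pi * of_int k"] \<gamma> \<alpha> by (simp add: smooth_symbol_def)

text \<open>The gain of one derivative in quantitative form; \<open>\<gamma> / \<alpha>\<close> is
  the reciprocal of the slope in \<open>ilw_g_lower\<close>.\<close>

lemma smooth_symbol_order: "smooth_symbol \<gamma> \<alpha> k * (2 * pi * \<bar>of_int k\<bar>) \<le> \<gamma> / \<alpha>"
proof -
  have "\<alpha> / \<gamma> * \<bar>2 * pi * of_int k\<bar> \<le> 1 + ilw_g \<gamma> \<alpha> (2 * pi * of_int k)"
    using ilw_g_lower[of \<gamma> \<alpha> "2 * pi * of_int k"] \<gamma> \<alpha> by simp
  moreover have "0 < 1 + ilw_g \<gamma> \<alpha> (2 * pi * of_int k)"
    using ilw_g_nonneg[of \<gamma> \<alpha> "2 * pi * of_int k"] \<gamma> \<alpha> by simp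
  ultimately show ?thesis using \<gamma> \<alpha>
    by (simp add: smooth_symbol_def abs_mult field_simps)
qed

text \<open>The source of coercivity: for \<alpha> > 1 the lower bound is positive and independent
  of the frequency.\<close>

lemma lin_symbol_lower: "(\<alpha> - 1) / \<alpha> \<le> lin_symbol \<gamma> \<alpha> k"
  using smooth_symbol_pos[of k] \<alpha> by (simp add: lin_symbol_def)

lemma lin_symbol_pos: "0 < lin_symbol \<gamma> \<alpha> k"
  using lin_symbol_lower[of k] \<alpha> by (smt (verit) divide_pos_pos)

lemma lin_symbol_le_1: "lin_symbol \<gamma> \<alpha> k \<le> 1"
  using smooth_symbol_le_1[of k] \<alpha> by (simp add: lin_symbol_def field_simps)

lemma ilw_lin_eq: "ilw_lin \<gamma> \<alpha> v = fourier_sum (\<lambda>k. of_real (lin_symbol \<gamma> \<alpha> k) * \<F> v k)"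
proof -
  have "1 / (1 + ilw_g \<gamma> \<alpha> (2 * pi * of_int k)) * (1 + (\<alpha> - 1) / \<alpha> * ilw_g \<gamma> \<alpha> (2 * pi * of_int k))
      = lin_symbol \<gamma> \<alpha> k" for k
  proof -
    define G where "G = ilw_g \<gamma> \<alpha> (2 * pi * of_int k)"
    have "1 + G \<noteq> 0" "\<alpha> \<noteq> 0"
      using ilw_g_nonneg[of \<gamma> \<alpha> "2 * pi * of_int k"] \<gamma> \<alpha> by (auto simp: G_def)
    then have "1 / (1 + G) * (1 + (\<alpha> - 1) / \<alpha> * G) = (\<alpha> - 1) / \<alpha> + 1 / (1 + G) / \<alpha>"
      by (simp add: divide_simps) (simp add: algebra_simps)
    then show ?thesis by (simp add: lin_symbol_def smooth_symbol_def G_def)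
  qed
  then show ?thesis by (simp add: ilw_lin_def fourier_multiplier_def[abs_def] fourier_sum_def[abs_def])
qed

lemma ilw_inv_eq: "ilw_inv \<gamma> \<alpha> v = fourier_sum (\<lambda>k. of_real (smooth_symbol \<gamma> \<alpha> k) * \<F> v k)"
  by (simp add: ilw_inv_def fourier_multiplier_def[abs_def] fourier_sum_def[abs_def] smooth_symbol_def)

text \<open>A symbol of order -1 is square summable. Paired with the square summable coefficients of
  a merely continuous function it yields an absolutely convergent series.\<close>

lemma smooth_symbol_summable: "(\<lambda>k. (smooth_symbol \<gamma> \<alpha> k)\<^sup>2) summable_on UNIV"
proof (rule summable_on_comparison_le(1))
  let ?C = "1 + (\<gamma> / (2 * pi * \<alpha>))\<^sup>2"
  show "(\<lambda>k. ?C * (1 + (of_int k)\<^sup>2) powr (- 1)) summable_on UNIV"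
    by (intro summable_on_cmult_right summable_on_int_powr) simp
  show "(smooth_symbol \<gamma> \<alpha> k)\<^sup>2 \<le> ?C * (1 + (of_int k)\<^sup>2) powr (- 1)" for k
  proof -
    let ?b = "smooth_symbol \<gamma> \<alpha> k"
    have "?b * \<bar>of_int k\<bar> \<le> \<gamma> / (2 * pi * \<alpha>)"
      using smooth_symbol_order[of k] \<alpha> by (simp add: field_simps)
    then have "(?b * \<bar>of_int k\<bar>)\<^sup>2 \<le> (\<gamma> / (2 * pi * \<alpha>))\<^sup>2"
      using smooth_symbol_pos[of k] by (intro power_mono) auto
    moreover have "?b\<^sup>2 \<le> 1"
      using smooth_symbol_pos[of k] smooth_symbol_le_1[of k] by (simp add: power_le_one)
    ultimately have "?b\<^sup>2 * (1 + (of_int k)\<^sup>2) \<le> ?C" by (simp add: power_mult_distrib algebra_simps)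
    moreover have "(0::real) < 1 + (of_int k)\<^sup>2" by (rule add_pos_nonneg) auto
    ultimately show ?thesis by (simp add: powr_minus field_simps)
  qed
qed simp

text \<open>The derivative of a product is known only to be continuous, so its coefficients are only
  square summable, by Bessel. The bound is explicit in \<open>K\<close> because a bound uniform in
  time is wanted later for dominated convergence.\<close>

lemma ilw_inv_properties:
  assumes F: "continuous_on UNIV F" "\<And>x. cmod (F x) \<le> K"
  shows "continuous_on S (ilw_inv \<gamma> \<alpha> F)"
    and "\<F> (ilw_inv \<gamma> \<alpha> F) k = of_real (smooth_symbol \<gamma> \<alpha> k) * \<F> F k"
    and "cmod (ilw_inv \<gamma> \<alpha> F x) \<le> ((\<Sum>\<^sub>\<infinity>k. (smooth_symbol \<gamma> \<alpha> k)\<^sup>2) + K\<^sup>2) / 2"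
proof -
  let ?b = "smooth_symbol \<gamma> \<alpha>" and ?c = "\<lambda>k. (cmod (\<F> F k))\<^sup>2"
  have K: "0 \<le> K" using F(2)[of 0] norm_ge_zero order_trans by blast
  have L2: "(L2_norm F)\<^sup>2 \<le> K\<^sup>2"
  proof -
    have "integral {0..1} (\<lambda>x. (cmod (F x))\<^sup>2) \<le> integral {0..1} (\<lambda>x::real. K\<^sup>2)"
      by (intro integral_le integrable_on_unit) (auto intro!: continuous_intros F power_mono)
    then show ?thesis by (simp add: L2_norm_power2 F)
  qed
  have part: "sum ?c X \<le> K\<^sup>2" if "finite X" for X
    using bessel[OF F(1) that] L2 by simp
  have sc: "?c summable_on UNIV"
    by (rule nonneg_bdd_above_summable_on) (auto intro!: bdd_aboveI[of _ "K\<^sup>2"] part)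
  have c_le: "infsum ?c UNIV \<le> K\<^sup>2" by (rule infsum_le_finite_sums[OF sc]) (auto intro: part)
  have le: "cmod (of_real (?b k) * \<F> F k) \<le> ((?b k)\<^sup>2 + ?c k) * (1 / 2)" for k
    using sum_squares_bound[of "?b k" "cmod (\<F> F k)"] smooth_symbol_pos[of k]
    by (simp add: norm_mult)
  have s: "(\<lambda>k. ((?b k)\<^sup>2 + ?c k) * (1 / 2)) summable_on UNIV"
    by (intro summable_on_cmult_left summable_on_add sc smooth_symbol_summable)
  note * = summable_on_comparison_le[OF s norm_ge_zero le]
  show "continuous_on S (ilw_inv \<gamma> \<alpha> F)"
    unfolding ilw_inv_eq by (rule continuous_on_fourier_sum[OF *(1)])
  show "\<F> (ilw_inv \<gamma> \<alpha> F) k = of_real (smooth_symbol \<gamma> \<alpha> k) * \<F> F k"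
    unfolding ilw_inv_eq by (rule fourier_coeff_fourier_sum[OF *(1)])
  have "cmod (ilw_inv \<gamma> \<alpha> F x) \<le> (\<Sum>\<^sub>\<infinity>k. ((?b k)\<^sup>2 + ?c k) * (1 / 2))"
    unfolding ilw_inv_eq by (rule order_trans[OF norm_fourier_sum_le[OF *(1)] *(2)])
  also have "\<dots> = (infsum (\<lambda>k. (?b k)\<^sup>2) UNIV + infsum ?c UNIV) * (1 / 2)"
    by (subst infsum_cmult_left', subst infsum_add[OF smooth_symbol_summable sc]) (rule refl)
  finally show "cmod (ilw_inv \<gamma> \<alpha> F x) \<le> ((\<Sum>\<^sub>\<infinity>k. (?b k)\<^sup>2) + K\<^sup>2) / 2" using c_le by simp
qed

text \<open>This operator has order zero and improves nothing: absolute summability has to come from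
  the argument, which is therefore the derivative of a \<open>wiener1\<close> function.\<close>

lemma ilw_lin_properties:
  assumes v: "wiener1 M v"
  shows "continuous_on S (ilw_lin \<gamma> \<alpha> (dx v))"
    and "\<F> (ilw_lin \<gamma> \<alpha> (dx v)) k = of_real (lin_symbol \<gamma> \<alpha> k) * (deriv_symbol k * \<F> v k)"
    and "cmod (ilw_lin \<gamma> \<alpha> (dx v) x) \<le> 2 * pi * M"
proof -
  have le: "cmod (of_real (lin_symbol \<gamma> \<alpha> k) * \<F> (dx v) k)
      \<le> cmod (deriv_symbol k * \<F> v k)" for k
  proof -
    have "cmod (of_real (lin_symbol \<gamma> \<alpha> k) * \<F> (dx v) k)
        = lin_symbol \<gamma> \<alpha> k * cmod (deriv_symbol k * \<F> v k)"
      using lin_symbol_pos[of k] by (simp add: fourier_coeff_dx_wiener1[OF v] norm_mult)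
    also have "\<dots> \<le> 1 * cmod (deriv_symbol k * \<F> v k)"
      by (intro mult_right_mono lin_symbol_le_1) simp
    finally show ?thesis by simp
  qed
  note * = summable_on_comparison_le[OF wiener1_summable_deriv(1)[OF v] norm_ge_zero le]
  show "continuous_on S (ilw_lin \<gamma> \<alpha> (dx v))"
    unfolding ilw_lin_eq by (rule continuous_on_fourier_sum[OF *(1)])
  show "\<F> (ilw_lin \<gamma> \<alpha> (dx v)) k = of_real (lin_symbol \<gamma> \<alpha> k) * (deriv_symbol k * \<F> v k)"
    unfolding ilw_lin_eq
    using fourier_coeff_fourier_sum[OF *(1), of k] by (simp only: fourier_coeff_dx_wiener1[OF v])
  show "cmod (ilw_lin \<gamma> \<alpha> (dx v) x) \<le> 2 * pi * M"
    unfolding ilw_lin_eq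
    by (rule order_trans[OF norm_fourier_sum_le[OF *(1)] order_trans[OF *(2) wiener1_summable_deriv(2)[OF v]]])
qed

end

lemma periodic1_ilw_inv: "periodic1 (ilw_inv \<gamma> \<alpha> v)"
  by (simp add: periodic1_def ilw_inv_def fourier_multiplier_def fourier_basis_periodic)

lemma periodic1_ilw_lin: "periodic1 (ilw_lin \<gamma> \<alpha> v)"
  by (simp add: periodic1_def ilw_lin_def fourier_multiplier_def fourier_basis_periodic)

text \<open>Products are treated by the product rule as continuously differentiable functions;
  \<open>4 * pi * M\<^sup>2\<close> is twice the product of the sup bounds \<open>M\<close> and
  \<open>2 * pi * M\<close>.\<close>

lemma dx_mult:
  assumes "wiener1 M z" "wiener1 M v"
  shows "dx (\<lambda>y. z y * v y) = (\<lambda>x. z x * dx v x + dx z x * v x)" (is ?eq)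
    and "continuous_on S (dx (\<lambda>y. z y * v y))"
    and "cmod (dx (\<lambda>y. z y * v y) x) \<le> 4 * pi * M\<^sup>2"
    and "\<F> (dx (\<lambda>y. z y * v y)) k = deriv_symbol k * \<F> (\<lambda>y. z y * v y) k"
proof -
  have d: "((\<lambda>y. z y * v y) has_vector_derivative z x * dx v x + dx z x * v x) (at x)" for x
    by (intro has_vector_derivative_mult wiener1_derivative[OF assms(1)] wiener1_derivative[OF assms(2)])
  show eq: ?eq unfolding dx_def[of "\<lambda>y. z y * v y"] by (intro ext vector_derivative_at d)
  show cont: "continuous_on S (dx (\<lambda>y. z y * v y))" for S
    unfolding eq by (intro continuous_intros wiener1_continuous[OF assms(1)] wiener1_continuous[OF assms(2)]
      continuous_on_dx_wiener1[OF assms(1)] continuous_on_dx_wiener1[OF assms(2)])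
  have "cmod (z x * dx v x + dx z x * v x) \<le> M * (2 * pi * M) + (2 * pi * M) * M"
    using wiener1_bound[OF assms(1), of x] wiener1_bound[OF assms(2), of x] wiener1_nonneg[OF assms(1)]
      norm_dx_wiener1[OF assms(1), of x] norm_dx_wiener1[OF assms(2), of x]
    by (intro order_trans[OF norm_triangle_ineq] add_mono) (auto simp: norm_mult intro!: mult_mono)
  then show "cmod (dx (\<lambda>y. z y * v y) x) \<le> 4 * pi * M\<^sup>2"
    unfolding eq by (simp add: power2_eq_square mult_ac)
  show "\<F> (dx (\<lambda>y. z y * v y)) k = deriv_symbol k * \<F> (\<lambda>y. z y * v y) k"
    using wiener1_periodic[OF assms(1)] wiener1_periodic[OF assms(2)]
    by (intro fourier_coeff_derivative) (auto simp: cont[unfolded eq] periodic1_def eq intro!: d)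
qed

subsection \<open>Time derivatives of Fourier coefficients\<close>

text \<open>Differentiation under the integral by dominated convergence along sequences. The bound
  \<open>K\<close> on the time derivative controls difference quotients through the mean value
  inequality, whence the dominating constant \<open>2 * K\<close>.\<close>

lemma fourier_coeff_has_vector_derivative:
  assumes t: "t \<in> {0..T}"
    and w: "\<And>s x. s \<in> {0..T} \<Longrightarrow> ((\<lambda>s. w s x) has_vector_derivative w' s x) (at s within {0..T})"
    and K: "\<And>s x. s \<in> {0..T} \<Longrightarrow> cmod (w' s x) \<le> K"
    and c: "\<And>s. s \<in> {0..T} \<Longrightarrow> continuous_on UNIV (w s)" "continuous_on UNIV (w' t)"
  shows "((\<lambda>s. \<F> (w s) k) has_vector_derivative \<F> (w' t) k) (at t within {0..T})"
  unfolding has_vector_derivative_def has_derivative_iff_norm tendsto_at_iff_sequentially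
proof (intro conjI bounded_linear_scaleR_left allI impI)
  fix X assume X: "\<forall>i. X i \<in> {0..T} - {t}" "X \<longlonglongrightarrow> t"
  \<comment> \<open>The difference quotient minus its limit, tested against the basis function; its
    integral is the same expression for the Fourier coefficients.\<close>
  define h where "h = (\<lambda>s x. (w s x - w t x - (s - t) *\<^sub>R w' t x) * cnj (fourier_basis k x) /\<^sub>R (s - t))"
  have lim: "(\<lambda>i. h (X i) x) \<longlonglongrightarrow> 0" for x
  proof -
    have "((\<lambda>s. norm (w s x - w t x - (s - t) *\<^sub>R w' t x) / norm (s - t)) \<longlongrightarrow> 0) (at t within {0..T})"
      using w[OF t, of x] unfolding has_vector_derivative_def has_derivative_iff_norm by blast
    then have "(\<lambda>i. norm (w (X i) x - w t x - (X i - t) *\<^sub>R w' t x) / norm (X i - t)) \<longlonglongrightarrow> 0"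
      using X unfolding tendsto_at_iff_sequentially o_def by blast
    then have "(\<lambda>i. norm (h (X i) x)) \<longlonglongrightarrow> 0"
      by (simp add: h_def norm_mult divide_inverse mult_ac)
    then show ?thesis by (rule tendsto_norm_zero_cancel)
  qed
  have bound: "norm (h (X i) x) \<le> 2 * K" for i x
  proof -
    have Xi: "X i \<in> {0..T}" "X i - t \<noteq> 0" using X(1) by auto
    have "norm (w (X i) x - w t x) \<le> K * norm (X i - t)"
    proof (rule differentiable_bound[of "{0..T}" _ "\<lambda>s r. r *\<^sub>R w' s x"])
      show "onorm (\<lambda>r. r *\<^sub>R w' s x) \<le> K" if "s \<in> {0..T}" for s
        using K[OF that, of x] by (intro onorm_le) (auto simp: mult.commute[of K] mult_left_mono)
    qed (use w t Xi in \<open>auto simp: has_vector_derivative_def\<close>)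
    moreover have "norm ((X i - t) *\<^sub>R w' t x) \<le> K * norm (X i - t)"
      using K[OF t, of x] by (simp add: mult.commute mult_right_mono)
    ultimately have "norm (w (X i) x - w t x - (X i - t) *\<^sub>R w' t x) \<le> 2 * K * \<bar>X i - t\<bar>"
      using norm_triangle_ineq4[of "w (X i) x - w t x" "(X i - t) *\<^sub>R w' t x"] by simp
    moreover have "norm (h (X i) x) = norm (w (X i) x - w t x - (X i - t) *\<^sub>R w' t x) / \<bar>X i - t\<bar>"
      by (simp add: h_def norm_mult divide_inverse mult_ac)
    ultimately show ?thesis using Xi(2) by (simp add: divide_le_eq)
  qed
  have ch: "continuous_on UNIV (h (X i))" for i
    unfolding h_def using X(1) c t by (intro continuous_intros) auto
  have "(\<lambda>i. integral {0..1} (h (X i))) \<longlonglongrightarrow> integral {0..1} (\<lambda>x::real. 0)"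
    by (rule dominated_convergence(2)[where h = "\<lambda>x. 2 * K"]) (use ch lim bound in \<open>auto intro!: integrable_on_unit\<close>)
  then have "(\<lambda>i. norm (integral {0..1} (h (X i)))) \<longlonglongrightarrow> 0"
    by (simp add: tendsto_norm_zero)
  moreover have "norm (integral {0..1} (h (X i)))
      = norm (\<F> (w (X i)) k - \<F> (w t) k - (X i - t) *\<^sub>R \<F> (w' t) k) / norm (X i - t)" for i
  proof -
    have cX: "continuous_on UNIV (w (X i))" "continuous_on UNIV (w t)" using X(1) c t by auto
    have "integral {0..1} (h (X i))
        = integral {0..1} (\<lambda>x. (w (X i) x - w t x - (X i - t) *\<^sub>R w' t x) * cnj (fourier_basis k x)) /\<^sub>R (X i - t)"
      unfolding h_def by (rule integral_cmul)
    also have "integral {0..1} (\<lambda>x. (w (X i) x - w t x - (X i - t) *\<^sub>R w' t x) * cnj (fourier_basis k x))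
        = \<F> (\<lambda>x. w (X i) x - w t x - of_real (X i - t) * w' t x) k"
      using cX c(2) by (subst fourier_coeff_integral) (auto intro!: continuous_intros simp: scaleR_conv_of_real)
    also have "\<dots> = \<F> (w (X i)) k - \<F> (w t) k - of_real (X i - t) * \<F> (w' t) k"
      using cX c(2) by (simp add: fourier_coeff_diff fourier_coeff_cmult continuous_intros)
    finally have "integral {0..1} (h (X i))
        = (\<F> (w (X i)) k - \<F> (w t) k - (X i - t) *\<^sub>R \<F> (w' t) k) /\<^sub>R (X i - t)"
      by (simp only: scaleR_conv_of_real)
    then show ?thesis by (simp add: divide_inverse mult.commute)
  qed
  ultimately show "((\<lambda>y. norm (\<F> (w y) k - \<F> (w t) k - (y - t) *\<^sub>R \<F> (w' t) k)
      / norm (y - t)) \<circ> X) \<longlonglongrightarrow> 0"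
    by (simp add: o_def)
qed

section \<open>The exact system in Fourier coefficients\<close>

lemma norm_weighted_diff_le:
  assumes "cmod A \<le> X" "cmod B \<le> Y"
  shows "cmod (of_real a * A - of_real b * B) \<le> \<bar>a\<bar> * X + \<bar>b\<bar> * Y"
  using assms
  by (intro order_trans[OF norm_triangle_ineq4] add_mono) (auto simp: norm_mult intro!: mult_left_mono)

lemma dt_has_vector_derivative:
  assumes "dt_exists T w t x"
  shows "((\<lambda>s. w s x) has_vector_derivative dt T w t x) (at t within {0..T})"
  using assms unfolding dt_exists_def dt_def by (simp add: vector_derivative_works)

text \<open>With \<open>ilw_coeff2\<close>, the right-hand sides at frequency \<open>k\<close>. They
  serve the exact and the Galerkin system alike, since P_N does not touch a frequency |k| <= N; the
  error equation is a difference of two values of the same function.\<close>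

definition ilw_coeff1 :: "real \<Rightarrow> real \<Rightarrow> (real \<Rightarrow> complex) \<Rightarrow> (real \<Rightarrow> complex) \<Rightarrow> int \<Rightarrow> complex" where
  "ilw_coeff1 \<gamma> \<alpha> z v k = deriv_symbol k *
     (of_real (smooth_symbol \<gamma> \<alpha> k / \<gamma>) * \<F> (\<lambda>y. z y * v y) k
      - of_real (lin_symbol \<gamma> \<alpha> k / \<gamma>) * \<F> v k)"

definition ilw_coeff2 :: "real \<Rightarrow> (real \<Rightarrow> complex) \<Rightarrow> (real \<Rightarrow> complex) \<Rightarrow> int \<Rightarrow> complex" where
  "ilw_coeff2 \<gamma> z v k = deriv_symbol k *
     (of_real (1 / (2 * \<gamma>)) * \<F> (\<lambda>y. (v y)\<^sup>2) k - of_real (1 - \<gamma>) * \<F> z k)"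

lemma ilw_solution_coeffs:
  assumes \<gamma>: "\<gamma> > 0" and \<alpha>: "\<alpha> > 1"
    and sol: "ilw_solution \<gamma> \<alpha> T \<mu> \<zeta>\<^sub>0 u\<^sub>0 \<zeta> u"
    and w: "\<And>t. t \<in> {0..T} \<Longrightarrow> wiener1 M (\<zeta> t)" "\<And>t. t \<in> {0..T} \<Longrightarrow> wiener1 M (u t)"
    and t: "t \<in> {0..T}"
  shows "((\<lambda>s. \<F> (\<zeta> s) k) has_vector_derivative ilw_coeff1 \<gamma> \<alpha> (\<zeta> t) (u t) k) (at t within {0..T})"
    and "((\<lambda>s. \<F> (u s) k) has_vector_derivative ilw_coeff2 \<gamma> (\<zeta> t) (u t) k) (at t within {0..T})"
proof -
  let ?I = "\<lambda>t. ilw_inv \<gamma> \<alpha> (dx (\<lambda>y. \<zeta> t y * u t y))" and ?L = "\<lambda>t. ilw_lin \<gamma> \<alpha> (dx (u t))"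
  define r1 where "r1 = (\<lambda>t x. of_real (1 / \<gamma>) * ?I t x
    - of_real (1 / \<gamma>) * ?L t x)"
  define r2 where "r2 = (\<lambda>t x. of_real (1 / (2 * \<gamma>)) * dx (\<lambda>y. u t y * u t y) x - of_real (1 - \<gamma>) * dx (\<zeta> t) x)"
  have eqs: "dt_exists T \<zeta> t x \<and> dt_exists T u t x \<and>
        dt T \<zeta> t x + of_real (1 / \<gamma>) * ?L t x
          = of_real (1 / \<gamma>) * ?I t x \<and>
        dt T u t x + of_real (1 - \<gamma>) * dx (\<zeta> t) x
          = of_real (1 / (2 * \<gamma>)) * dx (\<lambda>y. (u t y)\<^sup>2) x" if "t \<in> {0..T}" for t x
    using sol that unfolding ilw_solution_def by blast
  have r: "((\<lambda>s. \<zeta> s x) has_vector_derivative r1 t x) (at t within {0..T})"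
    "((\<lambda>s. u s x) has_vector_derivative r2 t x) (at t within {0..T})" if "t \<in> {0..T}" for t x
  proof -
    have "dt T \<zeta> t x = r1 t x" "dt T u t x = r2 t x"
      using eqs[OF that, of x] by (auto simp: r1_def r2_def algebra_simps power2_eq_square)
    then show "((\<lambda>s. \<zeta> s x) has_vector_derivative r1 t x) (at t within {0..T})"
      "((\<lambda>s. u s x) has_vector_derivative r2 t x) (at t within {0..T})"
      using eqs[OF that, of x] dt_has_vector_derivative by metis+
  qed
  \<comment> \<open>The sup bound of \<open>ilw_inv_properties\<close> for an argument bounded by
    \<open>4 * pi * M\<^sup>2\<close>, the constant of \<open>dx_mult\<close>.\<close>
  let ?B = "((\<Sum>\<^sub>\<infinity>k. (smooth_symbol \<gamma> \<alpha> k)\<^sup>2) + (4 * pi * M\<^sup>2)\<^sup>2) / 2"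
  have inv: "continuous_on UNIV (?I t)"
    "\<F> (?I t) k
      = of_real (smooth_symbol \<gamma> \<alpha> k) * (deriv_symbol k * \<F> (\<lambda>y. \<zeta> t y * u t y) k)"
    "cmod (?I t x) \<le> ?B" if "t \<in> {0..T}" for t x k
  proof -
    note * = ilw_inv_properties[OF \<gamma> \<alpha> dx_mult(2)[OF w(1)[OF that] w(2)[OF that]] dx_mult(3)[OF w(1)[OF that] w(2)[OF that]]]
    show "continuous_on UNIV (?I t)" by (rule *)
    show "cmod (?I t x) \<le> ?B" by (rule *)
    show "\<F> (?I t) k
      = of_real (smooth_symbol \<gamma> \<alpha> k) * (deriv_symbol k * \<F> (\<lambda>y. \<zeta> t y * u t y) k)"
      by (simp only: *(2) dx_mult(4)[OF w(1)[OF that] w(2)[OF that]])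
  qed
  have c1: "continuous_on UNIV (r1 t)" if "t \<in> {0..T}" for t
    unfolding r1_def by (intro continuous_intros inv that ilw_lin_properties[OF \<gamma> \<alpha> w(2)])
  have c2: "continuous_on UNIV (r2 t)" if "t \<in> {0..T}" for t
    unfolding r2_def by (intro continuous_intros dx_mult(2)[OF w(2)[OF that] w(2)[OF that]]
        continuous_on_dx_wiener1[OF w(1)[OF that]])
  have b1: "cmod (r1 t x) \<le> \<bar>1 / \<gamma>\<bar> * ?B + \<bar>1 / \<gamma>\<bar> * (2 * pi * M)" if "t \<in> {0..T}" for t x
    unfolding r1_def
    by (rule norm_weighted_diff_le[OF inv(3)[OF that] ilw_lin_properties(3)[OF \<gamma> \<alpha> w(2)[OF that]]])
  have b2: "cmod (r2 t x) \<le> \<bar>1 / (2 * \<gamma>)\<bar> * (4 * pi * M\<^sup>2) + \<bar>1 - \<gamma>\<bar> * (2 * pi * M)" if "t \<in> {0..T}" for t x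
    unfolding r2_def
    by (rule norm_weighted_diff_le[OF dx_mult(3)[OF w(2)[OF that] w(2)[OF that]] norm_dx_wiener1[OF w(1)[OF that]]])
  have lin: "\<F> (\<lambda>x. a * ?I t x - a * ?L t x) k
      = a * \<F> (?I t) k - a * \<F> (?L t) k" for a
    using inv(1)[OF t] ilw_lin_properties(1)[OF \<gamma> \<alpha> w(2)[OF t]]
    by (simp add: fourier_coeff_diff fourier_coeff_cmult continuous_intros)
  then have "\<F> (r1 t) k = ilw_coeff1 \<gamma> \<alpha> (\<zeta> t) (u t) k"
    unfolding r1_def ilw_coeff1_def lin
    by (simp add: inv(2)[OF t] ilw_lin_properties(2)[OF \<gamma> \<alpha> w(2)[OF t]] algebra_simps)
  moreover have "((\<lambda>s. \<F> (\<zeta> s) k) has_vector_derivative \<F> (r1 t) k) (at t within {0..T})"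
    by (rule fourier_coeff_has_vector_derivative[OF t r(1) b1 wiener1_continuous[OF w(1)] c1[OF t]])
  ultimately show "((\<lambda>s. \<F> (\<zeta> s) k) has_vector_derivative ilw_coeff1 \<gamma> \<alpha> (\<zeta> t) (u t) k) (at t within {0..T})"
    by simp
  have lin: "\<F> (\<lambda>x. a * dx (\<lambda>y. u t y * u t y) x - b * dx (\<zeta> t) x) k
      = a * \<F> (dx (\<lambda>y. u t y * u t y)) k - b * \<F> (dx (\<zeta> t)) k" for a b
    using dx_mult(2)[OF w(2)[OF t] w(2)[OF t]] continuous_on_dx_wiener1[OF w(1)[OF t]]
    by (simp add: fourier_coeff_diff fourier_coeff_cmult continuous_intros)
  then have "\<F> (r2 t) k = ilw_coeff2 \<gamma> (\<zeta> t) (u t) k"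
    unfolding r2_def ilw_coeff2_def lin
    by (simp add: dx_mult(4)[OF w(2)[OF t] w(2)[OF t]] fourier_coeff_dx_wiener1[OF w(1)[OF t]]
      power2_eq_square algebra_simps)
  moreover have "((\<lambda>s. \<F> (u s) k) has_vector_derivative \<F> (r2 t) k) (at t within {0..T})"
    by (rule fourier_coeff_has_vector_derivative[OF t r(2) b2 wiener1_continuous[OF w(2)] c2[OF t]])
  ultimately show "((\<lambda>s. \<F> (u s) k) has_vector_derivative ilw_coeff2 \<gamma> (\<zeta> t) (u t) k) (at t within {0..T})"
    by simp
qed

subsection \<open>Trigonometric polynomials and the Galerkin system\<close>

lemma trig_proj_id:
  assumes "continuous_on UNIV v" "periodic1 v" "\<And>k. k \<notin> freqs N \<Longrightarrow> \<F> v k = 0"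
  shows "trig_proj N v = v"
proof
  fix x
  let ?d = "\<lambda>x. trig_proj N v x - v x"
  have "?d x = 0"
  proof (rule fourier_uniqueness)
    show "continuous_on UNIV ?d" by (intro continuous_intros continuous_on_trig_proj assms)
    show "periodic1 ?d" using periodic1_trig_proj assms(2) by (simp add: periodic1_def)
    show "\<F> ?d k = 0" for k
      using assms(1,3) by (simp add: fourier_coeff_diff continuous_on_trig_proj fourier_coeff_trig_proj)
  qed
  then show "trig_proj N v x = v x" by simp
qed

lemma trig_proj_in_trig_space: "trig_proj N v \<in> trig_space N"
  by (auto simp: trig_space_def trig_proj_eq)

lemma trig_spaceD:
  assumes "v \<in> trig_space N"
  shows "continuous_on S v" "periodic1 v" "k \<notin> freqs N \<Longrightarrow> \<F> v k = 0" "trig_proj N v = v"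
proof -
  obtain c where c: "v = (\<lambda>x. \<Sum>k\<in>freqs N. c k * fourier_basis k x)"
    using assms by (auto simp: trig_space_def)
  show co: "continuous_on S v" for S unfolding c by (intro continuous_intros)
  show per: "periodic1 v" unfolding c by (simp add: periodic1_def fourier_basis_periodic)
  show van: "\<F> v k = 0" if "k \<notin> freqs N" for k
    unfolding c using that by (subst fourier_coeff_trig) auto
  show "trig_proj N v = v" by (rule trig_proj_id[OF co per van])
qed

lemma trig_space_wiener1:
  assumes "v \<in> trig_space N" shows "\<exists>M. wiener1 M v"
  by (rule wiener1_finite) (use trig_spaceD[OF assms] in auto)

text \<open>A geometric sum in a root of unity of order \<open>2 * N + 1\<close>. The root differs
  from 1 for distinct frequencies because |l - k| <= 2 N, which is what fixes the number of
  nodes.\<close>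

lemma sum_roots_of_unity:
  assumes "k \<in> freqs N" "l \<in> freqs N"
  shows "(\<Sum>j<2 * N + 1. fourier_basis l (real j / real (2 * N + 1)) * cnj (fourier_basis k (real j / real (2 * N + 1))))
    = (if k = l then of_nat (2 * N + 1) else 0)"
proof (cases "k = l")
  case False
  let ?m = "2 * N + 1"
  define \<theta> where "\<theta> = 2 * pi * of_int (l - k) / real ?m"
  have pow: "fourier_basis l (real j / real ?m) * cnj (fourier_basis k (real j / real ?m)) = cis \<theta> ^ j" for j
  proof -
    have "fourier_basis l (real j / real ?m) * cnj (fourier_basis k (real j / real ?m))
        = fourier_basis (l - k) (real j / real ?m)"
      using fourier_basis_add[of l "- k"] by (simp add: fourier_basis_uminus)
    also have "\<dots> = cis (real j * \<theta>)"
      by (simp add: fourier_basis_def \<theta>_def mult_ac)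
    finally show ?thesis by (simp only: Complex.DeMoivre)
  qed
  have "cis \<theta> ^ ?m = 1"
  proof -
    have "cis \<theta> ^ ?m = cis (real ?m * \<theta>)" by (simp only: Complex.DeMoivre)
    also have "real ?m * \<theta> = 2 * pi * of_int (l - k)" by (simp add: \<theta>_def)
    finally show ?thesis by (simp only: cis_2pi_int)
  qed
  moreover have "cis \<theta> \<noteq> 1"
  proof
    assume "cis \<theta> = 1"
    then have "cos \<theta> = 1" by (metis cis.sel(1) one_complex.sel(1))
    then obtain n :: int where "\<theta> = of_int n * 2 * pi" using cos_one_2pi_int by blast
    moreover have "\<theta> * real ?m = 2 * pi * of_int (l - k)" by (simp add: \<theta>_def)
    ultimately have "(2 * pi) * of_int (l - k) = (2 * pi) * (real_of_int n * real ?m)"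
      by (simp only: mult_ac)
    then have "of_int (l - k) = real_of_int n * real ?m"
      by (simp only: mult_cancel_left) simp
    then have "l - k = n * int ?m" by (metis of_int_eq_iff of_int_mult of_int_of_nat_eq)
    moreover have "\<bar>l - k\<bar> < int ?m" using assms by auto
    ultimately have "\<bar>n\<bar> * int ?m < 1 * int ?m" by (simp add: abs_mult)
    then have "n = 0" by (simp only: mult_less_cancel_right) auto
    with \<open>l - k = n * int ?m\<close> False show False by simp
  qed
  ultimately have "(\<Sum>j<?m. cis \<theta> ^ j) = 0"
    using one_diff_power_eq[of "cis \<theta>" ?m] by auto
  then show ?thesis using False by (simp only: pow) simp
qed simp

text \<open>Coefficients of trigonometric polynomials are finite combinations of point values, so
  they inherit differentiability in time from the pointwise equation.\<close>

lemma fourier_coeff_nodes: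
  assumes "v \<in> trig_space N" "k \<in> freqs N"
  shows "\<F> v k = (\<Sum>j<2 * N + 1. v (real j / real (2 * N + 1)) *
    (cnj (fourier_basis k (real j / real (2 * N + 1))) / of_nat (2 * N + 1)))"
proof -
  let ?m = "2 * N + 1"
  let ?x = "\<lambda>j. real j / real ?m"
  have v: "v x = (\<Sum>l\<in>freqs N. \<F> v l * fourier_basis l x)" for x
    using trig_spaceD(4)[OF assms(1)] by (metis trig_proj_def)
  have "(\<Sum>j<?m. v (?x j) * (cnj (fourier_basis k (?x j)) / of_nat ?m))
      = (\<Sum>j<?m. \<Sum>l\<in>freqs N. \<F> v l / of_nat ?m * (fourier_basis l (?x j) * cnj (fourier_basis k (?x j))))"
    by (subst v) (simp add: sum_distrib_right sum_distrib_left mult_ac)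
  also have "\<dots> = (\<Sum>l\<in>freqs N. \<F> v l / of_nat ?m * (\<Sum>j<?m. fourier_basis l (?x j) * cnj (fourier_basis k (?x j))))"
    by (subst sum.swap) (simp only: sum_distrib_left)
  also have "\<dots> = (\<Sum>l\<in>freqs N. \<F> v l / of_nat ?m * (if k = l then of_nat ?m else 0))"
    using assms(2) by (intro sum.cong refl) (simp only: sum_roots_of_unity)
  also have "\<dots> = (\<Sum>l\<in>freqs N. if k = l then \<F> v l else 0)"
    by (intro sum.cong) (auto simp del: of_nat_Suc of_nat_add)
  finally show ?thesis using assms(2) by simp
qed

text \<open>Dominated convergence, as used for the exact solution, would ask for a bound on the time
  derivative uniform in time, which a Galerkin solution is not yet known to satisfy. A finite
  combination of point values asks for none.\<close>

lemma fourier_coeff_nodes_derivative: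
  assumes "\<And>s. s \<in> {0..T} \<Longrightarrow> w s \<in> trig_space N" "r \<in> trig_space N" "t \<in> {0..T}" "k \<in> freqs N"
    and "\<And>x. ((\<lambda>s. w s x) has_vector_derivative r x) (at t within {0..T})"
  shows "((\<lambda>s. \<F> (w s) k) has_vector_derivative \<F> r k) (at t within {0..T})"
proof -
  let ?m = "2 * N + 1"
  let ?x = "\<lambda>j. real j / real ?m"
  have "((\<lambda>s. \<Sum>j<?m. w s (?x j) * (cnj (fourier_basis k (?x j)) / of_nat ?m)) has_vector_derivative
      (\<Sum>j<?m. r (?x j) * (cnj (fourier_basis k (?x j)) / of_nat ?m))) (at t within {0..T})"
    by (intro has_vector_derivative_sum has_vector_derivative_mult_left assms(5))
  then have "((\<lambda>s. \<Sum>j<?m. w s (?x j) * (cnj (fourier_basis k (?x j)) / of_nat ?m)) has_vector_derivative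
      \<F> r k) (at t within {0..T})"
    by (simp only: fourier_coeff_nodes[OF assms(2,4)])
  then show ?thesis
    by (rule has_vector_derivative_transform[OF assms(3) _, rotated])
      (rule fourier_coeff_nodes[OF assms(1) assms(4)])
qed

lemma periodic1_dx_wiener1: "wiener1 M v \<Longrightarrow> periodic1 (dx v)"
  by (simp add: dx_wiener1 periodic1_fourier_sum)

lemma trig_spaceI:
  assumes "continuous_on UNIV v" "periodic1 v" "\<And>k. k \<notin> freqs N \<Longrightarrow> \<F> v k = 0"
  shows "v \<in> trig_space N"
  using trig_proj_id[OF assms] trig_proj_in_trig_space by metis

context
  fixes \<gamma> \<alpha> :: real
  assumes \<gamma>: "\<gamma> > 0" and \<alpha>: "\<alpha> > 1"
begin

definition galerkin_rhs1 :: "nat \<Rightarrow> (real \<Rightarrow> complex) \<Rightarrow> (real \<Rightarrow> complex) \<Rightarrow> real \<Rightarrow> complex" where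
  "galerkin_rhs1 N z v x = of_real (1 / \<gamma>) * ilw_inv \<gamma> \<alpha> (dx (trig_proj N (\<lambda>y. z y * v y))) x
     - of_real (1 / \<gamma>) * ilw_lin \<gamma> \<alpha> (dx v) x"

definition galerkin_rhs2 :: "nat \<Rightarrow> (real \<Rightarrow> complex) \<Rightarrow> (real \<Rightarrow> complex) \<Rightarrow> real \<Rightarrow> complex" where
  "galerkin_rhs2 N z v x = of_real (1 / (2 * \<gamma>)) * dx (trig_proj N (\<lambda>y. (v y)\<^sup>2)) x - of_real (1 - \<gamma>) * dx z x"

text \<open>Used in both directions: to read coefficient equations off a pointwise Galerkin
  solution, and to recover the pointwise equations from the coefficients in the existence
  proof.\<close>

lemma galerkin_rhs:
  assumes z: "z \<in> trig_space N" and v: "v \<in> trig_space N"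
  shows "galerkin_rhs1 N z v \<in> trig_space N" "galerkin_rhs2 N z v \<in> trig_space N"
    and "k \<in> freqs N \<Longrightarrow> \<F> (galerkin_rhs1 N z v) k = ilw_coeff1 \<gamma> \<alpha> z v k"
    and "k \<in> freqs N \<Longrightarrow> \<F> (galerkin_rhs2 N z v) k = ilw_coeff2 \<gamma> z v k"
proof -
  let ?p = "trig_proj N (\<lambda>y. z y * v y)" and ?q = "trig_proj N (\<lambda>y. (v y)\<^sup>2)"
  obtain Mp Mq Mz Mv where M: "wiener1 Mp ?p" "wiener1 Mq ?q" "wiener1 Mz z" "wiener1 Mv v"
    using trig_space_wiener1 trig_proj_in_trig_space z v by meson
  note cp = continuous_on_dx_wiener1[OF M(1), of UNIV]
  note inv = ilw_inv_properties[OF \<gamma> \<alpha> cp norm_dx_wiener1[OF M(1)]]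
  note lin = ilw_lin_properties[OF \<gamma> \<alpha> M(4)]
  have fp: "\<F> ?p k = (if k \<in> freqs N then \<F> (\<lambda>y. z y * v y) k else 0)" for k
    by (rule fourier_coeff_trig_proj)
  have fq: "\<F> ?q k = (if k \<in> freqs N then \<F> (\<lambda>y. (v y)\<^sup>2) k else 0)" for k
    by (rule fourier_coeff_trig_proj)
  have c1: "continuous_on UNIV (galerkin_rhs1 N z v)"
    unfolding galerkin_rhs1_def[abs_def] by (intro continuous_intros inv(1) lin(1))
  have c2: "continuous_on UNIV (galerkin_rhs2 N z v)"
    unfolding galerkin_rhs2_def[abs_def]
    by (intro continuous_intros continuous_on_dx_wiener1[OF M(2)] continuous_on_dx_wiener1[OF M(3)])
  have "\<F> (\<lambda>x. a * ilw_inv \<gamma> \<alpha> (dx ?p) x - a * ilw_lin \<gamma> \<alpha> (dx v) x) k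
      = a * \<F> (ilw_inv \<gamma> \<alpha> (dx ?p)) k - a * \<F> (ilw_lin \<gamma> \<alpha> (dx v)) k" for a k
    using inv(1)[of UNIV] lin(1)[of UNIV] by (simp add: fourier_coeff_diff fourier_coeff_cmult continuous_intros)
  then have f1: "\<F> (galerkin_rhs1 N z v) k
      = of_real (1 / \<gamma>) * (of_real (smooth_symbol \<gamma> \<alpha> k) * (deriv_symbol k * \<F> ?p k))
      - of_real (1 / \<gamma>) * (of_real (lin_symbol \<gamma> \<alpha> k) * (deriv_symbol k * \<F> v k))" for k
    unfolding galerkin_rhs1_def[abs_def] by (simp only: inv(2) lin(2) fourier_coeff_dx_wiener1[OF M(1)])
  have "\<F> (\<lambda>x. a * dx ?q x - b * dx z x) k = a * \<F> (dx ?q) k - b * \<F> (dx z) k" for a b k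
    using continuous_on_dx_wiener1[OF M(2), of UNIV] continuous_on_dx_wiener1[OF M(3), of UNIV]
    by (simp add: fourier_coeff_diff fourier_coeff_cmult continuous_intros)
  then have f2: "\<F> (galerkin_rhs2 N z v) k
      = of_real (1 / (2 * \<gamma>)) * (deriv_symbol k * \<F> ?q k) - of_real (1 - \<gamma>) * (deriv_symbol k * \<F> z k)" for k
    unfolding galerkin_rhs2_def[abs_def] by (simp only: fourier_coeff_dx_wiener1[OF M(2)] fourier_coeff_dx_wiener1[OF M(3)])
  show "galerkin_rhs1 N z v \<in> trig_space N"
  proof (rule trig_spaceI[OF c1])
    show "periodic1 (galerkin_rhs1 N z v)"
      using periodic1_ilw_inv periodic1_ilw_lin by (simp add: periodic1_def galerkin_rhs1_def)
    show "\<F> (galerkin_rhs1 N z v) k = 0" if "k \<notin> freqs N" for k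
      using trig_spaceD(3)[OF v that] trig_spaceD(3)[OF trig_proj_in_trig_space that]
      by (simp only: f1) simp
  qed
  show "galerkin_rhs2 N z v \<in> trig_space N"
  proof (rule trig_spaceI[OF c2])
    show "periodic1 (galerkin_rhs2 N z v)"
      using periodic1_dx_wiener1[OF M(2)] periodic1_dx_wiener1[OF M(3)] by (simp add: periodic1_def galerkin_rhs2_def)
    show "\<F> (galerkin_rhs2 N z v) k = 0" if "k \<notin> freqs N" for k
      using trig_spaceD(3)[OF z that] trig_spaceD(3)[OF trig_proj_in_trig_space that]
      by (simp only: f2) simp
  qed
  show "\<F> (galerkin_rhs1 N z v) k = ilw_coeff1 \<gamma> \<alpha> z v k" if "k \<in> freqs N" for k
    by (simp only: f1 fp that if_True ilw_coeff1_def) (simp add: algebra_simps)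
  show "\<F> (galerkin_rhs2 N z v) k = ilw_coeff2 \<gamma> z v k" if "k \<in> freqs N" for k
    by (simp only: f2 fq that if_True ilw_coeff2_def) (simp add: algebra_simps)
qed

lemma ilw_galerkin_coeffs:
  assumes sol: "ilw_galerkin_solution \<gamma> \<alpha> T N \<zeta>\<^sub>0 u\<^sub>0 z v" and t: "t \<in> {0..T}" and k: "k \<in> freqs N"
  shows "((\<lambda>s. \<F> (z s) k) has_vector_derivative ilw_coeff1 \<gamma> \<alpha> (z t) (v t) k) (at t within {0..T})"
    and "((\<lambda>s. \<F> (v s) k) has_vector_derivative ilw_coeff2 \<gamma> (z t) (v t) k) (at t within {0..T})"
proof -
  have ts: "z s \<in> trig_space N" "v s \<in> trig_space N" if "s \<in> {0..T}" for s
    using sol that unfolding ilw_galerkin_solution_def by blast+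
  have eqs: "dt_exists T z t x \<and> dt_exists T v t x \<and>
        dt T z t x + of_real (1 / \<gamma>) * ilw_lin \<gamma> \<alpha> (dx (v t)) x
          = of_real (1 / \<gamma>) * ilw_inv \<gamma> \<alpha> (dx (trig_proj N (\<lambda>y. z t y * v t y))) x \<and>
        dt T v t x + of_real (1 - \<gamma>) * dx (z t) x
          = of_real (1 / (2 * \<gamma>)) * dx (trig_proj N (\<lambda>y. (v t y)\<^sup>2)) x" for x
    using sol t unfolding ilw_galerkin_solution_def by blast
  have "dt T z t x = galerkin_rhs1 N (z t) (v t) x" "dt T v t x = galerkin_rhs2 N (z t) (v t) x" for x
    using eqs[of x] by (auto simp: galerkin_rhs1_def galerkin_rhs2_def algebra_simps)
  then have d: "((\<lambda>s. z s x) has_vector_derivative galerkin_rhs1 N (z t) (v t) x) (at t within {0..T})"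
    "((\<lambda>s. v s x) has_vector_derivative galerkin_rhs2 N (z t) (v t) x) (at t within {0..T})" for x
    using eqs[of x] dt_has_vector_derivative by metis+
  note r = galerkin_rhs[OF ts[OF t]]
  show "((\<lambda>s. \<F> (z s) k) has_vector_derivative ilw_coeff1 \<gamma> \<alpha> (z t) (v t) k) (at t within {0..T})"
    using fourier_coeff_nodes_derivative[OF ts(1) r(1) t k d(1)] by (simp only: r(3)[OF k])
  show "((\<lambda>s. \<F> (v s) k) has_vector_derivative ilw_coeff2 \<gamma> (z t) (v t) k) (at t within {0..T})"
    using fourier_coeff_nodes_derivative[OF ts(2) r(2) t k d(2)] by (simp only: r(4)[OF k])
qed

end

subsection \<open>The energy estimate\<close>

lemma sum_cmod_le:
  fixes c :: "'i \<Rightarrow> complex"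
  assumes "finite K"
  shows "(\<Sum>k\<in>K. cmod (c k)) \<le> sqrt (real (card K)) * sqrt (\<Sum>k\<in>K. (cmod (c k))\<^sup>2)"
  using L2_set_mult_ineq[of "\<lambda>k. 1" "\<lambda>k. cmod (c k)" K] by (simp add: L2_set_def)

text \<open>The inverse inequality: Cauchy-Schwarz over the 2 N + 1 frequencies.\<close>

lemma norm_trig_le:
  "cmod (\<Sum>k\<in>freqs N. c k * fourier_basis k x) \<le> sqrt (2 * real N + 1) * sqrt (\<Sum>k\<in>freqs N. (cmod (c k))\<^sup>2)"
proof -
  have "cmod (\<Sum>k\<in>freqs N. c k * fourier_basis k x) \<le> (\<Sum>k\<in>freqs N. cmod (c k))"
    by (rule order_trans[OF norm_sum]) (simp add: norm_mult)
  also have "\<dots> \<le> sqrt (real (card (freqs N))) * sqrt (\<Sum>k\<in>freqs N. (cmod (c k))\<^sup>2)"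
    by (rule sum_cmod_le) simp
  also have "real (card (freqs N)) = 2 * real N + 1" by simp
  finally show ?thesis .
qed

lemma L2_norm_mult_le:
  assumes "continuous_on UNIV F" "continuous_on UNIV G" "\<And>x. cmod (F x) \<le> S"
  shows "L2_norm (\<lambda>x. F x * G x) \<le> S * L2_norm G"
proof (rule power2_le_imp_le)
  have S: "0 \<le> S" using assms(3)[of 0] norm_ge_zero order_trans by blast
  have "integral {0..1} (\<lambda>x. (cmod (F x * G x))\<^sup>2) \<le> integral {0..1} (\<lambda>x. S\<^sup>2 * (cmod (G x))\<^sup>2)"
    using assms by (intro integral_le integrable_on_unit)
      (auto intro!: continuous_intros mult_right_mono power_mono simp: norm_mult power_mult_distrib)
  then show "(L2_norm (\<lambda>x. F x * G x))\<^sup>2 \<le> (S * L2_norm G)\<^sup>2"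
    using assms by (simp add: L2_norm_power2 continuous_intros power_mult_distrib)
  show "0 \<le> S * L2_norm G" using S by simp
qed

text \<open>The common estimate for all terms other than transport: multiplier in the sup norm, one
  factor of the product in the sup norm, the other in L2. Bessel passes from the product to its
  coefficients.\<close>

lemma multiplier_pairing_le:
  assumes "continuous_on UNIV F" "continuous_on UNIV G" "\<And>x. cmod (F x) \<le> S"
    and "\<And>k. k \<in> K \<Longrightarrow> cmod (m k) \<le> C" "finite K" "0 \<le> C"
  shows "cmod (\<Sum>k\<in>K. m k * \<F> (\<lambda>x. F x * G x) k * cnj (d k))
    \<le> C * (S * L2_norm G) * sqrt (\<Sum>k\<in>K. (cmod (d k))\<^sup>2)"
proof -
  let ?f = "\<F> (\<lambda>x. F x * G x)"
  have "cmod (\<Sum>k\<in>K. m k * ?f k * cnj (d k)) \<le> (\<Sum>k\<in>K. cmod (m k) * (cmod (?f k) * cmod (d k)))"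
    by (rule order_trans[OF norm_sum]) (simp add: norm_mult mult.assoc)
  also have "\<dots> \<le> (\<Sum>k\<in>K. C * (cmod (?f k) * cmod (d k)))"
    using assms by (intro sum_mono mult_right_mono) auto
  also have "\<dots> = C * (\<Sum>k\<in>K. \<bar>cmod (?f k)\<bar> * \<bar>cmod (d k)\<bar>)"
    by (simp add: sum_distrib_left)
  also have "\<dots> \<le> C * (L2_set (\<lambda>k. cmod (?f k)) K * L2_set (\<lambda>k. cmod (d k)) K)"
    using assms by (intro mult_left_mono L2_set_mult_ineq)
  also have "L2_set (\<lambda>k. cmod (?f k)) K \<le> S * L2_norm G"
  proof -
    have "L2_set (\<lambda>k. cmod (?f k)) K \<le> L2_norm (\<lambda>x. F x * G x)"
      unfolding L2_set_def using bessel[OF _ \<open>finite K\<close>, of "\<lambda>x. F x * G x"] assms(1,2)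
      by (intro real_le_lsqrt) (auto intro!: continuous_intros sum_nonneg)
    also have "\<dots> \<le> S * L2_norm G" by (rule L2_norm_mult_le[OF assms(1-3)])
    finally show ?thesis .
  qed
  finally show ?thesis using assms(6) by (simp add: L2_set_def mult_left_mono mult_right_mono sum_nonneg mult.assoc)
qed

lemma dx_real_valued:
  assumes "real_valued v" "(v has_vector_derivative d) (at x)"
  shows "cnj d = d"
proof -
  have "((\<lambda>x. cnj (v x)) has_vector_derivative cnj d) (at x)"
    using bounded_linear.has_vector_derivative[OF bounded_linear_cnj assms(2)] .
  moreover have "(\<lambda>x. cnj (v x)) = v"
    using assms(1) by (auto simp: real_valued_def Reals_cnj_iff)
  ultimately show ?thesis using assms(2) vector_derivative_unique_at by metis
qed

text \<open>The quadratic transport term loses no derivative: integrating by parts against a real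
  trigonometric polynomial \<open>f\<close> moves the derivative onto the smooth factor \<open>U\<close>, and the cubic
  term is an exact derivative.\<close>

lemma transport_identity:
  assumes U: "wiener1 M U" and f: "f \<in> trig_space N" "real_valued f"
  shows "(\<Sum>k\<in>freqs N. deriv_symbol k * \<F> (\<lambda>x. (2 * U x + f x) * f x) k * cnj (\<F> f k))
    = integral {0..1} (\<lambda>x. dx U x * (f x * f x))"
proof -
  let ?G = "\<lambda>x. (2 * U x + f x) * f x"
  obtain Mf where Mf: "wiener1 Mf f" using trig_space_wiener1[OF f(1)] by blast
  have cont: "continuous_on UNIV U" "continuous_on UNIV f" "continuous_on UNIV (dx U)" "continuous_on UNIV (dx f)"
    using U Mf by (auto intro: wiener1_continuous continuous_on_dx_wiener1)
  have f_eq: "f = trig_proj N f" using trig_spaceD(4)[OF f(1)] by simp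
  have dxf: "dx f x = (\<Sum>k\<in>freqs N. (deriv_symbol k * \<F> f k) * fourier_basis k x)" for x
  proof -
    have "(trig_proj N f has_vector_derivative
        (\<Sum>k\<in>freqs N. \<F> f k * (deriv_symbol k * fourier_basis k x))) (at x)"
      unfolding trig_proj_eq
      by (intro has_vector_derivative_sum has_vector_derivative_mult_right has_vector_derivative_fourier_basis)
    then show ?thesis
      using wiener1_derivative[OF Mf, of x] vector_derivative_unique_at[of f] by (simp add: mult_ac flip: f_eq)
  qed
  have "(\<Sum>k\<in>freqs N. deriv_symbol k * \<F> ?G k * cnj (\<F> f k))
      = - (\<Sum>k\<in>freqs N. \<F> ?G k * cnj (deriv_symbol k * \<F> f k))"
    by (simp add: sum_negf mult_ac)
  also have "\<dots> = - integral {0..1} (\<lambda>x. ?G x * cnj (dx f x))"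
    unfolding dxf using cont by (subst integral_mult_cnj_trig) (auto intro!: continuous_intros)
  also have "(\<lambda>x. ?G x * cnj (dx f x)) = (\<lambda>x. ?G x * dx f x)"
    by (simp only: dx_real_valued[OF f(2) wiener1_derivative[OF Mf]])
  finally have eq: "(\<Sum>k\<in>freqs N. deriv_symbol k * \<F> ?G k * cnj (\<F> f k))
      = - integral {0..1} (\<lambda>x. ?G x * dx f x)" .
  \<comment> \<open>A primitive, up to the wanted term: its derivative is U_x f^2 + (2 U + f) f f_x,
    and its integral over a period is zero.\<close>
  let ?H = "\<lambda>x. U x * (f x * f x) + (f x * (f x * f x)) / 3"
  have "(?H has_vector_derivative dx U x * (f x * f x) + ?G x * dx f x) (at x)" for x
  proof -
    note dU = wiener1_derivative[OF U, of x] and df = wiener1_derivative[OF Mf, of x]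
    have "(?H has_vector_derivative (U x * (f x * dx f x + dx f x * f x) + dx U x * (f x * f x))
        + (f x * (f x * dx f x + dx f x * f x) + dx f x * (f x * f x)) / 3) (at x)"
      by (intro has_vector_derivative_add has_vector_derivative_mult has_vector_derivative_divide dU df)
    then show ?thesis by (simp add: algebra_simps add_divide_distrib)
  qed
  moreover have "?H 1 = ?H 0"
    using wiener1_periodic[OF U, unfolded periodic1_def, rule_format, of 0]
      wiener1_periodic[OF Mf, unfolded periodic1_def, rule_format, of 0] by simp
  ultimately have "integral {0..1} (\<lambda>x. dx U x * (f x * f x) + ?G x * dx f x) = 0"
    by (rule integral_derivative_periodic)
  then have "integral {0..1} (\<lambda>x. dx U x * (f x * f x)) + integral {0..1} (\<lambda>x. ?G x * dx f x) = 0"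
    using cont by (subst (asm) integral_add) (auto intro!: integrable_on_unit continuous_intros)
  then show ?thesis unfolding eq by (simp add: add_eq_0_iff)
qed

lemma transport_bound:
  assumes U: "wiener1 M U" and f: "f \<in> trig_space N" "real_valued f"
  shows "cmod (\<Sum>k\<in>freqs N. deriv_symbol k * \<F> (\<lambda>x. (2 * U x + f x) * f x) k * cnj (\<F> f k))
    \<le> 2 * pi * M * (L2_norm f)\<^sup>2"
proof -
  have cf: "continuous_on UNIV f" using trig_spaceD(1)[OF f(1)] .
  have "cmod (integral {0..1} (\<lambda>x. dx U x * (f x * f x))) \<le> integral {0..1} (\<lambda>x. 2 * pi * M * (cmod (f x))\<^sup>2)"
    using norm_dx_wiener1[OF U]
    by (intro integral_norm_bound_integral integrable_on_unit continuous_intros cf continuous_on_dx_wiener1[OF U])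
      (auto simp: norm_mult power2_eq_square intro!: mult_right_mono)
  then show ?thesis
    unfolding transport_identity[OF assms] by (simp add: L2_norm_power2[OF cf])
qed

lemma L2_norm_trig_space:
  assumes "v \<in> trig_space N"
  shows "(L2_norm v)\<^sup>2 = (\<Sum>k\<in>freqs N. (cmod (\<F> v k))\<^sup>2)"
proof -
  have "(L2_norm (trig_proj N v))\<^sup>2 = (\<Sum>k\<in>freqs N. (cmod (\<F> v k))\<^sup>2)"
    using L2_norm_power2[OF continuous_on_trig_proj] trig_norm_square[of "freqs N" "\<F> v"]
    by (simp add: trig_proj_eq)
  then show ?thesis by (simp add: trig_spaceD(4)[OF assms])
qed

lemma Re_of_real_mult: "Re (of_real r * z) = r * Re z"
  by simp

abbreviation coeff_dist :: "nat \<Rightarrow> (real \<Rightarrow> complex) \<Rightarrow> (real \<Rightarrow> complex) \<Rightarrow> real" where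
  "coeff_dist N v w \<equiv> \<Sum>k\<in>freqs N. (cmod (\<F> v k - \<F> w k))\<^sup>2"

text \<open>The time derivative of the energy, written as an algebraic expression in four spatial
  profiles so that it can be estimated at a frozen time.\<close>

definition energy_rate :: "real \<Rightarrow> real \<Rightarrow> nat \<Rightarrow> (real \<Rightarrow> complex) \<Rightarrow> (real \<Rightarrow> complex) \<Rightarrow>
    (real \<Rightarrow> complex) \<Rightarrow> (real \<Rightarrow> complex) \<Rightarrow> real" where
  "energy_rate \<gamma> \<alpha> N zn un z v = (\<Sum>k\<in>freqs N.
     (1 - \<gamma>) * (2 * Re ((ilw_coeff1 \<gamma> \<alpha> zn un k - ilw_coeff1 \<gamma> \<alpha> z v k)
        * cnj (\<F> zn k - \<F> z k)))
     + lin_symbol \<gamma> \<alpha> k / \<gamma> * (2 * Re ((ilw_coeff2 \<gamma> zn un k - ilw_coeff2 \<gamma> z v k)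
        * cnj (\<F> un k - \<F> v k))))"

text \<open>Assembled from the three prefactors in \<open>energy_rate_split\<close>: the two
  smoothed terms contribute the gain \<open>\<gamma> / \<alpha>\<close> times
  \<open>2 * M + 2\<close>, the transport term \<open>4 * pi * M\<close>.\<close>

definition energy_const :: "real \<Rightarrow> real \<Rightarrow> real \<Rightarrow> real" where
  "energy_const \<gamma> \<alpha> M = (2 * (1 - \<gamma>) / \<alpha> + 1 / (\<alpha>\<^sup>2 * \<gamma>)) * (2 * M + 2)
     + (\<alpha> - 1) / (\<alpha> * \<gamma>\<^sup>2) * (4 * pi * M)"

text \<open>The linear coupling terms carry the common factor
  \<open>(1 - \<gamma>) * l / \<gamma>\<close> and have opposite real parts, since D is imaginary.
  In the second equation the weight \<open>l\<close> is then split by the definition of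
  \<open>lin_symbol\<close>: its constant part leaves a pure transport term, the rest is
  smoothed.\<close>

lemma energy_rate_split:
  assumes "\<gamma> > 0" "\<alpha> > 1"
  shows "energy_rate \<gamma> \<alpha> N zn un z v =
    2 * (1 - \<gamma>) / \<gamma> * Re (\<Sum>k\<in>freqs N. of_real (smooth_symbol \<gamma> \<alpha> k) * deriv_symbol k
        * (\<F> (\<lambda>x. zn x * un x) k - \<F> (\<lambda>x. z x * v x) k)
        * cnj (\<F> zn k - \<F> z k))
    + (\<alpha> - 1) / (\<alpha> * \<gamma>\<^sup>2) * Re (\<Sum>k\<in>freqs N. deriv_symbol k
        * (\<F> (\<lambda>x. (un x)\<^sup>2) k - \<F> (\<lambda>x. (v x)\<^sup>2) k)
        * cnj (\<F> un k - \<F> v k))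
    + 1 / (\<alpha> * \<gamma>\<^sup>2) * Re (\<Sum>k\<in>freqs N. of_real (smooth_symbol \<gamma> \<alpha> k) * deriv_symbol k
        * (\<F> (\<lambda>x. (un x)\<^sup>2) k - \<F> (\<lambda>x. (v x)\<^sup>2) k)
        * cnj (\<F> un k - \<F> v k))"
proof -
  let ?p = "\<lambda>k. \<F> (\<lambda>x. zn x * un x) k - \<F> (\<lambda>x. z x * v x) k"
  let ?q = "\<lambda>k. \<F> (\<lambda>x. (un x)\<^sup>2) k - \<F> (\<lambda>x. (v x)\<^sup>2) k"
  let ?\<theta> = "\<lambda>k. \<F> zn k - \<F> z k" and ?\<xi> = "\<lambda>k. \<F> un k - \<F> v k"
  have pointwise: "(1 - \<gamma>) * (2 * Re (D * (of_real (b / \<gamma>) * p' - of_real (l / \<gamma>) * u' - (of_real (b / \<gamma>) * p - of_real (l / \<gamma>) * u)) * cnj (a' - a)))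
      + l / \<gamma> * (2 * Re (D * (of_real (1 / (2 * \<gamma>)) * q' - of_real (1 - \<gamma>) * a' - (of_real (1 / (2 * \<gamma>)) * q - of_real (1 - \<gamma>) * a)) * cnj (u' - u)))
    = 2 * (1 - \<gamma>) / \<gamma> * Re (of_real b * D * (p' - p) * cnj (a' - a))
      + (\<alpha> - 1) / (\<alpha> * \<gamma>\<^sup>2) * Re (D * (q' - q) * cnj (u' - u))
      + 1 / (\<alpha> * \<gamma>\<^sup>2) * Re (of_real b * D * (q' - q) * cnj (u' - u))"
    if D: "D = \<i> * of_real \<kappa>" and l: "l = (\<alpha> - 1) / \<alpha> + b / \<alpha>" for D p p' q q' u u' a a' :: complex and b l \<kappa> :: real
  proof -
    define \<theta> \<xi> P Q where "\<theta> = a' - a" "\<xi> = u' - u" "P = p' - p" "Q = q' - q"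
    have skew: "Re (D * \<xi> * cnj \<theta>) + Re (D * \<theta> * cnj \<xi>) = 0"
      unfolding D by (simp add: algebra_simps)
    have 1: "D * (of_real (b / \<gamma>) * p' - of_real (l / \<gamma>) * u' - (of_real (b / \<gamma>) * p - of_real (l / \<gamma>) * u)) * cnj \<theta>
        = of_real (1 / \<gamma>) * (of_real b * D * P * cnj \<theta>) - of_real (l / \<gamma>) * (D * \<xi> * cnj \<theta>)"
      by (simp add: \<theta>_\<xi>_P_Q_def algebra_simps add_divide_distrib diff_divide_distrib)
    have 2: "D * (of_real (1 / (2 * \<gamma>)) * q' - of_real (1 - \<gamma>) * a' - (of_real (1 / (2 * \<gamma>)) * q - of_real (1 - \<gamma>) * a)) * cnj \<xi>
        = of_real (1 / (2 * \<gamma>)) * (D * Q * cnj \<xi>) - of_real (1 - \<gamma>) * (D * \<theta> * cnj \<xi>)"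
      by (simp add: \<theta>_\<xi>_P_Q_def algebra_simps add_divide_distrib diff_divide_distrib)
    have 3: "Re (of_real b * D * Q * cnj \<xi>) = b * Re (D * Q * cnj \<xi>)"
      by (simp only: mult.assoc Re_of_real_mult)
    have "(1 - \<gamma>) * (2 * (1 / \<gamma> * X - l / \<gamma> * Y)) + l / \<gamma> * (2 * (1 / (2 * \<gamma>) * W - (1 - \<gamma>) * V))
        = 2 * (1 - \<gamma>) / \<gamma> * X + (\<alpha> - 1) / (\<alpha> * \<gamma>\<^sup>2) * W + 1 / (\<alpha> * \<gamma>\<^sup>2) * (b * W)"
      if "Y + V = 0" for X Y V W :: real
    proof -
      have V: "V = - Y" using that by simp
      show ?thesis using assms unfolding V l
        by (simp add: divide_simps power2_eq_square) (simp add: algebra_simps)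
    qed
    from this[OF skew] show ?thesis
      unfolding \<theta>_\<xi>_P_Q_def(1,2)[symmetric] 1 2 \<theta>_\<xi>_P_Q_def(3,4)[symmetric] 3
      by (simp only: minus_complex.sel Re_of_real_mult)
  qed
  have "energy_rate \<gamma> \<alpha> N zn un z v = (\<Sum>k\<in>freqs N.
      2 * (1 - \<gamma>) / \<gamma> * Re (of_real (smooth_symbol \<gamma> \<alpha> k) * deriv_symbol k
        * ?p k
        * cnj (?\<theta> k))
    + (\<alpha> - 1) / (\<alpha> * \<gamma>\<^sup>2) * Re (deriv_symbol k
        * ?q k
        * cnj (?\<xi> k))
    + 1 / (\<alpha> * \<gamma>\<^sup>2) * Re (of_real (smooth_symbol \<gamma> \<alpha> k) * deriv_symbol k
        * ?q k
        * cnj (?\<xi> k)))"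
    unfolding energy_rate_def ilw_coeff1_def ilw_coeff2_def right_diff_distrib[of "deriv_symbol _", symmetric]
    by (intro sum.cong refl pointwise[OF deriv_symbol_def lin_symbol_def])
  then show ?thesis
    by (simp only: sum.distrib sum_distrib_left Re_sum)
qed

text \<open>Every product is arranged so that one factor has a sup bound (\<open>M\<close> for exact
  profiles, \<open>s * n\<close> for errors by the inverse inequality) and the other is small in L2
  (\<open>n\<close> for errors, \<open>\<delta>\<close> for tails).\<close>

lemma energy_rate_bound:
  assumes \<gamma>: "0 < \<gamma>" "\<gamma> < 1" and \<alpha>: "\<alpha> > 1" and N: "N \<ge> 1"
    and z: "wiener1 M z" and v: "wiener1 M v" "real_valued v"
    and zn: "zn \<in> trig_space N" and un: "un \<in> trig_space N" "real_valued un"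
    and \<delta>: "L2_norm (\<lambda>x. z x - trig_proj N z x) \<le> \<delta>" "L2_norm (\<lambda>x. v x - trig_proj N v x) \<le> \<delta>"
    and n: "n \<ge> 0" "coeff_dist N zn z \<le> n\<^sup>2"
      "coeff_dist N un v \<le> n\<^sup>2"
  shows "energy_rate \<gamma> \<alpha> N zn un z v
    \<le> energy_const \<gamma> \<alpha> M * (n\<^sup>2 + sqrt (real N) * n ^ 3 + real N * \<delta> * n)"
proof -
  let ?p = "\<lambda>k. \<F> (\<lambda>x. zn x * un x) k - \<F> (\<lambda>x. z x * v x) k"
  let ?q = "\<lambda>k. \<F> (\<lambda>x. (un x)\<^sup>2) k - \<F> (\<lambda>x. (v x)\<^sup>2) k"
  define Z where "Z = trig_proj N z"
  define U where "U = trig_proj N v"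
  define e where "e = (\<lambda>x. zn x - Z x)"
  define f where "f = (\<lambda>x. un x - U x)"
  define s where "s = sqrt (2 * real N + 1)"
  let ?b = "\<lambda>k. of_real (smooth_symbol \<gamma> \<alpha> k) * deriv_symbol k"
  let ?\<theta> = "\<lambda>k. \<F> zn k - \<F> z k" and ?\<xi> = "\<lambda>k. \<F> un k - \<F> v k"
  have M: "0 \<le> M" by (rule wiener1_nonneg[OF z])
  have \<delta>0: "0 \<le> \<delta>" using order_trans[OF L2_norm_nonneg \<delta>(1)] .
  have Z: "wiener1 M Z" and U: "wiener1 M U" unfolding Z_def U_def by (rule wiener1_trig_proj z v)+
  have U_trig: "U \<in> trig_space N" and Z_trig: "Z \<in> trig_space N"
    unfolding U_def Z_def by (rule trig_proj_in_trig_space)+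
  have cont: "continuous_on UNIV z" "continuous_on UNIV v" "continuous_on UNIV Z" "continuous_on UNIV U"
    "continuous_on UNIV zn" "continuous_on UNIV un"
    using z v Z U trig_spaceD(1)[OF zn] trig_spaceD(1)[OF un(1)]
    by (auto intro: wiener1_continuous)
  then have cont': "continuous_on UNIV e" "continuous_on UNIV f"
    unfolding e_def f_def by (auto intro!: continuous_intros)
  have fe: "\<F> e k = (if k \<in> freqs N then ?\<theta> k else 0)"
    and ff: "\<F> f k = (if k \<in> freqs N then ?\<xi> k else 0)" for k
  proof -
    have "\<F> e k = \<F> zn k - \<F> Z k"
      unfolding e_def by (rule fourier_coeff_diff[OF cont(5,3)])
    then show "\<F> e k = (if k \<in> freqs N then ?\<theta> k else 0)"
      using trig_spaceD(3)[OF zn, of k] by (cases "k \<in> freqs N") (simp_all only: Z_def fourier_coeff_trig_proj if_True if_False, simp)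
    have "\<F> f k = \<F> un k - \<F> U k"
      unfolding f_def by (rule fourier_coeff_diff[OF cont(6,4)])
    then show "\<F> f k = (if k \<in> freqs N then ?\<xi> k else 0)"
      using trig_spaceD(3)[OF un(1), of k] by (cases "k \<in> freqs N") (simp_all only: U_def fourier_coeff_trig_proj if_True if_False, simp)
  qed
  have e_trig: "e \<in> trig_space N"
    by (rule trig_spaceI[OF cont'(1)])
      (use trig_spaceD(2)[OF zn] trig_spaceD(2)[OF Z_trig] in \<open>auto simp: periodic1_def e_def fe[unfolded e_def]\<close>)
  have f_trig: "f \<in> trig_space N"
    by (rule trig_spaceI[OF cont'(2)])
      (use trig_spaceD(2)[OF un(1)] trig_spaceD(2)[OF U_trig] in \<open>auto simp: periodic1_def f_def ff[unfolded f_def]\<close>)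
  have f_real: "real_valued f"
    using un(2) real_valued_trig_proj[OF cont(2) v(2)] by (auto simp: real_valued_def f_def U_def)
  have sum_le: "sqrt (\<Sum>k\<in>freqs N. (cmod (?\<theta> k))\<^sup>2) \<le> n" "sqrt (\<Sum>k\<in>freqs N. (cmod (?\<xi> k))\<^sup>2) \<le> n"
    using n by (auto intro!: real_le_lsqrt sum_nonneg)
  have L2e: "L2_norm e \<le> n"
    by (rule power2_le_imp_le) (use n L2_norm_trig_space[OF e_trig] in \<open>simp_all add: fe\<close>)
  have L2f: "L2_norm f \<le> n"
    by (rule power2_le_imp_le) (use n L2_norm_trig_space[OF f_trig] in \<open>simp_all add: ff\<close>)
  have s0: "0 \<le> s" by (simp add: s_def)
  have sup: "cmod (e x) \<le> s * n" "cmod (f x) \<le> s * n" for x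
  proof -
    have "cmod (trig_proj N e x) \<le> s * sqrt (\<Sum>k\<in>freqs N. (cmod (?\<theta> k))\<^sup>2)"
      using norm_trig_le[where c = "\<F> e" and N = N and x = x] by (simp add: trig_proj_def s_def fe)
    then show "cmod (e x) \<le> s * n"
      using mult_left_mono[OF sum_le(1) s0] unfolding trig_spaceD(4)[OF e_trig] by (rule order_trans)
    have "cmod (trig_proj N f x) \<le> s * sqrt (\<Sum>k\<in>freqs N. (cmod (?\<xi> k))\<^sup>2)"
      using norm_trig_le[where c = "\<F> f" and N = N and x = x] by (simp add: trig_proj_def s_def ff)
    then show "cmod (f x) \<le> s * n"
      using mult_left_mono[OF sum_le(2) s0] unfolding trig_spaceD(4)[OF f_trig] by (rule order_trans)
  qed
  have b_le: "cmod (?b k) \<le> \<gamma> / \<alpha>" for k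
    using smooth_symbol_order[OF \<gamma>(1) \<alpha>, of k] smooth_symbol_pos[OF \<gamma>(1) \<alpha>, of k]
    by (simp add: norm_mult norm_deriv_symbol)
  have pair: "cmod (\<Sum>k\<in>freqs N. m k * \<F> (\<lambda>x. F x * G x) k * cnj (d k)) \<le> C * (S * g) * n"
    if "continuous_on UNIV F" "continuous_on UNIV G" "\<And>x. cmod (F x) \<le> S" "L2_norm G \<le> g"
      "\<And>k. k \<in> freqs N \<Longrightarrow> cmod (m k) \<le> C" "0 \<le> C" "sqrt (\<Sum>k\<in>freqs N. (cmod (d k))\<^sup>2) \<le> n"
    for F G S g m C d
  proof -
    have S: "0 \<le> S" using that(3)[of 0] norm_ge_zero order_trans by blast
    have "cmod (\<Sum>k\<in>freqs N. m k * \<F> (\<lambda>x. F x * G x) k * cnj (d k))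
        \<le> C * (S * L2_norm G) * sqrt (\<Sum>k\<in>freqs N. (cmod (d k))\<^sup>2)"
      using that by (intro multiplier_pairing_le) auto
    also have "\<dots> \<le> C * (S * g) * n"
    proof (rule mult_mono[OF mult_left_mono[OF mult_left_mono[OF that(4) S] that(6)] that(7)])
      show "0 \<le> C * (S * g)" using that(4,6) S L2_norm_nonneg[of G] by (meson mult_nonneg_nonneg order_trans)
      show "0 \<le> sqrt (\<Sum>k\<in>freqs N. (cmod (d k))\<^sup>2)" by (simp add: sum_nonneg)
    qed
    finally show ?thesis .
  qed
  have Re_le: "Re w \<le> B" if "cmod w \<le> B" for w B
    using that complex_Re_le_cmod order_trans by blast
  have norm_2: "cmod (a - b) \<le> A + B" if "cmod a \<le> A" "cmod b \<le> B" for a b A B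
    using norm_triangle_ineq4[of a b] that by linarith
  have norm_5: "cmod (a + b + c - d - e) \<le> A + B + C + D + E"
    if "cmod a \<le> A" "cmod b \<le> B" "cmod c \<le> C" "cmod d \<le> D" "cmod e \<le> E" for a b c d e A B C D E
    using norm_triangle_ineq[of a b] norm_triangle_ineq[of "a + b" c] norm_triangle_ineq4[of "a + b + c" d]
      norm_triangle_ineq4[of "a + b + c - d" e] that by linarith

  \<comment> \<open>Write \<open>zn = Z + e\<close> and \<open>un = U + f\<close>. The first three
    terms are the expansion around \<open>Z x * U x\<close>; the last two replace
    \<open>Z x * U x\<close> by the product of the untruncated functions.\<close>
  have D1: "?p k
      = \<F> (\<lambda>x. Z x * f x) k + \<F> (\<lambda>x. U x * e x) k + \<F> (\<lambda>x. e x * f x) k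
        - \<F> (\<lambda>x. U x * (z x - Z x)) k - \<F> (\<lambda>x. z x * (v x - U x)) k" for k
  proof -
    have "\<F> (\<lambda>x. Z x * f x) k + \<F> (\<lambda>x. U x * e x) k + \<F> (\<lambda>x. e x * f x) k
        - \<F> (\<lambda>x. U x * (z x - Z x)) k - \<F> (\<lambda>x. z x * (v x - U x)) k
      = \<F> (\<lambda>x. Z x * f x + U x * e x + e x * f x - U x * (z x - Z x) - z x * (v x - U x)) k"
      using cont cont' by (simp add: fourier_coeff_add fourier_coeff_diff continuous_intros)
    also have "(\<lambda>x. Z x * f x + U x * e x + e x * f x - U x * (z x - Z x) - z x * (v x - U x))
      = (\<lambda>x. zn x * un x - z x * v x)"
      by (simp add: e_def f_def algebra_simps)
    finally show ?thesis using cont by (simp add: fourier_coeff_diff continuous_intros)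
  qed
  \<comment> \<open>Same expansion for the square, with the error part kept together in exactly the
    shape that \<open>transport_identity\<close> handles.\<close>
  have D2: "?q k
      = \<F> (\<lambda>x. (2 * U x + f x) * f x) k - \<F> (\<lambda>x. (U x + v x) * (v x - U x)) k" for k
  proof -
    have "\<F> (\<lambda>x. (2 * U x + f x) * f x) k - \<F> (\<lambda>x. (U x + v x) * (v x - U x)) k
      = \<F> (\<lambda>x. (2 * U x + f x) * f x - (U x + v x) * (v x - U x)) k"
      using cont cont' by (simp add: fourier_coeff_diff continuous_intros)
    also have "(\<lambda>x. (2 * U x + f x) * f x - (U x + v x) * (v x - U x)) = (\<lambda>x. (un x)\<^sup>2 - (v x)\<^sup>2)"
      by (simp add: f_def algebra_simps power2_eq_square)
    finally show ?thesis using cont by (simp add: fourier_coeff_diff continuous_intros)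
  qed
  have UvM: "cmod (U x + v x) \<le> 2 * M" for x
    using norm_triangle_ineq[of "U x" "v x"] wiener1_bound[OF U, of x] wiener1_bound[OF v(1), of x] by simp
  have UfM: "cmod (2 * U x + f x) \<le> 2 * M + s * n" for x
    using norm_triangle_ineq[of "2 * U x" "f x"] wiener1_bound[OF U, of x] sup(2)[of x] by (simp add: norm_mult)
  note tails = \<delta>[folded Z_def U_def]
  have \<gamma>\<alpha>: "0 \<le> \<gamma> / \<alpha>" using \<gamma> \<alpha> by simp

  have T1: "Re (\<Sum>k\<in>freqs N. ?b k * ?p k * cnj (?\<theta> k))
      \<le> \<gamma> / \<alpha> * (2 * M * n + s * n * n + 2 * M * \<delta>) * n"
  proof -
    let ?S = "\<lambda>F G. \<Sum>k\<in>freqs N. ?b k * \<F> (\<lambda>x. F x * G x) k * cnj (?\<theta> k)"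
    have "(\<Sum>k\<in>freqs N. ?b k * ?p k * cnj (?\<theta> k))
      = ?S Z f + ?S U e + ?S e f - ?S U (\<lambda>x. z x - Z x) - ?S z (\<lambda>x. v x - U x)"
      unfolding D1 by (simp only: distrib_left distrib_right left_diff_distrib right_diff_distrib
        sum.distrib sum_subtractf)
    moreover have "cmod (?S Z f) \<le> \<gamma> / \<alpha> * (M * n) * n"
      by (rule pair) (use cont cont' wiener1_bound[OF Z] L2f b_le \<gamma>\<alpha> sum_le in auto)
    moreover have "cmod (?S U e) \<le> \<gamma> / \<alpha> * (M * n) * n"
      by (rule pair) (use cont cont' wiener1_bound[OF U] L2e b_le \<gamma>\<alpha> sum_le in auto)
    moreover have "cmod (?S e f) \<le> \<gamma> / \<alpha> * ((s * n) * n) * n"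
      by (rule pair) (use cont cont' sup L2f b_le \<gamma>\<alpha> sum_le in auto)
    moreover have "cmod (?S U (\<lambda>x. z x - Z x)) \<le> \<gamma> / \<alpha> * (M * \<delta>) * n"
      by (rule pair) (use cont wiener1_bound[OF U] tails b_le \<gamma>\<alpha> sum_le in \<open>auto intro!: continuous_intros\<close>)
    moreover have "cmod (?S z (\<lambda>x. v x - U x)) \<le> \<gamma> / \<alpha> * (M * \<delta>) * n"
      by (rule pair) (use cont wiener1_bound[OF z] tails b_le \<gamma>\<alpha> sum_le in \<open>auto intro!: continuous_intros\<close>)
    ultimately have "cmod (\<Sum>k\<in>freqs N. ?b k * ?p k * cnj (?\<theta> k))
      \<le> \<gamma> / \<alpha> * (M * n) * n + \<gamma> / \<alpha> * (M * n) * n + \<gamma> / \<alpha> * ((s * n) * n) * n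
        + \<gamma> / \<alpha> * (M * \<delta>) * n + \<gamma> / \<alpha> * (M * \<delta>) * n"
      by (simp only: norm_5)
    then show ?thesis by (intro Re_le) (simp add: algebra_simps)
  qed
  have T2: "Re (\<Sum>k\<in>freqs N. ?b k * ?q k * cnj (?\<xi> k))
      \<le> \<gamma> / \<alpha> * (2 * M * n + s * n * n + 2 * M * \<delta>) * n"
  proof -
    let ?S = "\<lambda>F G. \<Sum>k\<in>freqs N. ?b k * \<F> (\<lambda>x. F x * G x) k * cnj (?\<xi> k)"
    have "(\<Sum>k\<in>freqs N. ?b k * ?q k * cnj (?\<xi> k))
      = ?S (\<lambda>x. 2 * U x + f x) f - ?S (\<lambda>x. U x + v x) (\<lambda>x. v x - U x)"
      unfolding D2 by (simp only: left_diff_distrib right_diff_distrib sum_subtractf)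
    moreover have "cmod (?S (\<lambda>x. 2 * U x + f x) f) \<le> \<gamma> / \<alpha> * ((2 * M + s * n) * n) * n"
      by (rule pair) (use cont cont' UfM L2f b_le \<gamma>\<alpha> sum_le in \<open>auto intro!: continuous_intros\<close>)
    moreover have "cmod (?S (\<lambda>x. U x + v x) (\<lambda>x. v x - U x)) \<le> \<gamma> / \<alpha> * (2 * M * \<delta>) * n"
      by (rule pair) (use cont UvM tails b_le \<gamma>\<alpha> sum_le in \<open>auto intro!: continuous_intros\<close>)
    ultimately have "cmod (\<Sum>k\<in>freqs N. ?b k * ?q k * cnj (?\<xi> k))
      \<le> \<gamma> / \<alpha> * ((2 * M + s * n) * n) * n + \<gamma> / \<alpha> * (2 * M * \<delta>) * n"
      by (simp only: norm_2)
    then show ?thesis by (intro Re_le) (simp add: algebra_simps)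
  qed
  \<comment> \<open>Here nothing smooths. The error part is transport and costs no derivative; the
    tail part pays the largest derivative symbol \<open>2 * pi * real N\<close>, and this loss is
    what lowers the final rate from N^(-\<mu>) to N^(1 - \<mu>).\<close>
  have T3: "Re (\<Sum>k\<in>freqs N. deriv_symbol k * ?q k * cnj (?\<xi> k))
      \<le> 2 * pi * M * n\<^sup>2 + 2 * pi * real N * (2 * M * \<delta>) * n"
  proof -
    let ?S = "\<lambda>F G. \<Sum>k\<in>freqs N. deriv_symbol k * \<F> (\<lambda>x. F x * G x) k * cnj (?\<xi> k)"
    have "(\<Sum>k\<in>freqs N. deriv_symbol k * ?q k * cnj (?\<xi> k))
      = ?S (\<lambda>x. 2 * U x + f x) f - ?S (\<lambda>x. U x + v x) (\<lambda>x. v x - U x)"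
      unfolding D2 by (simp only: left_diff_distrib right_diff_distrib sum_subtractf)
    moreover have "cmod (?S (\<lambda>x. 2 * U x + f x) f) \<le> 2 * pi * M * n\<^sup>2"
    proof -
      have "?S (\<lambda>x. 2 * U x + f x) f = (\<Sum>k\<in>freqs N. deriv_symbol k * \<F> (\<lambda>x. (2 * U x + f x) * f x) k * cnj (\<F> f k))"
        by (intro sum.cong) (auto simp: ff)
      also have "cmod \<dots> \<le> 2 * pi * M * (L2_norm f)\<^sup>2" by (rule transport_bound[OF U f_trig f_real])
      also have "\<dots> \<le> 2 * pi * M * n\<^sup>2" using L2f M by (intro mult_left_mono power_mono) auto
      finally show ?thesis .
    qed
    moreover have "cmod (?S (\<lambda>x. U x + v x) (\<lambda>x. v x - U x)) \<le> 2 * pi * real N * (2 * M * \<delta>) * n"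
      by (rule pair) (use cont UvM tails norm_deriv_symbol_le sum_le in \<open>auto intro!: continuous_intros\<close>)
    ultimately show ?thesis by (intro Re_le) (simp only: norm_2)
  qed
  define X where "X = n\<^sup>2 + sqrt (real N) * n ^ 3 + real N * \<delta> * n"
  \<comment> \<open>Uses 2 N + 1 <= 4 N, hence N >= 1.\<close>
  have s_le: "s \<le> 2 * sqrt (real N)"
  proof -
    have "s \<le> sqrt (4 * real N)" using N by (simp add: s_def)
    then show ?thesis by (simp add: real_sqrt_mult)
  qed
  have \<delta>_le: "\<delta> * n \<le> real N * \<delta> * n"
    using mult_right_mono[of 1 "real N" "\<delta> * n"] N \<delta>0 n(1) by (simp add: mult.assoc)
  have X_ge: "0 \<le> n\<^sup>2" "0 \<le> sqrt (real N) * n ^ 3" "0 \<le> real N * \<delta> * n" using n(1) \<delta>0 by auto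
  have cubic: "(2 * M * n + s * n * n + 2 * M * \<delta>) * n \<le> (2 * M + 2) * X"
  proof -
    have 1: "s * n ^ 3 \<le> 2 * (sqrt (real N) * n ^ 3)" using mult_right_mono[OF s_le, of "n ^ 3"] n(1) by simp
    have 2: "M * (\<delta> * n) \<le> M * (real N * \<delta> * n)" using \<delta>_le M by (rule mult_left_mono)
    have 3: "0 \<le> M * (sqrt (real N) * n ^ 3)" using M X_ge by simp
    have 4: "(2 * M * n + s * n * n + 2 * M * \<delta>) * n = 2 * (M * n\<^sup>2) + s * n ^ 3 + 2 * (M * (\<delta> * n))"
      by (simp add: algebra_simps power2_eq_square power3_eq_cube)
    have 5: "(2 * M + 2) * X = 2 * (M * n\<^sup>2) + 2 * (M * (sqrt (real N) * n ^ 3)) + 2 * (M * (real N * \<delta> * n))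
        + 2 * n\<^sup>2 + 2 * (sqrt (real N) * n ^ 3) + 2 * (real N * \<delta> * n)"
      by (simp add: X_def algebra_simps)
    show ?thesis unfolding 4 5 using 1 2 3 X_ge by linarith
  qed
  have quad: "2 * pi * M * n\<^sup>2 + 2 * pi * real N * (2 * M * \<delta>) * n \<le> 4 * pi * M * X"
  proof -
    have "0 \<le> (pi * M) * n\<^sup>2" "0 \<le> (pi * M) * (sqrt (real N) * n ^ 3)" using M X_ge by simp_all
    then show ?thesis unfolding X_def by (simp add: algebra_simps)
  qed
  have "energy_rate \<gamma> \<alpha> N zn un z v \<le> 2 * (1 - \<gamma>) / \<gamma> * (\<gamma> / \<alpha> * ((2 * M + 2) * X))
      + (\<alpha> - 1) / (\<alpha> * \<gamma>\<^sup>2) * (4 * pi * M * X) + 1 / (\<alpha> * \<gamma>\<^sup>2) * (\<gamma> / \<alpha> * ((2 * M + 2) * X))"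
    unfolding energy_rate_split[OF \<gamma>(1) \<alpha>]
  proof (intro add_mono mult_left_mono)
    show "Re (\<Sum>k\<in>freqs N. ?b k * ?p k * cnj (?\<theta> k))
        \<le> \<gamma> / \<alpha> * ((2 * M + 2) * X)"
      using order_trans[OF T1[unfolded mult.assoc[of "\<gamma> / \<alpha>"]] mult_left_mono[OF cubic \<gamma>\<alpha>]] .
    show "Re (\<Sum>k\<in>freqs N. ?b k * ?q k * cnj (?\<xi> k))
        \<le> \<gamma> / \<alpha> * ((2 * M + 2) * X)"
      using order_trans[OF T2[unfolded mult.assoc[of "\<gamma> / \<alpha>"]] mult_left_mono[OF cubic \<gamma>\<alpha>]] .
    show "Re (\<Sum>k\<in>freqs N. deriv_symbol k * ?q k * cnj (?\<xi> k))
        \<le> 4 * pi * M * X"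
      by (rule order_trans[OF T3 quad])
  qed (use \<gamma> \<alpha> in auto)
  also have "\<dots> = energy_const \<gamma> \<alpha> M * X"
    using \<gamma> \<alpha> by (simp add: energy_const_def divide_simps power2_eq_square) (simp add: algebra_simps)
  finally show ?thesis unfolding X_def .
qed

section \<open>First contact and barrier arguments on an interval\<close>

lemma first_hitting_time:
  fixes f :: "real \<Rightarrow> real"
  assumes "continuous_on {0..T} f" "f 0 < c" "t \<in> {0..T}" "c \<le> f t"
  shows "\<exists>s. 0 < s \<and> s \<le> T \<and> f s = c \<and> (\<forall>r\<in>{0..<s}. f r < c)"
proof -
  have hit: "\<exists>s. 0 \<le> s \<and> s \<le> r \<and> f s = c" if "r \<in> {0..T}" "c \<le> f r" for r
    using IVT'[of f 0 c r] that assms(2) continuous_on_subset[OF assms(1), of "{0..r}"] by auto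
  \<comment> \<open>The level set is compact, so it has a least element. By \<open>hit\<close>, a
    value at or above \<open>c\<close> before that time would produce a still earlier
    contact.\<close>
  let ?Z = "{s \<in> {0..T}. f s = c}"
  have "closed ?Z" by (rule continuous_closed_preimage_constant[OF assms(1)]) simp
  moreover have "bounded ?Z" by (rule bounded_subset[OF bounded_closed_interval[of 0 T]]) auto
  ultimately have "compact ?Z" by (simp add: compact_eq_bounded_closed)
  moreover have "?Z \<noteq> {}" using hit[OF assms(3,4)] assms(3) by fastforce
  ultimately obtain s where s: "s \<in> ?Z" "\<And>r. r \<in> ?Z \<Longrightarrow> s \<le> r"
    using compact_attains_inf by meson
  have "s \<noteq> 0" using assms(2) s(1) by auto
  moreover have "f r < c" if r: "r \<in> {0..<s}" for r
  proof (rule ccontr)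
    assume "\<not> f r < c"
    moreover have rT: "r \<in> {0..T}" using r s(1) by auto
    ultimately obtain q where "0 \<le> q" "q \<le> r" "f q = c" using hit[OF rT] by auto
    then show False using s(2)[of q] rT r by auto
  qed
  ultimately show ?thesis using s(1) by (intro exI[of _ s]) auto
qed

text \<open>The derivatives are compared only at points of contact. This is the bootstrap: when the
  hypothesis is checked, the energy equals the barrier and its smallness may be used.\<close>

lemma barrier:
  fixes E b :: "real \<Rightarrow> real"
  assumes "\<And>t. t \<in> {0..T} \<Longrightarrow> (E has_real_derivative E' t) (at t within {0..T})"
    and "\<And>t. t \<in> {0..T} \<Longrightarrow> (b has_real_derivative b' t) (at t within {0..T})"
    and "E 0 < b 0" and "\<And>t. t \<in> {0..T} \<Longrightarrow> E t = b t \<Longrightarrow> E' t < b' t"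
    and "t \<in> {0..T}"
  shows "E t < b t"
proof (rule ccontr)
  define h where "h = (\<lambda>t. E t - b t)"
  assume "\<not> E t < b t"
  then have ht: "0 \<le> h t" and h0: "h 0 < 0" using assms(3) by (simp_all add: h_def)
  have dh: "(h has_real_derivative E' s - b' s) (at s within {0..T})" if "s \<in> {0..T}" for s
    unfolding h_def by (intro DERIV_diff assms that)
  then have "continuous_on {0..T} h"
    by (meson DERIV_continuous continuous_on_eq_continuous_within)
  then obtain s where s: "0 < s" "s \<le> T" "h s = 0" "\<And>r. r \<in> {0..<s} \<Longrightarrow> h r < 0"
    using first_hitting_time[OF _ h0 assms(5) ht] by blast
  have sT: "s \<in> {0..T}" using s by simp
  have "E' s - b' s < 0" using assms(4)[OF sT] s(3) by (simp add: h_def)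
  \<comment> \<open>A negative derivative at the first contact makes \<open>h\<close> positive just
    before it, against minimality. The minimum in \<open>r\<close> below keeps \<open>s - r\<close>
    inside the interval.\<close>
  from has_real_derivative_neg_dec_left[OF dh[OF sT] this]
  obtain d where d: "d > 0" "\<And>r. r > 0 \<Longrightarrow> s - r \<in> {0..T} \<Longrightarrow> r < d \<Longrightarrow> h s < h (s - r)" by blast
  define r where "r = min (d / 2) s"
  have r: "0 < r" "r < d" "s - r \<in> {0..T}" "s - r \<in> {0..<s}" using d(1) s by (auto simp: r_def)
  show False using d(2)[OF r(1,3,2)] s(3) s(4)[OF r(4)] by simp
qed

lemma has_real_derivative_cmod_power2:
  assumes "(w has_vector_derivative w') (at t within S)"
  shows "((\<lambda>t. (cmod (w t))\<^sup>2) has_real_derivative 2 * Re (w' * cnj (w t))) (at t within S)"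
proof -
  have "((\<lambda>t. Re (w t)) has_real_derivative Re w') (at t within S)"
    "((\<lambda>t. Im (w t)) has_real_derivative Im w') (at t within S)"
    using bounded_linear.has_vector_derivative[OF bounded_linear_Re assms]
      bounded_linear.has_vector_derivative[OF bounded_linear_Im assms]
    by (simp_all add: has_real_derivative_iff_has_vector_derivative)
  from DERIV_add[OF DERIV_power[OF this(1), of 2] DERIV_power[OF this(2), of 2]]
  show ?thesis by (simp add: cmod_power2 algebra_simps)
qed

lemma L2_norm_diff_power2:
  assumes "continuous_on UNIV v" "continuous_on UNIV w"
  shows "(L2_norm (\<lambda>x. v x - w x))\<^sup>2 \<le> 2 * (L2_norm v)\<^sup>2 + 2 * (L2_norm w)\<^sup>2"
proof -
  have "integral {0..1} (\<lambda>x. (cmod (v x - w x))\<^sup>2) \<le> integral {0..1} (\<lambda>x. 2 * (cmod (v x))\<^sup>2 + 2 * (cmod (w x))\<^sup>2)"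
    using assms by (intro integral_le integrable_on_unit cmod_diff_power2_le) (auto intro!: continuous_intros)
  also have "\<dots> = 2 * integral {0..1} (\<lambda>x. (cmod (v x))\<^sup>2) + 2 * integral {0..1} (\<lambda>x. (cmod (w x))\<^sup>2)"
    using assms by (subst integral_add) (auto intro!: integrable_on_unit continuous_intros)
  finally show ?thesis using assms by (simp add: L2_norm_power2 continuous_intros)
qed

section \<open>The error estimate on any interval of existence\<close>

locale ilw_setting =
  fixes \<gamma> \<alpha> T \<mu> :: real and \<zeta>\<^sub>0 u\<^sub>0 :: "real \<Rightarrow> complex" and \<zeta> u :: "real \<Rightarrow> real \<Rightarrow> complex"
    and M B :: real
  assumes \<gamma>: "0 < \<gamma>" "\<gamma> < 1" and \<alpha>: "\<alpha> > 1" and T: "T > 0" and \<mu>: "\<mu> > 3 / 2"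
    and sol: "ilw_solution \<gamma> \<alpha> T \<mu> \<zeta>\<^sub>0 u\<^sub>0 \<zeta> u"
    and w\<zeta>: "\<And>t. t \<in> {0..T} \<Longrightarrow> wiener1 M (\<zeta> t)" and wu: "\<And>t. t \<in> {0..T} \<Longrightarrow> wiener1 M (u t)"
    and tail\<zeta>: "\<And>t N. t \<in> {0..T} \<Longrightarrow> N \<ge> 1 \<Longrightarrow> L2_norm (\<lambda>x. \<zeta> t x - trig_proj N (\<zeta> t) x) \<le> B * real N powr (- \<mu>)"
    and tailu: "\<And>t N. t \<in> {0..T} \<Longrightarrow> N \<ge> 1 \<Longrightarrow> L2_norm (\<lambda>x. u t x - trig_proj N (u t) x) \<le> B * real N powr (- \<mu>)"
begin

lemma real_u: "t \<in> {0..T} \<Longrightarrow> real_valued (u t)" and real_\<zeta>: "t \<in> {0..T} \<Longrightarrow> real_valued (\<zeta> t)"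
  using sol by (auto simp: ilw_solution_def)

lemma initial: "\<zeta> 0 = \<zeta>\<^sub>0" "u 0 = u\<^sub>0"
  using sol by (auto simp: ilw_solution_def)

lemma M_nonneg: "0 \<le> M"
  using wiener1_nonneg[OF w\<zeta>[of 0]] T by simp

text \<open>A lower bound for both energy weights, the second through
  \<open>lin_symbol_lower\<close>.\<close>

definition coercivity :: real where
  "coercivity = min (1 - \<gamma>) ((\<alpha> - 1) / (\<alpha> * \<gamma>))"

text \<open>At contact the rate is at most \<open>energy_const\<close> times 5/2 n^2 + B^2 b / 2,
  where n^2 = b / \<open>coercivity\<close> and b is the barrier. The added 1 makes the comparison
  strict, as \<open>barrier\<close> requires.\<close>

definition growth :: real where
  "growth = energy_const \<gamma> \<alpha> M * (5 / (2 * coercivity) + B\<^sup>2 / 2) + 1"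

text \<open>The barrier at time \<open>T\<close> divided by \<open>coercivity\<close>; it bounds
  squared errors.\<close>

definition error_bound :: "nat \<Rightarrow> real" where
  "error_bound N = real N powr (2 - 2 * \<mu>) * (exp (growth * T) / coercivity)"

lemma coercivity_pos: "coercivity > 0"
  using \<gamma> \<alpha> by (simp add: coercivity_def)

lemma energy_const_nonneg: "0 \<le> energy_const \<gamma> \<alpha> M"
  using \<gamma> \<alpha> M_nonneg by (simp add: energy_const_def)

lemma growth_pos: "growth > 0"
  unfolding growth_def using energy_const_nonneg coercivity_pos by (intro add_nonneg_pos mult_nonneg_nonneg) auto

lemma error_bound_nonneg: "0 \<le> error_bound N"
  using coercivity_pos by (simp add: error_bound_def)

text \<open>Stated on an arbitrary \<open>{0..s}\<close> with constants depending on
  \<open>T\<close> alone, so that it is both the error estimate and the a priori bound for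
  existence. The smallness condition on N is what tames the cubic term.\<close>

lemma galerkin_coefficient_error:
  assumes N: "N \<ge> 1" "real N * error_bound N \<le> 1"
    and s: "0 \<le> s" "s \<le> T"
    and gal: "ilw_galerkin_solution \<gamma> \<alpha> s N \<zeta>\<^sub>0 u\<^sub>0 zn un"
    and t: "t \<in> {0..s}"
  shows "coeff_dist N (zn t) (\<zeta> t) \<le> error_bound N"
    and "coeff_dist N (un t) (u t) \<le> error_bound N"
proof -
  let ?A = "\<lambda>k. lin_symbol \<gamma> \<alpha> k / \<gamma>"
  let ?\<theta> = "\<lambda>k t. \<F> (zn t) k - \<F> (\<zeta> t) k"
  let ?\<xi> = "\<lambda>k t. \<F> (un t) k - \<F> (u t) k"
  define E where "E = (\<lambda>t. \<Sum>k\<in>freqs N. (1 - \<gamma>) * (cmod (?\<theta> k t))\<^sup>2 + ?A k * (cmod (?\<xi> k t))\<^sup>2)"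
  define b where "b = (\<lambda>t. real N powr (2 - 2 * \<mu>) * exp (growth * t))"
  define E' where "E' = (\<lambda>t. energy_rate \<gamma> \<alpha> N (zn t) (un t) (\<zeta> t) (u t))"
  have N0: "real N > 0" using N by simp
  have ts: "zn t \<in> trig_space N" "un t \<in> trig_space N" "real_valued (un t)" if "t \<in> {0..s}" for t
    using gal that unfolding ilw_galerkin_solution_def by blast+
  have sT: "t \<in> {0..T}" if "t \<in> {0..s}" for t using that s by auto
  have dE: "(E has_real_derivative E' t) (at t within {0..s})" if t: "t \<in> {0..s}" for t
  proof -
    have "((\<lambda>s. ?\<theta> k s) has_vector_derivative
        ilw_coeff1 \<gamma> \<alpha> (zn t) (un t) k - ilw_coeff1 \<gamma> \<alpha> (\<zeta> t) (u t) k) (at t within {0..s})"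
      "((\<lambda>s. ?\<xi> k s) has_vector_derivative
        ilw_coeff2 \<gamma> (zn t) (un t) k - ilw_coeff2 \<gamma> (\<zeta> t) (u t) k) (at t within {0..s})" if "k \<in> freqs N" for k
      using ilw_galerkin_coeffs[OF \<gamma>(1) \<alpha> gal t that] s
        ilw_solution_coeffs[OF \<gamma>(1) \<alpha> sol w\<zeta> wu sT[OF t], of k]
      by (auto intro!: has_vector_derivative_diff elim: has_vector_derivative_within_subset)
    then show ?thesis
      unfolding E_def E'_def energy_rate_def
      by (intro DERIV_sum DERIV_add DERIV_cmult has_real_derivative_cmod_power2)
  qed
  have db: "(b has_real_derivative growth * b t) (at t within {0..s})" for t
    unfolding b_def by (auto intro!: derivative_eq_intros)
  have b_pos: "b t > 0" for t using N0 by (simp add: b_def)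
  have E_lower: "coercivity * (\<Sum>k\<in>freqs N. (cmod (?\<theta> k t))\<^sup>2) \<le> E t"
    "coercivity * (\<Sum>k\<in>freqs N. (cmod (?\<xi> k t))\<^sup>2) \<le> E t" for t
  proof -
    have c1: "coercivity * (cmod (?\<theta> k t))\<^sup>2 \<le> (1 - \<gamma>) * (cmod (?\<theta> k t))\<^sup>2" for k
      by (intro mult_right_mono) (auto simp: coercivity_def)
    have "coercivity \<le> ?A k" for k
    proof -
      have "(\<alpha> - 1) / (\<alpha> * \<gamma>) = ((\<alpha> - 1) / \<alpha>) / \<gamma>" by simp
      also have "\<dots> \<le> ?A k" using lin_symbol_lower[OF \<gamma>(1) \<alpha>, of k] \<gamma> by (intro divide_right_mono) auto
      finally show ?thesis by (simp add: coercivity_def)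
    qed
    then have c2: "coercivity * (cmod (?\<xi> k t))\<^sup>2 \<le> ?A k * (cmod (?\<xi> k t))\<^sup>2" for k
      by (intro mult_right_mono) auto
    have p: "0 \<le> coercivity * (cmod c)\<^sup>2" for c using coercivity_pos by simp
    show "coercivity * (\<Sum>k\<in>freqs N. (cmod (?\<theta> k t))\<^sup>2) \<le> E t"
      unfolding E_def sum_distrib_left
    proof (rule sum_mono)
      fix k show "coercivity * (cmod (?\<theta> k t))\<^sup>2 \<le> (1 - \<gamma>) * (cmod (?\<theta> k t))\<^sup>2 + ?A k * (cmod (?\<xi> k t))\<^sup>2"
        using c1[of k] c2[of k] p[of "?\<xi> k t"] by linarith
    qed
    show "coercivity * (\<Sum>k\<in>freqs N. (cmod (?\<xi> k t))\<^sup>2) \<le> E t"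
      unfolding E_def sum_distrib_left
    proof (rule sum_mono)
      fix k show "coercivity * (cmod (?\<xi> k t))\<^sup>2 \<le> (1 - \<gamma>) * (cmod (?\<theta> k t))\<^sup>2 + ?A k * (cmod (?\<xi> k t))\<^sup>2"
        using c1[of k] c2[of k] p[of "?\<theta> k t"] by linarith
    qed
  qed
  have b_le: "b t / coercivity \<le> error_bound N" if "t \<in> {0..s}" for t
    using that s growth_pos coercivity_pos unfolding b_def error_bound_def times_divide_eq_right
    by (intro divide_right_mono mult_left_mono) auto
  have "E t < b t" if "t \<in> {0..s}" for t
  proof (rule barrier[OF dE db _ _ that])
    have "0 \<in> {0..s}" using s by simp
    \<comment> \<open>The discrete data are the truncated exact data, so the energy starts at 0,
      strictly below the positive barrier.\<close>
    have "zn 0 = trig_proj N (\<zeta> 0)" "un 0 = trig_proj N (u 0)"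
      using gal by (auto simp: ilw_galerkin_solution_def initial)
    then have "E 0 = 0" by (simp add: E_def fourier_coeff_trig_proj)
    then show "E 0 < b 0" using b_pos[of 0] by simp
  next
    fix t assume t: "t \<in> {0..s}" and eq: "E t = b t"
    \<comment> \<open>At contact the energy equals the barrier, so by coercivity both coefficient
      distances are at most \<open>n\<^sup>2\<close>.\<close>
    define n where "n = sqrt (b t / coercivity)"
    have n0: "0 \<le> n" and n2: "n\<^sup>2 = b t / coercivity"
      using b_pos[of t] coercivity_pos by (auto simp: n_def)
    have sums: "(\<Sum>k\<in>freqs N. (cmod (?\<theta> k t))\<^sup>2) \<le> n\<^sup>2" "(\<Sum>k\<in>freqs N. (cmod (?\<xi> k t))\<^sup>2) \<le> n\<^sup>2"
      using E_lower[of t] coercivity_pos unfolding n2 eq by (simp_all add: le_divide_eq mult.commute)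
    define \<delta> where "\<delta> = B * real N powr (- \<mu>)"
    have "E' t \<le> energy_const \<gamma> \<alpha> M * (n\<^sup>2 + sqrt (real N) * n ^ 3 + real N * \<delta> * n)"
      unfolding E'_def \<delta>_def
      by (rule energy_rate_bound[OF \<gamma> \<alpha> N(1) w\<zeta>[OF sT[OF t]] wu[OF sT[OF t]] real_u[OF sT[OF t]] ts[OF t]
            tail\<zeta>[OF sT[OF t] N(1)] tailu[OF sT[OF t] N(1)] n0 sums])
    also have "\<dots> \<le> energy_const \<gamma> \<alpha> M * ((5 / (2 * coercivity) + B\<^sup>2 / 2) * b t)"
    proof (rule mult_left_mono[OF _ energy_const_nonneg])
      \<comment> \<open>The smallness condition on N enters here: it absorbs the cubic term into the
        quadratic one.\<close>
      have "(sqrt (real N) * n)\<^sup>2 \<le> 1"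
      proof -
        have "(sqrt (real N) * n)\<^sup>2 = real N * (b t / coercivity)" by (simp add: power_mult_distrib n2)
        also have "\<dots> \<le> real N * error_bound N" using b_le[OF t] by (intro mult_left_mono) auto
        finally show ?thesis using N(2) by simp
      qed
      then have "sqrt (real N) * n \<le> 1" using n0 by (simp add: abs_square_le_1)
      then have cubic: "sqrt (real N) * n ^ 3 \<le> n\<^sup>2"
        using mult_right_mono[of "sqrt (real N) * n" 1 "n\<^sup>2"] by (simp add: power2_eq_square power3_eq_cube mult_ac)
      \<comment> \<open>The barrier carries the power 2 - 2 \<mu> precisely so that the squared
        consistency error N^2 N^(-2 \<mu>) is a multiple of it; the linear term is then split by 2 a
        b <= a^2 + b^2.\<close>
      have "(real N * \<delta>)\<^sup>2 \<le> B\<^sup>2 * b t"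
      proof -
        have "real N * \<delta> = B * real N powr (1 - \<mu>)"
          using N0 by (simp add: \<delta>_def powr_diff powr_minus divide_inverse)
        then have "(real N * \<delta>)\<^sup>2 = B\<^sup>2 * (real N powr (2 - 2 * \<mu>) * 1)"
          by (simp add: power_mult_distrib power2_eq_square flip: powr_add)
        also have "\<dots> \<le> B\<^sup>2 * b t"
          unfolding b_def using growth_pos t by (intro mult_left_mono) auto
        finally show ?thesis .
      qed
      then have lin: "real N * \<delta> * n \<le> (B\<^sup>2 * b t + n\<^sup>2) / 2"
        using sum_squares_bound[of "real N * \<delta>" n] by simp
      have "n\<^sup>2 + sqrt (real N) * n ^ 3 + real N * \<delta> * n \<le> 5 / 2 * n\<^sup>2 + B\<^sup>2 * b t / 2"
        using cubic lin by simp
      also have "\<dots> = (5 / (2 * coercivity) + B\<^sup>2 / 2) * b t"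
        using coercivity_pos by (simp add: n2 field_simps)
      finally show "n\<^sup>2 + sqrt (real N) * n ^ 3 + real N * \<delta> * n \<le> (5 / (2 * coercivity) + B\<^sup>2 / 2) * b t" .
    qed
    also have "\<dots> < growth * b t" using b_pos[of t] by (simp add: growth_def algebra_simps)
    finally show "E' t < growth * b t" .
  qed
  then have "E t < b t" using t .
  then have "E t / coercivity \<le> b t / coercivity" using coercivity_pos by (intro divide_right_mono) auto
  then have "E t / coercivity \<le> error_bound N" using b_le[OF t] by (rule order_trans)
  moreover have "(\<Sum>k\<in>freqs N. (cmod (?\<theta> k t))\<^sup>2) \<le> E t / coercivity"
    "(\<Sum>k\<in>freqs N. (cmod (?\<xi> k t))\<^sup>2) \<le> E t / coercivity"
    using E_lower[of t] coercivity_pos by (simp_all add: le_divide_eq mult.commute)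
  ultimately show "(\<Sum>k\<in>freqs N. (cmod (?\<theta> k t))\<^sup>2) \<le> error_bound N"
    "(\<Sum>k\<in>freqs N. (cmod (?\<xi> k t))\<^sup>2) \<le> error_bound N"
    by linarith+
qed

text \<open>Split at the truncation of \<open>v\<close>. The part in the trigonometric space has the
  coefficient distance as its squared norm; the tail is one power of N smaller and is weakened to
  the same rate.\<close>

lemma L2_error_aux:
  assumes N: "N \<ge> 1" and "vn \<in> trig_space N" "wiener1 M v"
    and sum: "coeff_dist N vn v \<le> error_bound N"
    and tail: "L2_norm (\<lambda>x. v x - trig_proj N v x) \<le> B * real N powr (- \<mu>)"
  shows "L2_norm (\<lambda>x. vn x - v x) \<le> sqrt (2 * (exp (growth * T) / coercivity) + 2 * B\<^sup>2) * real N powr (1 - \<mu>)"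
proof (rule power2_le_imp_le)
  let ?e = "\<lambda>x. vn x - trig_proj N v x" and ?r = "\<lambda>x. v x - trig_proj N v x"
  have N0: "real N \<ge> 1" using N by simp
  have c: "continuous_on UNIV vn" "continuous_on UNIV v" "continuous_on UNIV (trig_proj N v)"
    using trig_spaceD(1)[OF assms(2)] wiener1_continuous[OF assms(3)] continuous_on_trig_proj by blast+
  have fe: "\<F> ?e k = (if k \<in> freqs N then \<F> vn k - \<F> v k else 0)" for k
    using trig_spaceD(3)[OF assms(2), of k]
    by (cases "k \<in> freqs N") (simp_all only: fourier_coeff_diff[OF c(1,3)] fourier_coeff_trig_proj if_True if_False, simp)
  have "?e \<in> trig_space N"
    using c trig_spaceD(2)[OF assms(2)] periodic1_trig_proj
    by (intro trig_spaceI) (auto simp: fe periodic1_def intro!: continuous_intros)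
  then have e: "(L2_norm ?e)\<^sup>2 \<le> error_bound N"
    using sum by (simp add: L2_norm_trig_space fe)
  have "(L2_norm ?r)\<^sup>2 \<le> (B * real N powr (- \<mu>))\<^sup>2" by (intro power_mono tail) simp
  also have "\<dots> = B\<^sup>2 * real N powr (- (2 * \<mu>))"
    by (simp add: power_mult_distrib power2_eq_square flip: powr_add)
  also have "\<dots> \<le> B\<^sup>2 * real N powr (2 - 2 * \<mu>)" using N0 by (intro mult_left_mono powr_mono) auto
  finally have r: "(L2_norm ?r)\<^sup>2 \<le> B\<^sup>2 * real N powr (2 - 2 * \<mu>)" .
  have "(L2_norm (\<lambda>x. ?e x - ?r x))\<^sup>2 \<le> 2 * (L2_norm ?e)\<^sup>2 + 2 * (L2_norm ?r)\<^sup>2"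
    using c by (intro L2_norm_diff_power2 continuous_intros)
  also have "\<dots> \<le> 2 * error_bound N + 2 * (B\<^sup>2 * real N powr (2 - 2 * \<mu>))" using e r by simp
  also have "\<dots> = (2 * (exp (growth * T) / coercivity) + 2 * B\<^sup>2) * real N powr (2 - 2 * \<mu>)"
    by (simp add: error_bound_def algebra_simps)
  also have "\<dots> = (sqrt (2 * (exp (growth * T) / coercivity) + 2 * B\<^sup>2) * real N powr (1 - \<mu>))\<^sup>2"
  proof -
    have "(real N powr (1 - \<mu>))\<^sup>2 = real N powr (2 - 2 * \<mu>)" by (simp add: power2_eq_square flip: powr_add)
    moreover have "0 \<le> 2 * (exp (growth * T) / coercivity) + 2 * B\<^sup>2" using coercivity_pos by simp
    ultimately show ?thesis by (simp only: power_mult_distrib real_sqrt_pow2)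
  qed
  finally show "(L2_norm (\<lambda>x. vn x - v x))\<^sup>2 \<le> (sqrt (2 * (exp (growth * T) / coercivity) + 2 * B\<^sup>2) * real N powr (1 - \<mu>))\<^sup>2"
    by simp
  show "0 \<le> sqrt (2 * (exp (growth * T) / coercivity) + 2 * B\<^sup>2) * real N powr (1 - \<mu>)"
    using coercivity_pos by simp
qed

end

subsection \<open>Ordinary differential equations in Banach spaces\<close>

text \<open>Picard's fixed point argument in the weighted norm \<open>sup e^(- 2 L t) \<parallel>w t\<parallel>\<close>, which makes the
  integral operator a contraction on the whole interval.\<close>

lemma ode_global:
  fixes F :: "'a::banach \<Rightarrow> 'a"
  assumes L: "L > 0" and lip: "\<And>x y. norm (F x - F y) \<le> L * norm (x - y)" and T: "T \<ge> 0"
  obtains w where "w 0 = x0" "\<And>t. t \<in> {0..T} \<Longrightarrow> (w has_vector_derivative F (w t)) (at t within {0..T})"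
proof -
  \<comment> \<open>Clamping time to \<open>{0..T}\<close> turns functions on the interval into
    bounded continuous functions on the line, a complete metric space available as a type.\<close>
  define \<tau> where "\<tau> = (\<lambda>t. max 0 (min T t))"
  have \<tau>: "\<tau> t \<in> {0..T}" "t \<in> {0..T} \<Longrightarrow> \<tau> t = t" for t using T by (auto simp: \<tau>_def)
  \<comment> \<open>The unknown \<open>v\<close> is the solution already multiplied by the decaying
    weight; the exponential undoes this before \<open>F\<close> is applied.\<close>
  define g where "g = (\<lambda>(v :: real \<Rightarrow>\<^sub>C 'a) s. F (exp (2 * L * s) *\<^sub>R v s))"
  define H where "H = (\<lambda>v t. exp (- (2 * L * \<tau> t)) *\<^sub>R (x0 + integral {0..\<tau> t} (g v)))"
  have "L-lipschitz_on UNIV F" using lip L by (intro lipschitz_onI) (auto simp: dist_norm)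
  then have cF: "continuous_on UNIV F" by (rule lipschitz_on_continuous_on)
  have cg: "continuous_on S (g v)" for v S
    unfolding g_def by (intro continuous_on_compose2[OF cF] continuous_intros) auto
  have ig: "g v integrable_on {a..b}" for v a b
    by (intro integrable_continuous_real cg)
  define J where "J = (\<lambda>v t. exp (- (2 * L * t)) *\<^sub>R (x0 + integral {0..t} (g v)))"
  have HJ: "H v = J v \<circ> \<tau>" for v by (auto simp: H_def J_def)
  have cJ: "continuous_on {0..T} (J v)" for v
    unfolding J_def by (intro continuous_intros indefinite_integral_continuous_1 ig)
  have H: "H v \<in> bcontfun" for v
  proof -
    have "continuous_on UNIV (H v)"
      unfolding HJ by (rule continuous_on_compose) (auto intro!: continuous_intros continuous_on_subset[OF cJ] simp: \<tau>_def T)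
    moreover have "bounded (range (H v))"
      by (rule bounded_subset[OF compact_imp_bounded[OF compact_continuous_image[OF cJ compact_Icc]]])
        (use \<tau>(1) in \<open>auto simp: HJ\<close>)
    ultimately show ?thesis by (simp add: bcontfun_def)
  qed
  define \<Phi> where "\<Phi> = (\<lambda>v. Bcontfun (H v))"
  have \<Phi>: "apply_bcontfun (\<Phi> v) = H v" for v unfolding \<Phi>_def using H by (rule Bcontfun_inverse)
  have "\<exists>!v. \<Phi> v = v"
  proof (rule banach_fix_type[of "1 / 2"], simp, simp, intro allI)
    fix v w :: "real \<Rightarrow>\<^sub>C 'a"
    show "dist (\<Phi> v) (\<Phi> w) \<le> 1 / 2 * dist v w"
    proof (rule dist_bound)
      fix t
      let ?t = "\<tau> t" and ?d = "dist v w"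
      have t0: "0 \<le> ?t" using \<tau>(1)[of t] by simp
      have pt: "norm (g v s - g w s) \<le> L * ?d * exp (2 * L * s)" for s
      proof -
        have "norm (g v s - g w s) \<le> L * norm (exp (2 * L * s) *\<^sub>R (v s - w s))"
          using lip[of "exp (2 * L * s) *\<^sub>R v s" "exp (2 * L * s) *\<^sub>R w s"] by (simp add: g_def scaleR_diff_right)
        also have "\<dots> = L * exp (2 * L * s) * dist (v s) (w s)" by (simp add: dist_norm)
        also have "\<dots> \<le> L * exp (2 * L * s) * ?d" using L by (intro mult_left_mono dist_bounded) auto
        finally show ?thesis by (simp add: mult_ac)
      qed
      \<comment> \<open>Integrating the weight exp(2 L s) gains the factor 1/(2 L), which against
        the Lipschitz constant L leaves the contraction factor 1/2 whatever the length of the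
        interval.\<close>
      have ie: "((\<lambda>s. L * ?d * exp (2 * L * s)) has_integral (?d / 2 * exp (2 * L * ?t) - ?d / 2 * exp (2 * L * 0))) {0..?t}"
        using L by (intro fundamental_theorem_of_calculus t0)
          (auto intro!: derivative_eq_intros simp flip: has_real_derivative_iff_has_vector_derivative)
      have "norm (integral {0..?t} (g v) - integral {0..?t} (g w)) = norm (integral {0..?t} (\<lambda>s. g v s - g w s))"
        by (simp add: integral_diff ig)
      also have "\<dots> \<le> integral {0..?t} (\<lambda>s. L * ?d * exp (2 * L * s))"
        using ie by (intro integral_norm_bound_integral integrable_diff ig pt) (auto simp: has_integral_integrable)
      also have "\<dots> = ?d / 2 * exp (2 * L * ?t) - ?d / 2 * exp (2 * L * 0)" using ie by (rule integral_unique)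
      also have "\<dots> \<le> ?d / 2 * exp (2 * L * ?t)" by simp
      finally have int: "norm (integral {0..?t} (g v) - integral {0..?t} (g w)) \<le> ?d / 2 * exp (2 * L * ?t)" .
      have "dist (H v t) (H w t) = exp (- (2 * L * ?t)) * norm (integral {0..?t} (g v) - integral {0..?t} (g w))"
        by (simp add: dist_norm H_def flip: scaleR_diff_right)
      also have "\<dots> \<le> exp (- (2 * L * ?t)) * (?d / 2 * exp (2 * L * ?t))"
        using int by (intro mult_left_mono) auto
      also have "\<dots> = 1 / 2 * ?d" by (simp add: exp_minus field_simps)
      finally show "dist (\<Phi> v t) (\<Phi> w t) \<le> 1 / 2 * ?d" by (simp add: \<Phi>)
    qed
  qed
  then obtain v where "\<Phi> v = v" by blast
  then have v: "v t = J v t" if "t \<in> {0..T}" for t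
    using \<Phi>[of v] \<tau>(2)[OF that] by (simp add: HJ)
  \<comment> \<open>The fixed point with the weight removed, in integral form so that the derivative
    can be read off.\<close>
  define w where "w = (\<lambda>t. x0 + integral {0..t} (g v))"
  have w: "F (w t) = g v t" if "t \<in> {0..T}" for t
    by (simp add: w_def g_def v[OF that] J_def exp_minus)
  show thesis
  proof (rule that[of w])
    show "w 0 = x0" by (simp add: w_def)
    fix t assume t: "t \<in> {0..T}"
    have "((\<lambda>t. integral {0..t} (g v)) has_vector_derivative g v t) (at t within {0..T})"
      by (rule integral_has_vector_derivative[OF cg t])
    then have "((\<lambda>t. x0 + integral {0..t} (g v)) has_vector_derivative 0 + g v t) (at t within {0..T})"
      by (intro has_vector_derivative_add has_vector_derivative_const)
    then show "(w has_vector_derivative F (w t)) (at t within {0..T})"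
      unfolding w[OF t] by (simp add: w_def[abs_def])
  qed
qed

definition ball_retract :: "real \<Rightarrow> 'a::real_normed_vector \<Rightarrow> 'a" where
  "ball_retract R x = (R / max R (norm x)) *\<^sub>R x"

lemma norm_ball_retract: "R > 0 \<Longrightarrow> norm (ball_retract R x) \<le> R"
  by (auto simp: ball_retract_def max_def divide_simps)

lemma ball_retract_id: "R > 0 \<Longrightarrow> norm x \<le> R \<Longrightarrow> ball_retract R x = x"
  by (simp add: ball_retract_def max_def)

text \<open>Move the point at a fixed scaling, then change the scaling; each costs at most
  \<open>norm (x - y)\<close>. The constant 2 suits general norms, as needed for the sup
  norm.\<close>

lemma ball_retract_lipschitz:
  assumes "R > 0"
  shows "norm (ball_retract R x - ball_retract R y) \<le> 2 * norm (x - y)"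
proof -
  define p where "p = max R (norm x)"
  define q where "q = max R (norm y)"
  have pq: "p > 0" "q > 0" "R \<le> p" "norm y \<le> q" "R \<le> q" using assms by (auto simp: p_def q_def)
  have "\<bar>q - p\<bar> \<le> \<bar>norm y - norm x\<bar>" by (auto simp: p_def q_def max_def)
  also have "\<dots> \<le> norm (x - y)" by (metis norm_minus_commute norm_triangle_ineq3)
  finally have d: "\<bar>q - p\<bar> \<le> norm (x - y)" .
  have "ball_retract R x - ball_retract R y = (R / p) *\<^sub>R (x - y) + (R / p - R / q) *\<^sub>R y"
    by (simp add: ball_retract_def p_def q_def algebra_simps)
  also have "norm \<dots> \<le> norm ((R / p) *\<^sub>R (x - y)) + norm ((R / p - R / q) *\<^sub>R y)"
    by (rule norm_triangle_ineq)
  also have "norm ((R / p) *\<^sub>R (x - y)) \<le> norm (x - y)"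
    using assms pq mult_right_mono[of "R / p" 1 "norm (x - y)"] by simp
  also have "norm ((R / p - R / q) *\<^sub>R y) \<le> norm (x - y)"
  proof -
    have "R / p - R / q = (R / p) * ((q - p) / q)" using pq by (simp add: field_simps)
    then have "norm ((R / p - R / q) *\<^sub>R y) = (R / p) * (\<bar>q - p\<bar> * (norm y / q))"
      using assms pq by (simp add: abs_mult)
    also have "\<dots> \<le> 1 * (\<bar>q - p\<bar> * 1)"
      using assms pq by (intro mult_mono mult_left_mono) auto
    finally show ?thesis using d by simp
  qed
  finally show ?thesis by simp
qed

text \<open>A solution of the system truncated at radius \<open>R\<close> can only leave the ball through a point of
  norm \<open>R\<close>, which the a priori bound rules out.\<close>

lemma ode_a_priori:
  fixes F :: "'a::banach \<Rightarrow> 'a"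
  assumes L: "L > 0" and T: "T > 0" and x0: "norm x0 < R"
    and lip: "\<And>x y. norm x \<le> R \<Longrightarrow> norm y \<le> R \<Longrightarrow> norm (F x - F y) \<le> L * norm (x - y)"
    and bound: "\<And>s w. 0 < s \<Longrightarrow> s \<le> T \<Longrightarrow> w 0 = x0 \<Longrightarrow>
      (\<And>t. t \<in> {0..s} \<Longrightarrow> (w has_vector_derivative F (w t)) (at t within {0..s})) \<Longrightarrow> norm (w s) < R"
  obtains w where "w 0 = x0" "\<And>t. t \<in> {0..T} \<Longrightarrow> (w has_vector_derivative F (w t)) (at t within {0..T})"
proof -
  have R: "R > 0" using x0 norm_ge_zero[of x0] by linarith
  have "norm (F (ball_retract R x) - F (ball_retract R y)) \<le> (2 * L) * norm (x - y)" for x y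
    using order_trans[OF lip[OF norm_ball_retract[OF R] norm_ball_retract[OF R]]
        mult_left_mono[OF ball_retract_lipschitz[OF R, of x y], of L]] L by simp
  then obtain w where w0: "w 0 = x0"
    and w: "\<And>t. t \<in> {0..T} \<Longrightarrow> (w has_vector_derivative F (ball_retract R (w t))) (at t within {0..T})"
    using ode_global[of "2 * L" "\<lambda>x. F (ball_retract R x)" T x0] L T by auto
  have "continuous_on {0..T} w"
    using w by (meson continuous_on_eq_continuous_within has_vector_derivative_continuous)
  then have cn: "continuous_on {0..T} (\<lambda>t. norm (w t))" by (intro continuous_intros)
  have small: "norm (w t) \<le> R" if t: "t \<in> {0..T}" for t
  proof (rule ccontr)
    assume "\<not> norm (w t) \<le> R"
    then have Rt: "R \<le> norm (w t)" by simp
    obtain s where s0: "0 < s" and sT: "s \<in> {0..T}" and ws: "norm (w s) = R"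
      and before: "\<And>r. r \<in> {0..<s} \<Longrightarrow> norm (w r) < R"
      using first_hitting_time[OF cn _ t Rt] x0 w0 by auto
    \<comment> \<open>Up to \<open>s\<close> the retraction is therefore the identity and
      \<open>w\<close> solves the untruncated equation, so the a priori bound applies at
      \<open>s\<close>.\<close>
    have le: "norm (w r) \<le> R" if "r \<in> {0..s}" for r
      using that before[of r] ws by (cases "r = s") (auto intro: less_imp_le)
    have "norm (w s) < R"
    proof (rule bound[of s w])
      show "0 < s" "s \<le> T" "w 0 = x0" using s0 sT w0 by auto
      fix r assume r: "r \<in> {0..s}"
      then have "r \<in> {0..T}" using sT by auto
      from has_vector_derivative_within_subset[OF w[OF this], of "{0..s}"]
      show "(w has_vector_derivative F (w r)) (at r within {0..s})"
        using sT by (simp add: ball_retract_id[OF R le[OF r]])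
    qed
    then show False using ws by simp
  qed
  show thesis
    using that[of w] w w0 small by (simp add: ball_retract_id[OF R])
qed

subsection \<open>Existence for the Galerkin system\<close>

instance bcontfun :: (metric_space, banach) banach ..

abbreviation cfun :: "(real \<Rightarrow>\<^sub>C real) \<Rightarrow> real \<Rightarrow> complex" where
  "cfun p \<equiv> \<lambda>x. complex_of_real (apply_bcontfun p x)"

text \<open>A type cannot depend on N, so a fixed Banach space of real functions replaces the
  coefficient space. Taking the real part puts real-valuedness into the type; on Hermitian
  coefficients it changes nothing, by \<open>cfun_re_trig\<close>.\<close>

definition re_trig :: "nat \<Rightarrow> (int \<Rightarrow> complex) \<Rightarrow> real \<Rightarrow>\<^sub>C real" where
  "re_trig N c = Bcontfun (\<lambda>x. Re (\<Sum>k\<in>freqs N. c k * fourier_basis k x))"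

lemma apply_re_trig: "apply_bcontfun (re_trig N c) x = Re (\<Sum>k\<in>freqs N. c k * fourier_basis k x)"
proof -
  have "(\<lambda>x. Re (\<Sum>k\<in>freqs N. c k * fourier_basis k x)) \<in> bcontfun"
  proof (rule bcontfun_normI)
    show "continuous_on UNIV (\<lambda>x. Re (\<Sum>k\<in>freqs N. c k * fourier_basis k x))" by (intro continuous_intros)
    show "norm (Re (\<Sum>k\<in>freqs N. c k * fourier_basis k x)) \<le> (\<Sum>k\<in>freqs N. cmod (c k))" for x
    proof -
      have "norm (Re (\<Sum>k\<in>freqs N. c k * fourier_basis k x)) \<le> cmod (\<Sum>k\<in>freqs N. c k * fourier_basis k x)"
        by (simp only: real_norm_def abs_Re_le_cmod)
      also have "\<dots> \<le> (\<Sum>k\<in>freqs N. cmod (c k))" by (rule order_trans[OF norm_sum]) (simp add: norm_mult)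
      finally show ?thesis .
    qed
  qed
  then show ?thesis unfolding re_trig_def by (simp only: Bcontfun_inverse)
qed

lemma norm_re_trig_diff: "norm (re_trig N c - re_trig N d) \<le> (\<Sum>k\<in>freqs N. cmod (c k - d k))"
proof (rule norm_bound)
  fix x
  have "apply_bcontfun (re_trig N c - re_trig N d) x = Re (\<Sum>k\<in>freqs N. (c k - d k) * fourier_basis k x)"
    by (simp only: minus_bcontfun.rep_eq apply_re_trig left_diff_distrib sum_subtractf minus_complex.sel)
  also have "norm \<dots> \<le> cmod (\<Sum>k\<in>freqs N. (c k - d k) * fourier_basis k x)"
    by (simp only: real_norm_def abs_Re_le_cmod)
  also have "\<dots> \<le> (\<Sum>k\<in>freqs N. cmod (c k - d k))" by (rule order_trans[OF norm_sum]) (simp add: norm_mult)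
  finally show "norm (apply_bcontfun (re_trig N c - re_trig N d) x) \<le> (\<Sum>k\<in>freqs N. cmod (c k - d k))" .
qed

lemma cfun_re_trig:
  assumes "\<And>k. c (- k) = cnj (c k)"
  shows "cfun (re_trig N c) = (\<lambda>x. \<Sum>k\<in>freqs N. c k * fourier_basis k x)"
proof
  fix x
  let ?s = "\<Sum>k\<in>freqs N. c k * fourier_basis k x"
  have "cnj ?s = (\<Sum>k\<in>freqs N. c (- k) * fourier_basis (- k) x)"
    by (simp add: assms fourier_basis_uminus)
  also have "\<dots> = ?s" by (rule sum.reindex_bij_witness[of _ uminus uminus]) auto
  finally have "?s \<in> \<real>" by (simp only: Reals_cnj_iff)
  then show "cfun (re_trig N c) x = ?s" by (simp only: apply_re_trig of_real_Re)
qed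

lemma continuous_on_cfun [continuous_intros]: "continuous_on S (cfun p)"
  by (intro continuous_on_of_real continuous_on_apply_bcontfun)

lemma real_valued_cfun: "real_valued (cfun p)"
  by (simp add: real_valued_def)

lemma norm_fourier_coeff_cfun: "cmod (\<F> (cfun p) k) \<le> norm p"
  using norm_bounded[of p] by (intro norm_fourier_coeff_le continuous_on_cfun) auto

text \<open>With \<open>bounded_linear_cfun_apply\<close>, this carries derivatives in the Banach
  space over to coefficients and point values.\<close>

lemma bounded_linear_fourier_coeff_cfun: "bounded_linear (\<lambda>p. \<F> (cfun p) k)"
proof (rule bounded_linear_intro[where K = 1])
  fix p q :: "real \<Rightarrow>\<^sub>C real" and r :: real
  show "\<F> (cfun (p + q)) k = \<F> (cfun p) k + \<F> (cfun q) k"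
    by (simp add: plus_bcontfun.rep_eq fourier_coeff_add continuous_on_cfun)
  show "\<F> (cfun (r *\<^sub>R p)) k = r *\<^sub>R \<F> (cfun p) k"
    by (simp add: scaleR_bcontfun.rep_eq fourier_coeff_cmult continuous_on_cfun scaleR_conv_of_real)
  show "norm (\<F> (cfun p) k) \<le> norm p * 1"
    using norm_fourier_coeff_cfun by simp
qed

lemma bounded_linear_cfun_apply: "bounded_linear (\<lambda>p. cfun p x)"
proof (rule bounded_linear_intro[where K = 1])
  show "norm (cfun p x) \<le> norm p * 1" for p
    using norm_bounded[of p x] by simp
qed (auto simp: plus_bcontfun.rep_eq scaleR_bcontfun.rep_eq scaleR_conv_of_real)

text \<open>The state ranges over all bounded continuous functions, so staying trigonometric has to
  be proved: at each \<open>x\<close> the defect between the state and its truncation has zero time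
  derivative and vanishes initially.\<close>

lemma re_trig_flow:
  assumes p0: "p 0 = re_trig N c0" "\<And>k. c0 (- k) = cnj (c0 k)"
    and dp: "\<And>t. t \<in> {0..s} \<Longrightarrow> (p has_vector_derivative re_trig N (c t)) (at t within {0..s})"
    and c: "\<And>t k. c t (- k) = cnj (c t k)"
    and t: "t \<in> {0..s}"
  shows "cfun (p t) \<in> trig_space N"
    and "((\<lambda>t. cfun (p t) x) has_vector_derivative (\<Sum>k\<in>freqs N. c t k * fourier_basis k x)) (at t within {0..s})"
proof -
  have re: "cfun (re_trig N (c t)) = (\<lambda>x. \<Sum>k\<in>freqs N. c t k * fourier_basis k x)" for t
    by (rule cfun_re_trig) (rule c)
  have d: "((\<lambda>t. cfun (p t) x) has_vector_derivative (\<Sum>k\<in>freqs N. c t k * fourier_basis k x)) (at t within {0..s})"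
    if "t \<in> {0..s}" for t x
    using bounded_linear.has_vector_derivative[OF bounded_linear_cfun_apply[of x] dp[OF that]]
    by (simp only: fun_cong[OF re])
  then show "((\<lambda>t. cfun (p t) x) has_vector_derivative (\<Sum>k\<in>freqs N. c t k * fourier_basis k x)) (at t within {0..s})"
    using t .
  have fc: "\<F> (cfun (re_trig N (c t))) k = c t k" if "k \<in> freqs N" for t k
    using fourier_coeff_trig[of "freqs N" "c t" k] that by (simp only: re) simp
  have "cfun (p t) x = trig_proj N (cfun (p t)) x" for x
  proof -
    let ?d = "\<lambda>t. cfun (p t) x - (\<Sum>k\<in>freqs N. \<F> (cfun (p t)) k * fourier_basis k x)"
    have "(?d has_vector_derivative ((\<Sum>k\<in>freqs N. c t k * fourier_basis k x)
        - (\<Sum>k\<in>freqs N. c t k * fourier_basis k x))) (at t within {0..s})" if t: "t \<in> {0..s}" for t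
    proof (intro has_vector_derivative_diff d t has_vector_derivative_sum has_vector_derivative_mult_left)
      fix k assume "k \<in> freqs N"
      then show "((\<lambda>t. \<F> (cfun (p t)) k) has_vector_derivative c t k) (at t within {0..s})"
        using bounded_linear.has_vector_derivative[OF bounded_linear_fourier_coeff_cfun dp[OF t], of k]
        by (simp only: fc)
    qed
    then have "\<And>t. t \<in> {0..s} \<Longrightarrow> (?d has_vector_derivative 0) (at t within {0..s})" by simp
    then obtain a where a: "\<And>t. t \<in> {0..s} \<Longrightarrow> ?d t = a"
      using has_vector_derivative_zero_constant[OF convex_real_interval(5)] by blast
    have "?d 0 = 0"
    proof -
      have re0: "cfun (re_trig N c0) = (\<lambda>x. \<Sum>k\<in>freqs N. c0 k * fourier_basis k x)"
        by (rule cfun_re_trig) (rule p0(2))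
      have "\<F> (cfun (p 0)) k = c0 k" if "k \<in> freqs N" for k
        using fourier_coeff_trig[of "freqs N" c0 k] that by (simp only: p0(1) re0) simp
      then have "(\<Sum>k\<in>freqs N. \<F> (cfun (p 0)) k * fourier_basis k x) = (\<Sum>k\<in>freqs N. c0 k * fourier_basis k x)"
        by (intro sum.cong refl) (simp only:)
      moreover have "cfun (p 0) x = (\<Sum>k\<in>freqs N. c0 k * fourier_basis k x)"
        using fun_cong[OF re0] by (simp only: p0(1))
      ultimately show ?thesis by simp
    qed
    moreover have "?d 0 = ?d t" using a[of 0] a[OF t] t by simp
    ultimately show ?thesis by (simp add: trig_proj_def)
  qed
  then have "cfun (p t) = trig_proj N (cfun (p t))" by (rule ext)
  then show "cfun (p t) \<in> trig_space N" using trig_proj_in_trig_space by metis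
qed

lemma ilw_coeff_cnj:
  assumes "continuous_on UNIV z" "continuous_on UNIV v" "real_valued z" "real_valued v"
  shows "ilw_coeff1 \<gamma> \<alpha> z v (- k) = cnj (ilw_coeff1 \<gamma> \<alpha> z v k)"
    and "ilw_coeff2 \<gamma> z v (- k) = cnj (ilw_coeff2 \<gamma> z v k)"
proof -
  have "real_valued (\<lambda>x. z x * v x)" "real_valued (\<lambda>x. (v x)\<^sup>2)"
    using assms by (auto simp: real_valued_def)
  then show "ilw_coeff1 \<gamma> \<alpha> z v (- k) = cnj (ilw_coeff1 \<gamma> \<alpha> z v k)"
    "ilw_coeff2 \<gamma> z v (- k) = cnj (ilw_coeff2 \<gamma> z v k)"
    using assms by (simp_all add: ilw_coeff1_def ilw_coeff2_def deriv_symbol_uminus smooth_symbol_uminus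
      lin_symbol_uminus fourier_coeff_real continuous_intros)
qed

text \<open>The Galerkin system is posed on pairs of bounded continuous real functions, where its right-hand
  side has finite rank; the flow preserves trigonometric polynomials.\<close>

definition galerkin_field :: "real \<Rightarrow> real \<Rightarrow> nat \<Rightarrow> (real \<Rightarrow>\<^sub>C real) \<times> (real \<Rightarrow>\<^sub>C real) \<Rightarrow> (real \<Rightarrow>\<^sub>C real) \<times> (real \<Rightarrow>\<^sub>C real)" where
  "galerkin_field \<gamma> \<alpha> N X = (re_trig N (ilw_coeff1 \<gamma> \<alpha> (cfun (fst X)) (cfun (snd X))),
     re_trig N (ilw_coeff2 \<gamma> (cfun (fst X)) (cfun (snd X))))"

lemma fourier_coeff_product_lipschitz:
  assumes "norm p \<le> R" "norm q \<le> R" "norm p' \<le> R" "norm q' \<le> R" "norm (p - p') \<le> d" "norm (q - q') \<le> d"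
  shows "cmod (\<F> (\<lambda>x. cfun p x * cfun q x) k - \<F> (\<lambda>x. cfun p' x * cfun q' x) k) \<le> 2 * R * d"
proof -
  have "\<F> (\<lambda>x. cfun p x * cfun q x) k - \<F> (\<lambda>x. cfun p' x * cfun q' x) k
      = \<F> (\<lambda>x. cfun p x * cfun q x - cfun p' x * cfun q' x) k"
    by (intro fourier_coeff_diff[symmetric] continuous_intros continuous_on_apply_bcontfun)
  also have "cmod \<dots> \<le> 2 * R * d"
  proof (intro norm_fourier_coeff_le continuous_intros continuous_on_apply_bcontfun)
    fix x
    have R: "0 \<le> R" using assms(1) norm_ge_zero order_trans by blast
    have b: "\<bar>p x\<bar> \<le> R" "\<bar>q' x\<bar> \<le> R" "\<bar>p x - p' x\<bar> \<le> d" "\<bar>q x - q' x\<bar> \<le> d"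
      using norm_bounded[of p x] norm_bounded[of q' x] norm_bounded[of "p - p'" x] norm_bounded[of "q - q'" x] assms
      by (auto simp: minus_bcontfun.rep_eq)
    have "cfun p x * cfun q x - cfun p' x * cfun q' x = of_real (p x * (q x - q' x) + (p x - p' x) * q' x)"
      by (simp add: algebra_simps)
    also have "cmod \<dots> \<le> \<bar>p x * (q x - q' x)\<bar> + \<bar>(p x - p' x) * q' x\<bar>"
      by (simp only: norm_of_real abs_triangle_ineq)
    also have "\<dots> \<le> R * d + d * R"
      using b R by (intro add_mono) (auto simp: abs_mult intro!: mult_mono)
    finally show "cmod (cfun p x * cfun q x - cfun p' x * cfun q' x) \<le> 2 * R * d" by simp
  qed
  finally show ?thesis .
qed

text \<open>Origin of the constant: two components, \<open>2 * real N + 1\<close> frequencies, the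
  derivative symbol at most \<open>2 * pi * real N\<close>, and per frequency \<open>2 * R\<close>
  from the products plus 1 from the linear part, over \<open>\<gamma>\<close>. The final 1 keeps it
  positive.\<close>

lemma galerkin_field_lipschitz:
  assumes \<gamma>: "0 < \<gamma>" "\<gamma> < 1" and \<alpha>: "\<alpha> > 1" and XY: "norm X \<le> R" "norm Y \<le> R"
  shows "norm (galerkin_field \<gamma> \<alpha> N X - galerkin_field \<gamma> \<alpha> N Y)
    \<le> (2 * ((2 * real N + 1) * (2 * pi * real N * (1 / \<gamma> * (2 * R + 1)))) + 1) * norm (X - Y)"
proof -
  obtain p q p' q' where X: "X = (p, q)" and Y: "Y = (p', q')" by (metis surj_pair)
  define d where "d = norm (X - Y)"
  have d: "norm (p - p') \<le> d" "norm (q - q') \<le> d"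
    using norm_fst_le[of "p - p'" "q - q'"] norm_snd_le[of "q - q'" "p - p'"] by (auto simp: X Y d_def)
  have R: "norm p \<le> R" "norm q \<le> R" "norm p' \<le> R" "norm q' \<le> R"
    using norm_fst_le[of p q] norm_snd_le[of q p] norm_fst_le[of p' q'] norm_snd_le[of q' p'] XY
    unfolding X Y by linarith+
  have R0: "0 \<le> R" and d0: "0 \<le> d" using R(1) norm_ge_zero[of p] by (linarith, simp add: d_def)
  let ?c1 = "ilw_coeff1 \<gamma> \<alpha> (cfun p) (cfun q)" and ?c1' = "ilw_coeff1 \<gamma> \<alpha> (cfun p') (cfun q')"
  let ?c2 = "ilw_coeff2 \<gamma> (cfun p) (cfun q)" and ?c2' = "ilw_coeff2 \<gamma> (cfun p') (cfun q')"
  let ?pq = "\<lambda>k. \<F> (\<lambda>x. cfun p x * cfun q x) k - \<F> (\<lambda>x. cfun p' x * cfun q' x) k"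
  let ?qq = "\<lambda>k. \<F> (\<lambda>x. cfun q x * cfun q x) k - \<F> (\<lambda>x. cfun q' x * cfun q' x) k"
  let ?K = "2 * pi * real N * (1 / \<gamma> * (2 * R + 1) * d)"
  have lin: "cmod (\<F> (cfun r) k - \<F> (cfun r') k) \<le> d" if "norm (r - r') \<le> d" for r r' k
    using order_trans[OF norm_fourier_coeff_cfun that, of k]
    by (simp only: bounded_linear.linear[OF bounded_linear_fourier_coeff_cfun, THEN linear_diff])
  have two: "cmod (of_real a * A - of_real b * B) \<le> 1 / \<gamma> * (2 * R + 1) * d"
    if "\<bar>a\<bar> \<le> 1 / \<gamma>" "\<bar>b\<bar> \<le> 1 / \<gamma>" "cmod A \<le> 2 * R * d" "cmod B \<le> d" for a b A B
  proof -
    have "cmod (of_real a * A - of_real b * B) \<le> \<bar>a\<bar> * (2 * R * d) + \<bar>b\<bar> * d"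
      by (rule norm_weighted_diff_le[OF that(3,4)])
    also have "\<dots> \<le> 1 / \<gamma> * (2 * R * d) + 1 / \<gamma> * d"
      using that R0 d0 by (intro add_mono mult_right_mono) auto
    also have "\<dots> = 1 / \<gamma> * (2 * R + 1) * d" by (simp add: algebra_simps add_divide_distrib)
    finally show ?thesis .
  qed
  have c1: "cmod (?c1 k - ?c1' k) \<le> ?K"
    if "k \<in> freqs N" for k
  proof -
    have "?c1 k - ?c1' k
      = deriv_symbol k * (of_real (smooth_symbol \<gamma> \<alpha> k / \<gamma>)
          * (?pq k)
        - of_real (lin_symbol \<gamma> \<alpha> k / \<gamma>) * (\<F> (cfun q) k - \<F> (cfun q') k))"
      by (simp only: ilw_coeff1_def right_diff_distrib) simp
    moreover have "cmod (of_real (smooth_symbol \<gamma> \<alpha> k / \<gamma>)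
          * (?pq k)
        - of_real (lin_symbol \<gamma> \<alpha> k / \<gamma>) * (\<F> (cfun q) k - \<F> (cfun q') k))
      \<le> 1 / \<gamma> * (2 * R + 1) * d"
    proof (rule two[OF _ _ fourier_coeff_product_lipschitz[OF R d] lin[OF d(2)]])
      show "\<bar>smooth_symbol \<gamma> \<alpha> k / \<gamma>\<bar> \<le> 1 / \<gamma>"
        using smooth_symbol_pos[OF \<gamma>(1) \<alpha>, of k] smooth_symbol_le_1[OF \<gamma>(1) \<alpha>, of k] \<gamma>
        by (simp add: divide_right_mono)
      show "\<bar>lin_symbol \<gamma> \<alpha> k / \<gamma>\<bar> \<le> 1 / \<gamma>"
        using lin_symbol_pos[OF \<gamma>(1) \<alpha>, of k] lin_symbol_le_1[OF \<gamma>(1) \<alpha>, of k] \<gamma>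
        by (simp add: divide_right_mono)
    qed
    ultimately show ?thesis using norm_deriv_symbol_le[OF that] by (simp only: norm_mult) (intro mult_mono, auto)
  qed
  have c2: "cmod (?c2 k - ?c2' k) \<le> ?K"
    if "k \<in> freqs N" for k
  proof -
    have "?c2 k - ?c2' k
      = deriv_symbol k * (of_real (1 / (2 * \<gamma>))
          * (?qq k)
        - of_real (1 - \<gamma>) * (\<F> (cfun p) k - \<F> (cfun p') k))"
      by (simp only: ilw_coeff2_def right_diff_distrib power2_eq_square) simp
    moreover have "cmod (of_real (1 / (2 * \<gamma>))
          * (?qq k)
        - of_real (1 - \<gamma>) * (\<F> (cfun p) k - \<F> (cfun p') k))
      \<le> 1 / \<gamma> * (2 * R + 1) * d"
    proof (rule two[OF _ _ fourier_coeff_product_lipschitz[OF R(2,2,4,4) d(2,2)] lin[OF d(1)]])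
      show "\<bar>1 / (2 * \<gamma>)\<bar> \<le> 1 / \<gamma>" using \<gamma> by (simp add: field_simps)
      have "1 \<le> 1 / \<gamma>" using \<gamma> by simp
      then show "\<bar>1 - \<gamma>\<bar> \<le> 1 / \<gamma>" using \<gamma> by linarith
    qed
    ultimately show ?thesis using norm_deriv_symbol_le[OF that] by (simp only: norm_mult) (intro mult_mono, auto)
  qed
  have sum: "(\<Sum>k\<in>freqs N. cmod (c k - c' k)) \<le> (2 * real N + 1) * ?K"
    if "\<And>k. k \<in> freqs N \<Longrightarrow> cmod (c k - c' k) \<le> ?K" for c c' :: "int \<Rightarrow> complex"
    using sum_bounded_above[of "freqs N" "\<lambda>k. cmod (c k - c' k)" ?K] that by simp
  have "norm (galerkin_field \<gamma> \<alpha> N X - galerkin_field \<gamma> \<alpha> N Y)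
      \<le> norm (re_trig N (?c1) - re_trig N (?c1'))
        + norm (re_trig N (?c2) - re_trig N (?c2'))"
    unfolding galerkin_field_def X Y fst_conv snd_conv diff_Pair by (rule norm_Pair_le)
  also have "\<dots> \<le> (2 * real N + 1) * ?K + (2 * real N + 1) * ?K"
    by (intro add_mono order_trans[OF norm_re_trig_diff] sum c1 c2)
  also have "\<dots> \<le> (2 * ((2 * real N + 1) * (2 * pi * real N * (1 / \<gamma> * (2 * R + 1)))) + 1) * d"
    using d0 by (simp add: algebra_simps)
  finally show ?thesis unfolding d_def .
qed

context ilw_setting
begin

text \<open>The vector field is defined by coefficients. The pointwise equations return because each
  Galerkin right-hand side lies in the trigonometric space and so equals the sum of its own Fourier
  terms.\<close>

lemma galerkin_field_solution:
  fixes N :: nat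
  defines "X0 \<equiv> (re_trig N (\<F> \<zeta>\<^sub>0), re_trig N (\<F> u\<^sub>0))"
  assumes s: "0 < s" and w0: "w 0 = X0"
    and w: "\<And>t. t \<in> {0..s} \<Longrightarrow> (w has_vector_derivative galerkin_field \<gamma> \<alpha> N (w t)) (at t within {0..s})"
  shows "ilw_galerkin_solution \<gamma> \<alpha> s N \<zeta>\<^sub>0 u\<^sub>0 (\<lambda>t. cfun (fst (w t))) (\<lambda>t. cfun (snd (w t)))"
proof -
  let ?p = "\<lambda>t. fst (w t)" and ?q = "\<lambda>t. snd (w t)"
  let ?c1 = "\<lambda>t. ilw_coeff1 \<gamma> \<alpha> (cfun (?p t)) (cfun (?q t))" and ?c2 = "\<lambda>t. ilw_coeff2 \<gamma> (cfun (?p t)) (cfun (?q t))"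
  let ?r1 = "\<lambda>t. galerkin_rhs1 \<gamma> \<alpha> N (cfun (?p t)) (cfun (?q t))" and ?r2 = "\<lambda>t. galerkin_rhs2 \<gamma> N (cfun (?p t)) (cfun (?q t))"
  have "0 \<in> {0..T}" using T by simp
  note init = w\<zeta>[OF this, unfolded initial] wu[OF this, unfolded initial]
    real_\<zeta>[OF this, unfolded initial] real_u[OF this, unfolded initial]
  have sym0: "\<F> \<zeta>\<^sub>0 (- k) = cnj (\<F> \<zeta>\<^sub>0 k)" "\<F> u\<^sub>0 (- k) = cnj (\<F> u\<^sub>0 k)" for k
    by (rule fourier_coeff_real[OF wiener1_continuous[OF init(1)] init(3)]
        fourier_coeff_real[OF wiener1_continuous[OF init(2)] init(4)])+
  have p0: "?p 0 = re_trig N (\<F> \<zeta>\<^sub>0)" and q0: "?q 0 = re_trig N (\<F> u\<^sub>0)"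
    by (simp_all add: w0 X0_def)
  have dp: "(?p has_vector_derivative re_trig N (?c1 t)) (at t within {0..s})"
    and dq: "(?q has_vector_derivative re_trig N (?c2 t)) (at t within {0..s})"
    if "t \<in> {0..s}" for t
    using bounded_linear.has_vector_derivative[OF bounded_linear_fst w[OF that]]
      bounded_linear.has_vector_derivative[OF bounded_linear_snd w[OF that]]
    by (simp_all add: galerkin_field_def)
  note c = ilw_coeff_cnj[OF continuous_on_cfun continuous_on_cfun real_valued_cfun real_valued_cfun]
  have p: "cfun (?p t) \<in> trig_space N"
    "((\<lambda>t. cfun (?p t) x) has_vector_derivative
      (\<Sum>k\<in>freqs N. ?c1 t k * fourier_basis k x)) (at t within {0..s})"
    if "t \<in> {0..s}" for t x
    by (rule re_trig_flow[where p = ?p and N = N and s = s, OF p0 sym0(1)]; (rule dp c that)?; assumption?)+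
  have q: "cfun (?q t) \<in> trig_space N"
    "((\<lambda>t. cfun (?q t) x) has_vector_derivative
      (\<Sum>k\<in>freqs N. ?c2 t k * fourier_basis k x)) (at t within {0..s})"
    if "t \<in> {0..s}" for t x
    by (rule re_trig_flow[where p = ?q and N = N and s = s, OF q0 sym0(2)]; (rule dq c that)?; assumption?)+
  have rhs: "(\<Sum>k\<in>freqs N. ?c1 t k * fourier_basis k x)
        = ?r1 t x"
    "(\<Sum>k\<in>freqs N. ?c2 t k * fourier_basis k x)
        = ?r2 t x"
    if t: "t \<in> {0..s}" for t x
  proof -
    note r = galerkin_rhs[OF \<gamma>(1) \<alpha> p(1)[OF t] q(1)[OF t]]
    have "?r1 t x = trig_proj N (?r1 t) x"
      by (simp only: trig_spaceD(4)[OF r(1)])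
    then show "(\<Sum>k\<in>freqs N. ?c1 t k * fourier_basis k x)
        = ?r1 t x"
      unfolding trig_proj_def by (simp only: r(3) cong: sum.cong)
    have "?r2 t x = trig_proj N (?r2 t) x"
      by (simp only: trig_spaceD(4)[OF r(2)])
    then show "(\<Sum>k\<in>freqs N. ?c2 t k * fourier_basis k x)
        = ?r2 t x"
      unfolding trig_proj_def by (simp only: r(4) cong: sum.cong)
  qed
  have dt: "dt_exists s (\<lambda>t. cfun (?p t)) t x" "dt_exists s (\<lambda>t. cfun (?q t)) t x"
    "dt s (\<lambda>t. cfun (?p t)) t x = ?r1 t x"
    "dt s (\<lambda>t. cfun (?q t)) t x = ?r2 t x"
    if t: "t \<in> {0..s}" for t x
    using p(2)[OF t, of x] q(2)[OF t, of x] s t unfolding dt_exists_def dt_def rhs[OF t]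
    by (auto intro!: differentiableI_vector vector_derivative_within_closed_interval)
  have start: "cfun (?p 0) = trig_proj N \<zeta>\<^sub>0" "cfun (?q 0) = trig_proj N u\<^sub>0"
    by (simp_all only: p0 q0 cfun_re_trig[of "\<F> \<zeta>\<^sub>0", OF sym0(1)]
      cfun_re_trig[of "\<F> u\<^sub>0", OF sym0(2)] trig_proj_eq)
  show ?thesis
    unfolding ilw_galerkin_solution_def
  proof (intro conjI ballI allI)
    fix t x assume t: "t \<in> {0..s}"
    show "dt s (\<lambda>t. cfun (?p t)) t x + of_real (1 / \<gamma>) * ilw_lin \<gamma> \<alpha> (dx (cfun (?q t))) x
          = of_real (1 / \<gamma>) * ilw_inv \<gamma> \<alpha> (dx (trig_proj N (\<lambda>y. cfun (?p t) y * cfun (?q t) y))) x"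
      by (simp only: dt(3)[OF t] galerkin_rhs1_def[OF \<gamma>(1) \<alpha>] diff_add_cancel)
    show "dt s (\<lambda>t. cfun (?q t)) t x + of_real (1 - \<gamma>) * dx (cfun (?p t)) x
          = of_real (1 / (2 * \<gamma>)) * dx (trig_proj N (\<lambda>y. (cfun (?q t) y)\<^sup>2)) x"
      by (simp only: dt(4)[OF t] galerkin_rhs2_def[OF \<gamma>(1) \<alpha>] diff_add_cancel)
  qed (use p(1) q(1) dt start real_valued_cfun in auto)
qed

text \<open>A crude bound that may grow with N: it only fixes the radius of the ball used for
  existence.\<close>

lemma norm_trig_space_le:
  assumes "zn \<in> trig_space N" "wiener1 M z"
    and "coeff_dist N zn z \<le> E"
  shows "cmod (zn x) \<le> (2 * real N + 1) * (sqrt E + M)"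
proof -
  have "cmod (\<F> zn k) \<le> sqrt E + M" if "k \<in> freqs N" for k
  proof -
    have "(cmod (\<F> zn k - \<F> z k))\<^sup>2
        \<le> coeff_dist N zn z"
      by (rule member_le_sum[OF that]) auto
    then have "cmod (\<F> zn k - \<F> z k) \<le> sqrt E"
      using assms(3) by (intro real_le_rsqrt) linarith
    moreover have "cmod (\<F> z k) \<le> M"
      by (rule norm_fourier_coeff_le[OF wiener1_continuous[OF assms(2)] wiener1_bound[OF assms(2)]])
    ultimately show ?thesis using norm_triangle_sub[of "\<F> zn k" "\<F> z k"] by linarith
  qed
  then have "(\<Sum>k\<in>freqs N. cmod (\<F> zn k)) \<le> (2 * real N + 1) * (sqrt E + M)"
    using sum_bounded_above[of "freqs N" "\<lambda>k. cmod (\<F> zn k)" "sqrt E + M"] by simp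
  moreover have "cmod (trig_proj N zn x) \<le> (\<Sum>k\<in>freqs N. cmod (\<F> zn k))"
    unfolding trig_proj_def by (rule order_trans[OF norm_sum]) (simp add: norm_mult)
  ultimately show ?thesis by (simp only: trig_spaceD(4)[OF assms(1)])
qed

lemma galerkin_existence:
  assumes N: "N \<ge> 1" "real N * error_bound N \<le> 1"
  shows "\<exists>zn un. ilw_galerkin_solution \<gamma> \<alpha> T N \<zeta>\<^sub>0 u\<^sub>0 zn un"
proof -
  define Q where "Q = (2 * real N + 1) * (sqrt (error_bound N) + M)"
  \<comment> \<open>\<open>Q\<close> bounds each component, the norm of a pair is at most the sum of
    the two norms, and the 1 makes the bound strict.\<close>
  define R where "R = 2 * Q + 1"
  define X0 where "X0 = (re_trig N (\<F> \<zeta>\<^sub>0), re_trig N (\<F> u\<^sub>0))"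
  define L where "L = 2 * ((2 * real N + 1) * (2 * pi * real N * (1 / \<gamma> * (2 * R + 1)))) + 1"
  have Q0: "0 \<le> Q" using M_nonneg error_bound_nonneg by (simp add: Q_def)
  then have L: "L > 0" using \<gamma> unfolding L_def R_def by (intro add_nonneg_pos mult_nonneg_nonneg) auto
  have pair_bound: "norm X < R" if "\<And>x. cmod (cfun (fst X) x) \<le> Q" "\<And>x. cmod (cfun (snd X) x) \<le> Q" for X
  proof -
    have "norm (fst X) \<le> Q" "norm (snd X) \<le> Q" using that by (auto intro: norm_bound)
    then show ?thesis using norm_Pair_le[of "fst X" "snd X"] by (simp add: R_def)
  qed
  have sol_bound: "norm (w s) < R"
    if s: "0 < s" "s \<le> T" and w: "w 0 = X0"
      "\<And>t. t \<in> {0..s} \<Longrightarrow> (w has_vector_derivative galerkin_field \<gamma> \<alpha> N (w t)) (at t within {0..s})" for s w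
  proof -
    have gal: "ilw_galerkin_solution \<gamma> \<alpha> s N \<zeta>\<^sub>0 u\<^sub>0 (\<lambda>t. cfun (fst (w t))) (\<lambda>t. cfun (snd (w t)))"
      using s w unfolding X0_def by (intro galerkin_field_solution)
    have mem: "s \<in> {0..s}" "s \<in> {0..T}" using s by auto
    have ts: "cfun (fst (w s)) \<in> trig_space N" "cfun (snd (w s)) \<in> trig_space N"
      using gal mem(1) unfolding ilw_galerkin_solution_def by blast+
    note err = galerkin_coefficient_error[OF N less_imp_le[OF s(1)] s(2) gal mem(1)]
    show ?thesis
      using norm_trig_space_le[OF ts(1) w\<zeta>[OF mem(2)] err(1)] norm_trig_space_le[OF ts(2) wu[OF mem(2)] err(2)]
      unfolding Q_def[symmetric] by (intro pair_bound)
  qed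
  have X0: "norm X0 < R"
  proof (rule pair_bound)
    have "0 \<in> {0..T}" using T by simp
    note init = w\<zeta>[OF this, unfolded initial] wu[OF this, unfolded initial]
    have MQ: "M \<le> Q"
    proof -
      have "1 * M \<le> (2 * real N + 1) * (sqrt (error_bound N) + M)"
        using M_nonneg error_bound_nonneg by (intro mult_mono) auto
      then show ?thesis by (simp add: Q_def)
    qed
    have re: "cmod (of_real (Re c)) \<le> cmod c" for c using abs_Re_le_cmod by simp
    show "cmod (cfun (fst X0) x) \<le> Q" for x
      using order_trans[OF re order_trans[OF wiener1_bound[OF wiener1_trig_proj[OF init(1)]] MQ]]
      by (simp only: X0_def fst_conv apply_re_trig trig_proj_def)
    show "cmod (cfun (snd X0) x) \<le> Q" for x
      using order_trans[OF re order_trans[OF wiener1_bound[OF wiener1_trig_proj[OF init(2)]] MQ]]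
      by (simp only: X0_def snd_conv apply_re_trig trig_proj_def)
  qed
  obtain w where "w 0 = X0"
    "\<And>t. t \<in> {0..T} \<Longrightarrow> (w has_vector_derivative galerkin_field \<gamma> \<alpha> N (w t)) (at t within {0..T})"
  proof (rule ode_a_priori[of L T X0 R "galerkin_field \<gamma> \<alpha> N", OF L T X0])
    show "norm (galerkin_field \<gamma> \<alpha> N X - galerkin_field \<gamma> \<alpha> N Y) \<le> L * norm (X - Y)"
      if "norm X \<le> R" "norm Y \<le> R" for X Y
      unfolding L_def by (rule galerkin_field_lipschitz[OF \<gamma> \<alpha> that])
  qed (rule sol_bound, assumption+, blast)
  then show ?thesis unfolding X0_def using galerkin_field_solution[OF T] by blast
qed

end

theorem proposition2p1:
  fixes \<gamma> \<alpha> T \<mu> :: real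
    and \<zeta>\<^sub>0 u\<^sub>0 :: "real \<Rightarrow> complex"
    and \<zeta> u :: "real \<Rightarrow> real \<Rightarrow> complex"
  assumes "0 < \<gamma>" and "\<gamma> < 1" and "\<alpha> > 1" and "T > 0" and "\<mu> > 3 / 2"
    and "real_valued \<zeta>\<^sub>0" and "smooth \<zeta>\<^sub>0" and "periodic1 \<zeta>\<^sub>0"
    and "real_valued u\<^sub>0" and "smooth u\<^sub>0" and "periodic1 u\<^sub>0"
    and "ilw_solution \<gamma> \<alpha> T \<mu> \<zeta>\<^sub>0 u\<^sub>0 \<zeta> u"
    and "\<And>\<zeta>' u'. ilw_solution \<gamma> \<alpha> T \<mu> \<zeta>\<^sub>0 u\<^sub>0 \<zeta>' u' \<Longrightarrow>
           \<forall>t\<in>{0..T}. \<zeta>' t = \<zeta> t \<and> u' t = u t"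
  shows "\<exists>(C::real) (N\<^sub>0::nat). 1 \<le> N\<^sub>0 \<and> (\<forall>N\<ge>N\<^sub>0.
           (\<exists>\<zeta>\<^sub>N u\<^sub>N. ilw_galerkin_solution \<gamma> \<alpha> T N \<zeta>\<^sub>0 u\<^sub>0 \<zeta>\<^sub>N u\<^sub>N) \<and>
           (\<forall>\<zeta>\<^sub>N u\<^sub>N. ilw_galerkin_solution \<gamma> \<alpha> T N \<zeta>\<^sub>0 u\<^sub>0 \<zeta>\<^sub>N u\<^sub>N \<longrightarrow>
              (\<forall>t\<in>{0..T}. L2_norm (\<lambda>x. \<zeta>\<^sub>N t x - \<zeta> t x) + L2_norm (\<lambda>x. u\<^sub>N t x - u t x)
                 \<le> C * real N powr (1 - \<mu>))))"
proof -
  have sob: "continuous_in_sobolev T \<mu> \<zeta>" "continuous_in_sobolev T \<mu> u"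
    and cont: "\<And>t. t \<in> {0..T} \<Longrightarrow> continuous_on UNIV (\<zeta> t)" "\<And>t. t \<in> {0..T} \<Longrightarrow> continuous_on UNIV (u t)"
    using assms(12) by (auto simp: ilw_solution_def)
  obtain B1 where B1: "\<And>t. t \<in> {0..T} \<Longrightarrow> (sobolev_norm \<mu> (\<zeta> t))\<^sup>2 \<le> B1"
    using sobolev_norm_bounded[OF sob(1) cont(1) \<open>T > 0\<close>] by blast
  obtain B2 where B2: "\<And>t. t \<in> {0..T} \<Longrightarrow> (sobolev_norm \<mu> (u t))\<^sup>2 \<le> B2"
    using sobolev_norm_bounded[OF sob(2) cont(2) \<open>T > 0\<close>] by blast
  define B where "B = max B1 B2"
  have B: "(sobolev_norm \<mu> (\<zeta> t))\<^sup>2 \<le> B" "(sobolev_norm \<mu> (u t))\<^sup>2 \<le> B" if "t \<in> {0..T}" for t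
    using B1[OF that] B2[OF that] by (auto simp: B_def)
  have sp: "\<zeta> t \<in> sobolev_space \<mu>" "u t \<in> sobolev_space \<mu>" if "t \<in> {0..T}" for t
    using sob that by (auto simp: continuous_in_sobolev_def)
  have tail: "L2_norm (\<lambda>x. v x - trig_proj N v x) \<le> sqrt B * real N powr (- \<mu>)"
    if "v \<in> sobolev_space \<mu>" "continuous_on UNIV v" "(sobolev_norm \<mu> v)\<^sup>2 \<le> B" "N \<ge> 1" for v N
  proof -
    have "sobolev_norm \<mu> v \<le> sqrt B" using that(3) by (rule real_le_rsqrt)
    then have "real N powr (- \<mu>) * sobolev_norm \<mu> v \<le> real N powr (- \<mu>) * sqrt B" by (rule mult_left_mono) simp
    then show ?thesis using trig_proj_tail[OF \<open>\<mu> > 3 / 2\<close> that(1,2,4)] by (simp add: mult.commute)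
  qed
  \<comment> \<open>The first constant is that of \<open>wiener1_sobolev\<close>; the tail constant
    is \<open>sqrt B\<close>, since \<open>B\<close> bounds the squared Sobolev norms.\<close>
  interpret ilw_setting \<gamma> \<alpha> T \<mu> \<zeta>\<^sub>0 u\<^sub>0 \<zeta> u "(sobolev_weight_sum \<mu> + B) / 2" "sqrt B"
  proof
    show "0 < \<gamma>" "\<gamma> < 1" "\<alpha> > 1" "T > 0" "\<mu> > 3 / 2" "ilw_solution \<gamma> \<alpha> T \<mu> \<zeta>\<^sub>0 u\<^sub>0 \<zeta> u" by fact+
    fix t assume t: "t \<in> {0..T}"
    show "wiener1 ((sobolev_weight_sum \<mu> + B) / 2) (\<zeta> t)"
      by (rule wiener1_sobolev[OF \<open>\<mu> > 3 / 2\<close> sp(1)[OF t] cont(1)[OF t] B(1)[OF t]])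
    show "wiener1 ((sobolev_weight_sum \<mu> + B) / 2) (u t)"
      by (rule wiener1_sobolev[OF \<open>\<mu> > 3 / 2\<close> sp(2)[OF t] cont(2)[OF t] B(2)[OF t]])
    fix N :: nat assume N: "N \<ge> 1"
    show "L2_norm (\<lambda>x. \<zeta> t x - trig_proj N (\<zeta> t) x) \<le> sqrt B * real N powr (- \<mu>)"
      by (rule tail[OF sp(1)[OF t] cont(1)[OF t] B(1)[OF t] N])
    show "L2_norm (\<lambda>x. u t x - trig_proj N (u t) x) \<le> sqrt B * real N powr (- \<mu>)"
      by (rule tail[OF sp(2)[OF t] cont(2)[OF t] B(2)[OF t] N])
  qed
  define D where "D = sqrt (2 * (exp (growth * T) / coercivity) + 2 * (sqrt B)\<^sup>2)"
  \<comment> \<open>N times \<open>error_bound N\<close> is a constant times N^(3 - 2 \<mu>), a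
    negative power for \<mu> > 3/2; this determines how large N must be.\<close>
  have "((\<lambda>N. real N powr (3 - 2 * \<mu>) * (exp (growth * T) / coercivity)) \<longlongrightarrow> 0 * (exp (growth * T) / coercivity)) sequentially"
    using \<open>\<mu> > 3 / 2\<close>
    by (intro tendsto_mult tendsto_const tendsto_neg_powr filterlim_real_sequentially) auto
  then have "eventually (\<lambda>N. real N powr (3 - 2 * \<mu>) * (exp (growth * T) / coercivity) < 1) sequentially"
    by (rule order_tendstoD) simp
  then obtain N1 where N1: "\<And>N. N \<ge> N1 \<Longrightarrow> real N powr (3 - 2 * \<mu>) * (exp (growth * T) / coercivity) < 1"
    by (auto simp: eventually_sequentially)
  have small: "real N * error_bound N \<le> 1" if "N \<ge> N1" "N \<ge> 1" for N
  proof -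
    have "real N * error_bound N = (real N powr 1 * real N powr (2 - 2 * \<mu>)) * (exp (growth * T) / coercivity)"
      using that(2) by (simp add: error_bound_def)
    also have "real N powr 1 * real N powr (2 - 2 * \<mu>) = real N powr (3 - 2 * \<mu>)"
      by (subst powr_add[symmetric]) simp
    finally show ?thesis using N1[OF that(1)] by simp
  qed
  show ?thesis
  \<comment> \<open>One \<open>D\<close> for each of the two components; the maximum with 1 makes
    the tail estimates applicable.\<close>
  proof (intro exI[of _ "2 * D"] exI[of _ "max N1 1"] conjI allI impI ballI)
    fix N assume "max N1 1 \<le> N"
    then have N: "N \<ge> 1" "real N * error_bound N \<le> 1" using small by auto
    show "\<exists>\<zeta>\<^sub>N u\<^sub>N. ilw_galerkin_solution \<gamma> \<alpha> T N \<zeta>\<^sub>0 u\<^sub>0 \<zeta>\<^sub>N u\<^sub>N"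
      by (rule galerkin_existence[OF N])
    fix \<zeta>\<^sub>N u\<^sub>N t
    assume gal: "ilw_galerkin_solution \<gamma> \<alpha> T N \<zeta>\<^sub>0 u\<^sub>0 \<zeta>\<^sub>N u\<^sub>N" and t: "t \<in> {0..T}"
    have ts: "\<zeta>\<^sub>N t \<in> trig_space N" "u\<^sub>N t \<in> trig_space N"
      using gal t unfolding ilw_galerkin_solution_def by blast+
    note err = galerkin_coefficient_error[OF N _ order_refl gal t]
    have "L2_norm (\<lambda>x. \<zeta>\<^sub>N t x - \<zeta> t x) \<le> D * real N powr (1 - \<mu>)"
      unfolding D_def using T by (intro L2_error_aux[OF N(1) ts(1) w\<zeta>[OF t] err(1) tail\<zeta>[OF t N(1)]]) simp
    moreover have "L2_norm (\<lambda>x. u\<^sub>N t x - u t x) \<le> D * real N powr (1 - \<mu>)"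
      unfolding D_def using T by (intro L2_error_aux[OF N(1) ts(2) wu[OF t] err(2) tailu[OF t N(1)]]) simp
    ultimately show "L2_norm (\<lambda>x. \<zeta>\<^sub>N t x - \<zeta> t x) + L2_norm (\<lambda>x. u\<^sub>N t x - u t x) \<le> 2 * D * real N powr (1 - \<mu>)"
      by simp
  qed simp
qed

end
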